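(* Let $G$ be a metrizable totally disconnected, locally compact group, let $H$ be a closed subgroup of $G$ of finite covolume, let $\mathcal{U}$ be the set of identity neighbourhoods in $G$ and define $K(H) := \bigcap_{U \in \mathcal{U}}HUH$. (i) We have \[ G^\dagger \le \mathrm{Dist}^*_{G/H}(H) = \overline{K(H)}. \] (ii) The group $D = \mathrm{Dist}^*_{G/H}(H)$ is the unique largest closed subgroup $D$ of $G$ such that $H \le D$ and $H$ acts ergodically on $D/H$.
   Context: Topological groups are Hausdorff. A closed subgroup $H \le G$ has finite covolume if $G/H$ carries a $G$-invariant Borel probability measure; in that case, for every closed subgroup $D$ with $H\le D\le G$, $H$ has finite covolume in $D$, and ergodicity of the action of $H$ on $D/H$ by left translation is with respect to the $D$-invariant Borel probability measure on $D/H$. For $g\in G$, $\mathrm{con}(g) = \{x \in G \mid g^n x g^{-n} \to 1 \text{ as } n \to +\infty\}$; the Tits core is the abstract subgroup $G^\dagger := \langle \overline{\mathrm{con}(g)} \mid g \in G\rangle$. $\mathrm{Dist}^*_{G/H}(H)$ denotes the smallest closed subgroup $E$ of $G$ with $H \le E$ such that the action of $H$ on $G/E$ (by conjugation, or equivalently, since $H \le E$, by left translation) is distal at $1$, meaning that the trivial coset does not lie in the closure of the $H$-orbit of any non-trivial coset; such a smallest subgroup exists. *)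

theory Defs
  imports "HOL-Analysis.Analysis" "HOL-Algebra.Left_Coset" "HOL-Algebra.Generated_Groups"
begin

definition topological_group :: "('a, 'b) monoid_scheme \<Rightarrow> 'a topology \<Rightarrow> bool" where
  "topological_group G T \<longleftrightarrow>
     group G \<and> topspace T = carrier G \<and> Hausdorff_space T \<and>
     continuous_map (prod_topology T T) T (\<lambda>(x, y). x \<otimes>\<^bsub>G\<^esub> y) \<and>
     continuous_map T T (\<lambda>x. inv\<^bsub>G\<^esub> x)"

definition totally_disconnected_space :: "'a topology \<Rightarrow> bool" where
  "totally_disconnected_space T \<longleftrightarrow>
     (\<forall>x \<in> topspace T. connected_component_of_set T x = {x})"

definition closed_subgroup :: "('a, 'b) monoid_scheme \<Rightarrow> 'a topology \<Rightarrow> 'a set \<Rightarrow> bool" where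
  "closed_subgroup G T H \<longleftrightarrow> subgroup H G \<and> closedin T H"

definition contraction_group :: "('a, 'b) monoid_scheme \<Rightarrow> 'a topology \<Rightarrow> 'a \<Rightarrow> 'a set" where
  "contraction_group G T g =
     {x \<in> carrier G.
        limitin T (\<lambda>n::nat. g [^]\<^bsub>G\<^esub> n \<otimes>\<^bsub>G\<^esub> x \<otimes>\<^bsub>G\<^esub> inv\<^bsub>G\<^esub> (g [^]\<^bsub>G\<^esub> n)) \<one>\<^bsub>G\<^esub> sequentially}"

definition Tits_core :: "('a, 'b) monoid_scheme \<Rightarrow> 'a topology \<Rightarrow> 'a set" where
  "Tits_core G T = generate G (\<Union>g \<in> carrier G. T closure_of contraction_group G T g)"

definition identity_neighbourhoods ::
    "('a, 'b) monoid_scheme \<Rightarrow> 'a topology \<Rightarrow> 'a set set" where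
  "identity_neighbourhoods G T =
     {U. U \<subseteq> carrier G \<and> (\<exists>V. openin T V \<and> \<one>\<^bsub>G\<^esub> \<in> V \<and> V \<subseteq> U)}"

definition K_set :: "('a, 'b) monoid_scheme \<Rightarrow> 'a topology \<Rightarrow> 'a set \<Rightarrow> 'a set" where
  "K_set G T H = (\<Inter>U \<in> identity_neighbourhoods G T. H <#>\<^bsub>G\<^esub> U <#>\<^bsub>G\<^esub> H)"

text \<open>The quotient topology on the space of left cosets \<open>G/H\<close>. For a closed subgroup \<open>D\<close> of \<open>G\<close>
  containing \<open>H\<close>, the space \<open>D/H\<close> is obtained by passing \<open>G\<lparr>carrier := D\<rparr>\<close> and
  \<open>subtopology T D\<close>.\<close>

definition coset_topology ::
    "('a, 'b) monoid_scheme \<Rightarrow> 'a topology \<Rightarrow> 'a set \<Rightarrow> 'a set topology" where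
  "coset_topology G T H =
     topology (\<lambda>W. W \<subseteq> lcosets\<^bsub>G\<^esub> H \<and> openin T {x \<in> topspace T. x <#\<^bsub>G\<^esub> H \<in> W})"

lemma openin_coset_topology:
  "openin (coset_topology G T H) W \<longleftrightarrow>
     W \<subseteq> lcosets\<^bsub>G\<^esub> H \<and> openin T {x \<in> topspace T. x <#\<^bsub>G\<^esub> H \<in> W}"
proof -
  have "istopology (\<lambda>W. W \<subseteq> lcosets\<^bsub>G\<^esub> H \<and> openin T {x \<in> topspace T. x <#\<^bsub>G\<^esub> H \<in> W})"
    unfolding istopology_def
  proof (rule conjI; intro allI impI)
    fix S S'
    assume S: "S \<subseteq> lcosets\<^bsub>G\<^esub> H \<and> openin T {x \<in> topspace T. x <#\<^bsub>G\<^esub> H \<in> S}"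
      and S': "S' \<subseteq> lcosets\<^bsub>G\<^esub> H \<and> openin T {x \<in> topspace T. x <#\<^bsub>G\<^esub> H \<in> S'}"
    have "{x \<in> topspace T. x <#\<^bsub>G\<^esub> H \<in> S \<inter> S'} =
        {x \<in> topspace T. x <#\<^bsub>G\<^esub> H \<in> S} \<inter> {x \<in> topspace T. x <#\<^bsub>G\<^esub> H \<in> S'}"
      by blast
    then show "S \<inter> S' \<subseteq> lcosets\<^bsub>G\<^esub> H \<and> openin T {x \<in> topspace T. x <#\<^bsub>G\<^esub> H \<in> S \<inter> S'}"
      using S S' by auto
  next
    fix \<K>
    assume K: "\<forall>S\<in>\<K>. S \<subseteq> lcosets\<^bsub>G\<^esub> H \<and> openin T {x \<in> topspace T. x <#\<^bsub>G\<^esub> H \<in> S}"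
    have "{x \<in> topspace T. x <#\<^bsub>G\<^esub> H \<in> \<Union>\<K>} =
        (\<Union>S\<in>\<K>. {x \<in> topspace T. x <#\<^bsub>G\<^esub> H \<in> S})"
      by blast
    moreover have "openin T (\<Union>S\<in>\<K>. {x \<in> topspace T. x <#\<^bsub>G\<^esub> H \<in> S})"
      using K by blast
    ultimately show "\<Union>\<K> \<subseteq> lcosets\<^bsub>G\<^esub> H \<and> openin T {x \<in> topspace T. x <#\<^bsub>G\<^esub> H \<in> \<Union>\<K>}"
      using K by (metis Sup_least)
  qed
  then show ?thesis
    by (simp add: coset_topology_def)
qed

lemma quotient_map_coset_topology:
  assumes "topspace T = carrier G"
  shows "quotient_map T (coset_topology G T H) (\<lambda>x. x <#\<^bsub>G\<^esub> H)"
proof -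
  have "{x \<in> topspace T. x <#\<^bsub>G\<^esub> H \<in> lcosets\<^bsub>G\<^esub> H} = topspace T"
    using assms by (auto simp: LCOSETS_def)
  then have "openin (coset_topology G T H) (lcosets\<^bsub>G\<^esub> H)"
    by (simp add: openin_coset_topology)
  then have top: "topspace (coset_topology G T H) = lcosets\<^bsub>G\<^esub> H"
    by (metis openin_coset_topology openin_subset openin_topspace subset_antisym)
  then show ?thesis
    unfolding quotient_map_def using assms
    by (auto simp: openin_coset_topology LCOSETS_def)
qed

text \<open>A Borel probability measure on a locally compact Hausdorff space is understood, as usual
  outside the second countable setting, to be regular. For the finite measures considered here,
  this is inner regularity with respect to compact sets. Without it the
  invariant probability measure on \<open>G/H\<close> need not be unique, nor behave well: if \<open>\<kappa>\<close> is a
  measurable cardinal and \<open>G\<close> is the discrete group of finitely supported permutations of \<open>\<kappa>\<close>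
  and \<open>H\<close> a point stabilizer, then a two-valued measure on \<open>\<kappa>\<close> is \<open>G\<close>-invariant on
  \<open>G/H = \<kappa>\<close>. If \<open>G\<close> is second countable, regularity is automatic.\<close>

definition Borel_prob_measure :: "'a topology \<Rightarrow> 'a measure \<Rightarrow> bool" where
  "Borel_prob_measure X M \<longleftrightarrow>
     space M = topspace X \<and>
     sets M = sigma_sets (topspace X) {U. openin X U} \<and>
     emeasure M (topspace X) = 1 \<and>
     (\<forall>A \<in> sets M. emeasure M A = (SUP K \<in> {K. compactin X K \<and> K \<subseteq> A}. emeasure M K))"

definition invariant_prob_measure ::
    "('a, 'b) monoid_scheme \<Rightarrow> 'a topology \<Rightarrow> 'a set \<Rightarrow> 'a set measure \<Rightarrow> bool" where
  "invariant_prob_measure G T H M \<longleftrightarrow>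
     Borel_prob_measure (coset_topology G T H) M \<and>
     (\<forall>g \<in> carrier G. \<forall>A \<in> sets M. emeasure M ((\<lambda>C. g <#\<^bsub>G\<^esub> C) ` A) = emeasure M A)"

definition finite_covolume ::
    "('a, 'b) monoid_scheme \<Rightarrow> 'a topology \<Rightarrow> 'a set \<Rightarrow> bool" where
  "finite_covolume G T H \<longleftrightarrow> (\<exists>M. invariant_prob_measure G T H M)"

text \<open>Ergodicity of the left translation action of \<open>H\<close> on \<open>G/H\<close> with respect to the \<open>G\<close>-invariant
  probability measure. That measure is unique when it exists, so the existential quantifier
  does not involve a choice.\<close>

definition acts_ergodically ::
    "('a, 'b) monoid_scheme \<Rightarrow> 'a topology \<Rightarrow> 'a set \<Rightarrow> bool" where
  "acts_ergodically G T H \<longleftrightarrow>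
     (\<exists>M. invariant_prob_measure G T H M \<and>
        (\<forall>A \<in> sets M. (\<forall>h \<in> H. (\<lambda>C. h <#\<^bsub>G\<^esub> C) ` A = A) \<longrightarrow>
           emeasure M A = 0 \<or> emeasure M A = 1))"

definition distal_at_1 ::
    "('a, 'b) monoid_scheme \<Rightarrow> 'a topology \<Rightarrow> 'a set \<Rightarrow> 'a set \<Rightarrow> bool" where
  "distal_at_1 G T H E \<longleftrightarrow>
     (\<forall>C \<in> lcosets\<^bsub>G\<^esub> E. C \<noteq> E \<longrightarrow>
        E \<notin> coset_topology G T E closure_of ((\<lambda>h. h <#\<^bsub>G\<^esub> C) ` H))"

text \<open>\<open>Dist\<^sup>*\<^bsub>G/H\<^esub>(H)\<close>; the order underlying \<open>LEAST\<close> is inclusion of sets.\<close>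

definition Dist_star :: "('a, 'b) monoid_scheme \<Rightarrow> 'a topology \<Rightarrow> 'a set \<Rightarrow> 'a set" where
  "Dist_star G T H = (LEAST E. closed_subgroup G T E \<and> H \<subseteq> E \<and> distal_at_1 G T H E)"

definition ergodic_closed_overgroup ::
    "('a, 'b) monoid_scheme \<Rightarrow> 'a topology \<Rightarrow> 'a set \<Rightarrow> 'a set \<Rightarrow> bool" where
  "ergodic_closed_overgroup G T H D \<longleftrightarrow>
     closed_subgroup G T D \<and> H \<subseteq> D \<and>
     acts_ergodically (G\<lparr>carrier := D\<rparr>) (subtopology T D) H"

end

theory Submission
  imports Defs
begin

text \<open>
  Let \<open>D\<close> be the smallest closed subgroup containing \<open>H\<close> on whose coset space \<open>H\<close> acts distally at
  the trivial coset; distality of \<open>E\<close> means that \<open>E\<close> contains the intersection of the sets \<open>H U E\<close>.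

  \<^item> \<open>D\<close> is ergodic: if \<open>A\<close> is an \<open>H\<close>-invariant Borel set in \<open>D/H\<close>, then
    \<open>d (h u f A, A) = d (u f A, A) = d (u A, A)\<close> for \<open>h \<in> H\<close> and \<open>f\<close> in the stabilizer \<open>F\<close> of \<open>A\<close>
    modulo null sets, where \<open>d\<close> is the measure of the symmetric difference, and this tends to \<open>0\<close> as \<open>u\<close> tends to \<open>1\<close>. So \<open>F\<close> is distal, hence \<open>F = D\<close>, and
    \<open>A\<close> is null or conull by uniqueness of the invariant measure.
  \<^item> If \<open>H\<close> acts ergodically on \<open>D'/H\<close>, the open invariant sets \<open>H U H\<close> are conull. By metrizability
    so is their intersection, hence \<open>K(H)\<close> is dense in \<open>D'\<close>. With \<open>K(H) \<subseteq> D\<close> this settles everything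
    except the Tits core.
  \<^item> If \<open>x\<close> is contracted by \<open>g\<close>, Poincare recurrence on \<open>G/H\<close> yields \<open>a\<close> arbitrarily close to \<open>1\<close> and
    arbitrarily large \<open>n\<close> with \<open>g\<^sup>n a = b h\<close>, where \<open>h \<in> H\<close> and \<open>b\<close> stays in a compact set. Then
    \<open>h (a\<^sup>-\<^sup>1 x a) h\<^sup>-\<^sup>1 = b\<^sup>-\<^sup>1 (g\<^sup>n x g\<^sup>-\<^sup>n) b\<close> is close to \<open>1\<close>, so that \<open>a\<^sup>-\<^sup>1 x a \<in> K(H)\<close>.

  For compact open subgroups \<open>V \<subseteq> U\<close>, counting cosets of \<open>V\<close> in \<open>U\<close> shows that the ratio of the measures
  of \<open>V C\<close> and \<open>U C\<close> is the same for every invariant measure and every \<open>U \<inter> D\<close>-invariant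
  \<open>C \<subseteq> D/H\<close>. This gives uniqueness, and makes \<open>\<mu>(U C) / \<mu>(U D)\<close> a well-defined content on \<open>D/H\<close>.
\<close>

text \<open>Avoids the clash with the notation for left cosets.\<close>
no_notation (input) subset_mset (infix \<open><#\<close> 50)

section \<open>Totally disconnected locally compact groups\<close>

locale tdlc_group =
  fixes G :: "('a, 'b) monoid_scheme" (structure) and T :: "'a topology"
  assumes tg: "topological_group G T"
    and metrizable: "metrizable_space T"
    and tot_disc: "totally_disconnected_space T"
    and loc_compact: "locally_compact_space T"

sublocale tdlc_group \<subseteq> group G
  using tg by (simp add: topological_group_def)

context tdlc_group
begin

lemma topspace_T [simp]: "topspace T = carrier G"
  and Hausdorff: "Hausdorff_space T"
  and cont_mult: "continuous_map (prod_topology T T) T (\<lambda>(x, y). x \<otimes> y)"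
  and cont_inv: "continuous_map T T (\<lambda>x. inv x)"
  using tg by (simp_all add: topological_group_def)

lemma continuous_map_mult:
  assumes "continuous_map X T f" "continuous_map X T g"
  shows "continuous_map X T (\<lambda>x. f x \<otimes> g x)"
  using continuous_map_compose [OF continuous_map_pairedI [OF assms] cont_mult] by (simp add: o_def)

lemma cont_lmult: "g \<in> carrier G \<Longrightarrow> continuous_map T T (\<lambda>x. g \<otimes> x)"
  by (rule continuous_map_mult) auto

lemma cont_rmult: "g \<in> carrier G \<Longrightarrow> continuous_map T T (\<lambda>x. x \<otimes> g)"
  by (rule continuous_map_mult) auto

lemma cont_conj: "g \<in> carrier G \<Longrightarrow> h \<in> carrier G \<Longrightarrow> continuous_map T T (\<lambda>x. g \<otimes> x \<otimes> h)"
  by (intro continuous_map_mult) auto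

lemma open_preimage:
  "continuous_map T T f \<Longrightarrow> openin T S \<Longrightarrow> openin T {x \<in> carrier G. f x \<in> S}"
  using openin_continuous_map_preimage by fastforce

lemma open_sub: "openin T S \<Longrightarrow> S \<subseteq> carrier G"
  using openin_subset by fastforce

lemma set_multI: "a \<in> A \<Longrightarrow> b \<in> B \<Longrightarrow> a \<otimes> b \<in> A <#> B"
  by (auto simp: set_mult_def)

lemma open_lmult:
  assumes "openin T S" "g \<in> carrier G"
  shows "openin T ((\<lambda>x. g \<otimes> x) ` S)"
proof -
  have "(\<lambda>x. g \<otimes> x) ` S = {x \<in> carrier G. inv g \<otimes> x \<in> S}"
  proof (intro equalityI subsetI)
    fix x assume "x \<in> {x \<in> carrier G. inv g \<otimes> x \<in> S}"
    then show "x \<in> (\<lambda>x. g \<otimes> x) ` S"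
      using assms(2) by (intro image_eqI [of _ _ "inv g \<otimes> x"]) (auto simp: m_assoc [symmetric])
  qed (use assms open_sub [of S] in \<open>auto simp: m_assoc [symmetric] subset_iff\<close>)
  then show ?thesis
    using open_preimage [OF cont_lmult assms(1)] assms(2) by simp
qed

lemma open_rmult:
  assumes "openin T S" "g \<in> carrier G"
  shows "openin T ((\<lambda>x. x \<otimes> g) ` S)"
proof -
  have "(\<lambda>x. x \<otimes> g) ` S = {x \<in> carrier G. x \<otimes> inv g \<in> S}"
  proof (intro equalityI subsetI)
    fix x assume "x \<in> {x \<in> carrier G. x \<otimes> inv g \<in> S}"
    then show "x \<in> (\<lambda>x. x \<otimes> g) ` S"
      using assms(2) by (intro image_eqI [of _ _ "x \<otimes> inv g"]) (auto simp: m_assoc)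
  next
    fix x assume "x \<in> (\<lambda>x. x \<otimes> g) ` S"
    then obtain s where "s \<in> S" "x = s \<otimes> g" by blast
    then show "x \<in> {x \<in> carrier G. x \<otimes> inv g \<in> S}"
      using assms open_sub by (auto simp: m_assoc subset_iff)
  qed
  then show ?thesis
    using open_preimage [OF cont_rmult assms(1)] assms(2) by simp
qed

lemma open_set_mult_right:
  assumes "openin T S" "A \<subseteq> carrier G"
  shows "openin T (A <#> S)"
proof -
  have "A <#> S = (\<Union>a\<in>A. (\<lambda>x. a \<otimes> x) ` S)" by (auto simp: set_mult_def)
  then show ?thesis using assms open_lmult by (auto intro!: openin_Union)
qed

lemma open_set_mult_left:
  assumes "openin T S" "A \<subseteq> carrier G"
  shows "openin T (S <#> A)"
proof -
  have "S <#> A = (\<Union>a\<in>A. (\<lambda>x. x \<otimes> a) ` S)" by (auto simp: set_mult_def)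
  then show ?thesis using assms open_rmult by (auto intro!: openin_Union)
qed

lemma open_subgroup_closed:
  assumes U: "subgroup U G" and "openin T U"
  shows "closedin T U"
proof -
  interpret U: subgroup U G by fact
  have "carrier G - U = (carrier G - U) <#> U"
  proof (intro equalityI subsetI)
    fix x assume "x \<in> carrier G - U" then show "x \<in> (carrier G - U) <#> U"
      using set_multI [OF _ U.one_closed, of x] by simp
  next
    fix x assume "x \<in> (carrier G - U) <#> U"
    then obtain a u where au: "a \<in> carrier G - U" "u \<in> U" "x = a \<otimes> u" by (auto simp: set_mult_def)
    moreover have "a \<otimes> u \<notin> U"
    proof
      assume "a \<otimes> u \<in> U"
      then have "a \<otimes> u \<otimes> inv u \<in> U" using au by blast
      then show False using au by (simp add: m_assoc)
    qed
    ultimately show "x \<in> carrier G - U" by auto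
  qed
  then have "openin T (carrier G - U)"
    using open_set_mult_right [OF assms(2), of "carrier G - U"] by simp
  then show ?thesis using U.subset by (simp add: closedin_def)
qed

section \<open>Compact open subgroups\<close>

definition cosub :: "'a set \<Rightarrow> bool" where
  "cosub U \<longleftrightarrow> subgroup U G \<and> openin T U \<and> compactin T U"

lemma cosubD:
  assumes "cosub U"
  shows "subgroup U G" "openin T U" "compactin T U" "\<one> \<in> U" "U \<subseteq> carrier G" "closedin T U"
  using assms open_subgroup_closed by (auto simp: cosub_def subgroup.one_closed dest: subgroup.subset)

lemma cosub_closed:
  assumes "cosub U" "x \<in> U"
  shows "x \<in> carrier G" "inv x \<in> U" "y \<in> U \<Longrightarrow> x \<otimes> y \<in> U"
  using assms cosubD(1,5) by (auto simp: subgroup.m_closed subgroup.m_inv_closed)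

text \<open>Total disconnectedness makes \<open>{\<one>}\<close> a connected component, and in a
  locally compact Hausdorff space a compact component is separated from the outside of any open
  neighbourhood by a clopen set. Inside a compact neighbourhood that clopen set is compact.\<close>

lemma compact_open_nbhd:
  assumes "openin T S" "\<one> \<in> S"
  obtains Z where "openin T Z" "compactin T Z" "\<one> \<in> Z" "Z \<subseteq> S"
proof -
  have "neighbourhood_base_of (compactin T) T"
    using loc_compact Hausdorff locally_compact_space_neighbourhood_base by blast
  then obtain P K where PK: "openin T P" "compactin T K" "\<one> \<in> P" "P \<subseteq> K" "K \<subseteq> S"
    using assms unfolding neighbourhood_base_of by (metis (full_types))
  have cc: "connected_component_of_set T \<one> = {\<one>}"
    using tot_disc by (simp add: totally_disconnected_space_def)
  then have "{\<one>} \<in> connected_components_of T"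
    by (metis connected_component_in_connected_components_of one_closed topspace_T)
  then obtain U V where UV: "openin T U" "openin T V" "disjnt U V" "U \<union> V = topspace T" "{\<one>} \<subseteq> U" "U \<subseteq> P"
    using wilder_locally_compact_component_thm [OF loc_compact Hausdorff _ _ PK(1), of "{\<one>}"] PK(3)
    by (metis compactin_sing empty_subsetI insert_subset one_closed topspace_T)
  have "U = topspace T - V" using UV(3,4) by (auto simp: disjnt_iff)
  then have "closedin T U" using UV(2) by blast
  then have "compactin T U" using PK UV closed_compactin by (metis order_trans)
  then show thesis using that UV PK by auto
qed

text \<open>A compact open \<open>Z\<close> around \<open>\<one>\<close> is turned into a group: the
  elements whose right multiplication maps \<open>Z\<close> into itself form a monoid
  \<open>B\<close>, and \<open>U\<close> is the group of its invertible elements. Since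
  \<open>\<one>\<close> is in \<open>Z\<close>, both lie in \<open>Z\<close>.\<close>

theorem van_Dantzig:
  assumes "openin T S" "\<one> \<in> S"
  obtains U where "cosub U" "U \<subseteq> S"
proof -
  obtain Z where Z: "openin T Z" "compactin T Z" "\<one> \<in> Z" "Z \<subseteq> S"
    using compact_open_nbhd assms by blast
  have Zc: "Z \<subseteq> carrier G" using Z open_sub by blast
  define B where "B = {b \<in> carrier G. \<forall>z\<in>Z. z \<otimes> b \<in> Z}"
  \<comment> \<open>The complement of \<open>B\<close> is the projection of the closed set of pairs
    whose product leaves \<open>Z\<close>. Projecting along the compact factor \<open>Z\<close> is a
    closed map, so \<open>B\<close> is open.\<close>
  have "closedin (prod_topology (subtopology T Z) T)
      {p \<in> topspace (prod_topology (subtopology T Z) T). (case p of (z, b) \<Rightarrow> z \<otimes> b) \<in> carrier G - Z}"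
  proof (rule closedin_continuous_map_preimage)
    show "continuous_map (prod_topology (subtopology T Z) T) T (\<lambda>(x, y). x \<otimes> y)"
      by (metis cont_mult continuous_map_from_subtopology prod_topology_subtopology(1))
    show "closedin T (carrier G - Z)" using Z(1) by (metis openin_closedin_eq topspace_T)
  qed
  then have "closedin T (snd ` {p \<in> topspace (prod_topology (subtopology T Z) T). (case p of (z, b) \<Rightarrow> z \<otimes> b) \<in> carrier G - Z})"
    using closed_map_snd [of "subtopology T Z" T] Z(2)
    by (simp add: closed_map_def compact_space_subtopology)
  moreover have "snd ` {p \<in> topspace (prod_topology (subtopology T Z) T). (case p of (z, b) \<Rightarrow> z \<otimes> b) \<in> carrier G - Z}
      = carrier G - B"
    using Zc by (force simp: B_def image_iff)
  ultimately have "closedin T (carrier G - B)" by simp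
  then have "openin T (topspace T - (carrier G - B))" by blast
  moreover have "topspace T - (carrier G - B) = B" by (auto simp: B_def)
  ultimately have Bop: "openin T B" by simp
  have B1: "\<one> \<in> B" using Zc by (auto simp: B_def)
  define U where "U = {b \<in> B. inv b \<in> B}"
  have sg: "subgroup U G"
  proof (rule subgroupI)
    show "U \<subseteq> carrier G" by (auto simp: U_def B_def)
    show "U \<noteq> {}" using B1 by (auto simp: U_def)
    fix a assume "a \<in> U" then show "inv a \<in> U" by (auto simp: U_def B_def)
  next
    have BB: "a \<otimes> b \<in> B" if "a \<in> B" "b \<in> B" for a b
      using that Zc unfolding B_def by (auto simp: m_assoc [symmetric] subset_iff)
    fix a b assume "a \<in> U" "b \<in> U" 
    then show "a \<otimes> b \<in> U" using BB by (auto simp: U_def inv_mult_group B_def)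
  qed
  have "U = B \<inter> {b \<in> carrier G. inv b \<in> B}" by (auto simp: U_def B_def)
  then have Uop: "openin T U"
    using Bop open_preimage [OF cont_inv Bop] by auto
  have "U \<subseteq> Z" using Z(3) by (auto simp: U_def B_def)
  then have "compactin T U"
    using Z(2) open_subgroup_closed [OF sg Uop] closed_compactin by blast
  then show thesis using that Uop sg \<open>U \<subseteq> Z\<close> Z(4) by (auto simp: cosub_def)
qed

text \<open>Metrizability is used in the form of first countability. It later replaces the
  intersection of all \<open>H U H\<close> by a countable one and yields a countable base of
  \<open>D/H\<close>.\<close>

lemma countable_base_at_one:
  obtains V :: "nat \<Rightarrow> 'a set" where "\<And>n. cosub (V n)" "\<And>S. openin T S \<Longrightarrow> \<one> \<in> S \<Longrightarrow> \<exists>n. V n \<subseteq> S"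
proof -
  have "first_countable T" using metrizable by (rule metrizable_imp_first_countable)
  then obtain \<B> where B: "countable \<B>" "\<forall>V\<in>\<B>. openin T V"
    "\<forall>U. openin T U \<and> \<one> \<in> U \<longrightarrow> (\<exists>V\<in>\<B>. \<one> \<in> V \<and> V \<subseteq> U)"
    by (auto simp: first_countable_def dest!: bspec [of _ _ \<one>])
  let ?B = "{V \<in> \<B>. \<one> \<in> V}"
  have ne: "?B \<noteq> {}" using B(3) by (metis (no_types, lifting) empty_iff mem_Collect_eq one_closed openin_topspace topspace_T)
  have c: "countable ?B" using B(1) by simp
  have "\<exists>U. cosub U \<and> U \<subseteq> from_nat_into ?B n" for n
    using van_Dantzig from_nat_into [OF ne, of n] B(2) by (metis (no_types, lifting) mem_Collect_eq)
  then have "\<forall>n. \<exists>U. cosub U \<and> U \<subseteq> from_nat_into ?B n" by blast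
  from choice [OF this] obtain V where V: "\<And>n. cosub (V n)" "\<And>n. V n \<subseteq> from_nat_into ?B n"
    by blast
  have base: "\<exists>n. V n \<subseteq> S" if "openin T S" "\<one> \<in> S" for S
  proof -
    have "\<exists>W\<in>\<B>. \<one> \<in> W \<and> W \<subseteq> S" using B(3) that by simp
    then obtain W where W: "W \<in> ?B" "W \<subseteq> S" by blast
    obtain n where "from_nat_into ?B n = W" using from_nat_into_surj [OF c W(1)] by blast
    then have "V n \<subseteq> S" using V(2) [of n] W(2) by simp
    then show ?thesis by blast
  qed
  show thesis by (rule that [OF V(1) base])
qed

text \<open>This is \<open>g U (inv g)\<close>, written as a preimage so that openness is immediate;
  compactness comes from its description as an image.\<close>

lemma cosub_conj:
  assumes U: "cosub U" and g: "g \<in> carrier G"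
  shows "cosub {x \<in> carrier G. inv g \<otimes> x \<otimes> g \<in> U}"
proof -
  let ?C = "{x \<in> carrier G. inv g \<otimes> x \<otimes> g \<in> U}"
  have "subgroup ?C G"
  proof (rule subgroupI)
    show "?C \<noteq> {}" using cosubD [OF U] g by (auto intro!: exI [of _ \<one>])
    fix a assume a: "a \<in> ?C"
    then have "inv (inv g \<otimes> a \<otimes> g) \<in> U" using cosub_closed [OF U] by blast
    then show "inv a \<in> ?C" using a g by (simp add: inv_mult_group m_assoc)
  next
    fix a b assume ab: "a \<in> ?C" "b \<in> ?C"
    then have "(inv g \<otimes> a \<otimes> g) \<otimes> (inv g \<otimes> b \<otimes> g) \<in> U" using cosub_closed [OF U] by blast
    moreover have "(inv g \<otimes> a \<otimes> g) \<otimes> (inv g \<otimes> b \<otimes> g) = inv g \<otimes> (a \<otimes> b) \<otimes> g"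
      using ab g by (simp add: m_assoc) (simp add: m_assoc [symmetric])
    ultimately show "a \<otimes> b \<in> ?C" using ab by simp
  qed auto
  moreover have "openin T ?C" using open_preimage [OF cont_conj cosubD(2) [OF U]] g by simp
  moreover have "?C = (\<lambda>x. g \<otimes> x \<otimes> inv g) ` U"
  proof (intro equalityI subsetI)
    fix x assume x: "x \<in> ?C"
    then have "x = g \<otimes> (inv g \<otimes> x \<otimes> g) \<otimes> inv g"
      using g by (simp add: m_assoc) (simp add: m_assoc [symmetric])
    then show "x \<in> (\<lambda>x. g \<otimes> x \<otimes> inv g) ` U" using x by blast
  next
    fix x assume "x \<in> (\<lambda>x. g \<otimes> x \<otimes> inv g) ` U"
    then obtain u where u: "u \<in> U" "x = g \<otimes> u \<otimes> inv g" by blast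
    then have "inv g \<otimes> x \<otimes> g = u" "x \<in> carrier G"
      using g cosub_closed(1) [OF U] by (auto simp: m_assoc) (simp add: m_assoc [symmetric])
    then show "x \<in> ?C" using u by auto
  qed
  then have "compactin T ?C"
    using image_compactin [OF cosubD(3) [OF U] cont_conj [of g "inv g"]] g by simp
  ultimately show ?thesis by (simp add: cosub_def)
qed

lemma cosub_Int:
  assumes "cosub U" "cosub V"
  shows "cosub (U \<inter> V)"
  using assms cosubD [OF assms(1)] cosubD [OF assms(2)] unfolding cosub_def
  by (auto intro: subgroups_Inter_pair compact_Int_closedin)

lemma cosub_Inter:
  assumes "finite F" "F \<noteq> {}" "\<And>U. U \<in> F \<Longrightarrow> cosub U"
  shows "cosub (\<Inter>F)"
  using assms by (induction rule: finite_ne_induct) (auto intro: cosub_Int)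

text \<open>The left cosets of \<open>V\<close> through points of \<open>K\<close> are an open cover
  of \<open>K\<close>.\<close>

lemma compact_finite_cover:
  assumes K: "compactin T K" and V: "cosub V"
  obtains F where "finite F" "F \<subseteq> K" "K \<subseteq> F <#> V"
proof -
  have Kc: "K \<subseteq> carrier G" using K compactin_subset_topspace by fastforce
  let ?\<U> = "(\<lambda>k. (\<lambda>x. k \<otimes> x) ` V) ` K"
  have "\<forall>U\<in>?\<U>. openin T U" using open_lmult cosubD(2) [OF V] Kc by auto
  moreover have "K \<subseteq> \<Union>?\<U>"
  proof
    fix k assume "k \<in> K" then show "k \<in> \<Union>?\<U>" using Kc cosubD(4) [OF V] by (auto intro!: bexI [of _ k] image_eqI [of _ _ \<one>])
  qed
  ultimately obtain \<F> where F: "finite \<F>" "\<F> \<subseteq> ?\<U>" "K \<subseteq> \<Union>\<F>"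
    using K unfolding compactin_def by meson
  then obtain F where "finite F" "F \<subseteq> K" "\<F> = (\<lambda>k. (\<lambda>x. k \<otimes> x) ` V) ` F"
    by (metis finite_subset_image)
  then show thesis using that F(3) by (force simp: set_mult_def)
qed

end

section \<open>Coset spaces\<close>

text \<open>The product \<open>A C\<close> of a set of group elements with a set of cosets. The
  carrier does not enter, so it is the same set in \<open>G\<close> and in a subgroup.\<close>

definition translates :: "('a, 'b) monoid_scheme \<Rightarrow> 'a set \<Rightarrow> 'a set set \<Rightarrow> 'a set set" where
  "translates G A C = (\<Union>a\<in>A. (\<lambda>y. a <#\<^bsub>G\<^esub> y) ` C)"

lemma translates_consistent [simp]: "translates (G\<lparr>carrier := D\<rparr>) = translates G"
  by (intro ext) (simp add: translates_def l_coset_def)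

lemma translatesI: "a \<in> A \<Longrightarrow> c \<in> C \<Longrightarrow> a <#\<^bsub>G\<^esub> c \<in> translates G A C"
  by (auto simp: translates_def)

lemma translatesE:
  assumes "y \<in> translates G A C"
  obtains a c where "a \<in> A" "c \<in> C" "y = a <#\<^bsub>G\<^esub> c"
  using assms by (auto simp: translates_def)

text \<open>Group and subgroup are both parameters, because the results are reused with
  \<open>D\<close> in place of \<open>G\<close> and with an overgroup \<open>E\<close> in place of
  \<open>H\<close>.\<close>

locale tdlc_pair = tdlc_group +
  fixes H :: "'a set"
  assumes closed_subgroup_H: "closed_subgroup G T H"
begin

abbreviation "X \<equiv> coset_topology G T H"

abbreviation "tr \<equiv> translates G"

lemma H_sub: "subgroup H G" and H_closed: "closedin T H" and H_carrier: "H \<subseteq> carrier G"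
  using closed_subgroup_H by (auto simp: closed_subgroup_def dest: subgroup.subset)

lemma topspace_X [simp]: "topspace X = lcosets H"
proof -
  have "quotient_map T X (\<lambda>x. x <# H)" by (rule quotient_map_coset_topology) simp
  then have "(\<lambda>x. x <# H) ` topspace T = topspace X" by (simp add: quotient_map_def)
  then show ?thesis by (auto simp: LCOSETS_def)
qed

lemma cont_proj: "continuous_map T X (\<lambda>x. x <# H)"
  by (intro quotient_imp_continuous_map quotient_map_coset_topology) simp

lemma openX: "openin X W \<longleftrightarrow> W \<subseteq> lcosets H \<and> openin T {x \<in> carrier G. x <# H \<in> W}"
  by (simp add: openin_coset_topology)

lemma cosetE:
  assumes "y \<in> lcosets H"
  obtains x where "x \<in> carrier G" "y = x <# H"
  using assms by (auto simp: LCOSETS_def)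

lemma proj_in [simp]: "x \<in> carrier G \<Longrightarrow> x <# H \<in> lcosets H"
  by (auto simp: LCOSETS_def)

lemma H_in: "H \<in> lcosets H"
  using proj_in [OF one_closed] lcos_mult_one [OF H_carrier] by simp

lemma coset_sub: "y \<in> lcosets H \<Longrightarrow> y \<subseteq> carrier G"
  by (metis cosetE l_coset_subset_G H_carrier)

lemma act_mult: "y \<in> lcosets H \<Longrightarrow> g \<in> carrier G \<Longrightarrow> h \<in> carrier G \<Longrightarrow> g <# (h <# y) = (g \<otimes> h) <# y"
  using coset_sub lcos_m_assoc by auto

lemma act_proj: "g \<in> carrier G \<Longrightarrow> h \<in> carrier G \<Longrightarrow> g <# (h <# H) = (g \<otimes> h) <# H"
  using H_carrier lcos_m_assoc by auto

lemma act_one [simp]: "y \<in> lcosets H \<Longrightarrow> \<one> <# y = y"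
  using coset_sub lcos_mult_one by auto

lemma act_closed [simp]: "y \<in> lcosets H \<Longrightarrow> g \<in> carrier G \<Longrightarrow> g <# y \<in> lcosets H"
  by (metis cosetE act_proj m_closed proj_in)

lemma act_inv [simp]: "y \<in> lcosets H \<Longrightarrow> g \<in> carrier G \<Longrightarrow> inv g <# (g <# y) = y"
  "y \<in> lcosets H \<Longrightarrow> g \<in> carrier G \<Longrightarrow> g <# (inv g <# y) = y"
  by (simp_all add: act_mult)

lemma act_inj: "g \<in> carrier G \<Longrightarrow> inj_on (\<lambda>y. g <# y) (lcosets H)"
  by (metis act_inv(1) inj_onI)

lemma act_image: "g \<in> carrier G \<Longrightarrow> (\<lambda>y. g <# y) ` (lcosets H) = lcosets H"
  by (metis (no_types, lifting) act_closed act_inv(2) image_eqI inv_closed subsetI image_subsetI subset_antisym)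

lemma act_image_eq:
  assumes "g \<in> carrier G" "A \<subseteq> lcosets H"
  shows "(\<lambda>y. g <# y) ` A = {y \<in> lcosets H. inv g <# y \<in> A}"
proof (intro equalityI subsetI)
  fix y assume "y \<in> {y \<in> lcosets H. inv g <# y \<in> A}"
  then show "y \<in> (\<lambda>y. g <# y) ` A"
    using assms by (intro image_eqI [of _ _ "inv g <# y"]) auto
qed (use assms in auto)

lemma act_image_mult:
  assumes "g \<in> carrier G" "h \<in> carrier G" "A \<subseteq> lcosets H"
  shows "(\<lambda>y. g <# y) ` (\<lambda>y. h <# y) ` A = (\<lambda>y. (g \<otimes> h) <# y) ` A"
  unfolding image_image using assms act_mult by (intro image_cong) auto

lemma proj_eq_iff:
  assumes "x \<in> carrier G" "y \<in> carrier G"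
  shows "x <# H = y <# H \<longleftrightarrow> inv x \<otimes> y \<in> H"
  using assms H_sub
  by (metis l_repr_independence lcos_self subgroup.lcos_module_imp subgroup.lcos_module_rev is_group)

lemma proj_H_iff: "x \<in> carrier G \<Longrightarrow> x <# H = H \<longleftrightarrow> x \<in> H"
  using proj_eq_iff [of \<one> x] lcos_mult_one [OF H_carrier] by auto

lemma tr_sub: "A \<subseteq> carrier G \<Longrightarrow> C \<subseteq> lcosets H \<Longrightarrow> tr A C \<subseteq> lcosets H"
  by (auto simp: subset_iff elim!: translatesE)

text \<open>The preimage of \<open>S C\<close> in \<open>G\<close> is \<open>S\<close> times the
  preimage of \<open>C\<close>, a union of right translates of \<open>S\<close>. Nothing is asked of
  the topology of \<open>C\<close>, so thin sets may be thickened to open ones.\<close>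

lemma open_tr:
  assumes "openin T S" "C \<subseteq> lcosets H"
  shows "openin X (tr S C)"
proof -
  have S: "S \<subseteq> carrier G" using assms open_sub by blast
  have "{x \<in> carrier G. x <# H \<in> tr S C} = S <#> {x \<in> carrier G. x <# H \<in> C}"
  proof (intro equalityI subsetI)
    fix x assume "x \<in> {x \<in> carrier G. x <# H \<in> tr S C}"
    then obtain s c where x: "x \<in> carrier G" "s \<in> S" "c \<in> C" "x <# H = s <# c"
      by (auto elim: translatesE)
    have s: "s \<in> carrier G" using x S by blast
    have c: "c \<in> lcosets H" using x assms by blast
    have "(inv s \<otimes> x) <# H = inv s <# (x <# H)"
      by (rule act_proj [symmetric]) (use x s in auto)
    also have "\<dots> = c" using x(4) s c by simp
    finally have "inv s \<otimes> x \<in> {x \<in> carrier G. x <# H \<in> C}" using x s by auto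
    moreover have "x = s \<otimes> (inv s \<otimes> x)" using x s by (simp add: m_assoc [symmetric])
    ultimately show "x \<in> S <#> {x \<in> carrier G. x <# H \<in> C}" using x(2) set_multI by metis
  next
    fix x assume "x \<in> S <#> {x \<in> carrier G. x <# H \<in> C}"
    then obtain s c where "s \<in> S" "c \<in> carrier G" "c <# H \<in> C" "x = s \<otimes> c" by (auto simp: set_mult_def)
    then show "x \<in> {x \<in> carrier G. x <# H \<in> tr S C}"
      using S translatesI [of s S "c <# H" C G] by (auto simp: act_proj subset_iff)
  qed
  then have "openin T {x \<in> carrier G. x <# H \<in> tr S C}" using open_set_mult_left [OF assms(1)] by simp
  then show ?thesis using tr_sub [OF S assms(2)] by (simp add: openX)
qed

lemma cont_act:
  assumes g: "g \<in> carrier G"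
  shows "continuous_map X X (\<lambda>y. g <# y)"
  unfolding continuous_map_def
proof (intro conjI allI impI)
  show "(\<lambda>y. g <# y) \<in> topspace X \<rightarrow> topspace X" using g by auto
  fix W assume W: "openin X W"
  have "{x \<in> carrier G. x <# H \<in> {y \<in> topspace X. g <# y \<in> W}} = {x \<in> carrier G. g \<otimes> x \<in> {x \<in> carrier G. x <# H \<in> W}}"
    using g by (auto simp: act_proj)
  moreover have "openin T {x \<in> carrier G. g \<otimes> x \<in> {x \<in> carrier G. x <# H \<in> W}}"
    by (rule open_preimage [OF cont_lmult [OF g]]) (use W openX in blast)
  ultimately show "openin X {y \<in> topspace X. g <# y \<in> W}" unfolding openX by auto
qed

lemma open_act:
  assumes "g \<in> carrier G" "openin X W"
  shows "openin X ((\<lambda>y. g <# y) ` W)"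
proof -
  have "W \<subseteq> lcosets H" using assms(2) openX by blast
  then show ?thesis using openin_continuous_map_preimage [OF cont_act [of "inv g"] assms(2)] assms(1)
    by (simp add: act_image_eq)
qed

lemma orbit_eq: "tr U {y} = (\<lambda>u. u <# y) ` U"
  by (auto simp: translates_def)

lemma compact_orbit:
  assumes "compactin T U" "y \<in> lcosets H"
  shows "compactin X (tr U {y})"
proof -
  obtain x where x: "x \<in> carrier G" "y = x <# H" using cosetE assms(2) by blast
  have "continuous_map T X ((\<lambda>z. z <# H) \<circ> (\<lambda>u. u \<otimes> x))"
    using cont_rmult [OF x(1)] cont_proj by (rule continuous_map_compose)
  then have "compactin X (((\<lambda>z. z <# H) \<circ> (\<lambda>u. u \<otimes> x)) ` U)"
    using assms(1) image_compactin by blast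
  moreover have "((\<lambda>z. z <# H) \<circ> (\<lambda>u. u \<otimes> x)) ` U = tr U {y}"
    unfolding orbit_eq x(2) using compactin_subset_topspace [OF assms(1)] x(1)
    by (intro image_cong) (auto simp: act_proj)
  ultimately show ?thesis by simp
qed

text \<open>Together with \<open>open_orbit\<close> and \<open>compact_orbit\<close>: the orbits of
  compact open subgroups are a base of compact open sets.\<close>

lemma orbit_nbhd:
  assumes "openin X W" "y \<in> W"
  obtains V where "cosub V" "tr V {y} \<subseteq> W"
proof -
  have "y \<in> lcosets H" using assms openX by blast
  then obtain x where x: "x \<in> carrier G" "y = x <# H" using cosetE by blast
  let ?S = "{g \<in> carrier G. g \<otimes> x \<in> {x \<in> carrier G. x <# H \<in> W}}"
  have "openin T ?S" using open_preimage [OF cont_rmult [OF x(1)]] assms(1) openX by blast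
  moreover have "\<one> \<in> ?S" using x assms by simp
  ultimately obtain V where V: "cosub V" "V \<subseteq> ?S" using van_Dantzig by blast
  have "tr V {y} \<subseteq> W"
    using V x by (auto simp: orbit_eq act_proj)
  then show thesis using V that by blast
qed

lemma orbit_self: "cosub V \<Longrightarrow> y \<in> lcosets H \<Longrightarrow> y \<in> tr V {y}"
  using cosubD(4) by (force simp: orbit_eq)

lemma orbit_sub: "cosub V \<Longrightarrow> y \<in> lcosets H \<Longrightarrow> tr V {y} \<subseteq> lcosets H"
  by (rule tr_sub) (auto dest: cosubD)

lemma tr_tr:
  assumes V: "cosub V" and C: "C \<subseteq> lcosets H"
  shows "tr V (tr V C) = tr V C"
proof (intro equalityI subsetI)
  fix z assume "z \<in> tr V (tr V C)"
  then obtain a b c where z: "a \<in> V" "b \<in> V" "c \<in> C" "z = a <# (b <# c)"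
    by (auto elim!: translatesE)
  then have "z = (a \<otimes> b) <# c" using C cosub_closed(1) [OF V] by (auto simp: act_mult)
  then show "z \<in> tr V C" using z cosub_closed(3) [OF V] translatesI by metis
next
  fix z assume "z \<in> tr V C"
  then show "z \<in> tr V (tr V C)"
    using translatesI [OF cosubD(4) [OF V], of z _ G] tr_sub [OF cosubD(5) [OF V] C] by auto
qed

text \<open>Orbits of a group are equal or disjoint; this cuts invariant compact open sets into
  finitely many disjoint pieces.\<close>

lemma orbit_sym:
  assumes V: "cosub V" and y: "y \<in> lcosets H" and z: "z \<in> tr V {y}"
  shows "tr V {z} = tr V {y}"
proof -
  obtain v where v: "v \<in> V" "z = v <# y" using z by (auto elim: translatesE)
  have "tr V {z} \<subseteq> tr V {y}"
  proof
    fix w assume "w \<in> tr V {z}"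
    then have "w \<in> tr V (tr V {y})" using z by (auto simp: translates_def)
    then show "w \<in> tr V {y}" using tr_tr [OF V, of "{y}"] y by simp
  qed
  moreover have "y = inv v <# z" using v y cosub_closed(1) [OF V] by simp
  then have "y \<in> tr V {z}" using cosub_closed(2) [OF V v(1)] by (simp add: orbit_eq)
  then have "tr V {y} \<subseteq> tr V (tr V {z})" by (auto simp: translates_def)
  then have "tr V {y} \<subseteq> tr V {z}"
    using tr_tr [OF V, of "{z}"] orbit_sub [OF V y] z by auto
  ultimately show ?thesis by blast
qed

text \<open>The preimage of a point is a left coset of \<open>H\<close>, closed because
  \<open>H\<close> is closed.\<close>

lemma closed_point:
  assumes "y \<in> lcosets H"
  shows "closedin X {y}"
proof -
  obtain x where x: "x \<in> carrier G" "y = x <# H" using cosetE assms by blast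
  have "closedin T {z \<in> topspace T. inv x \<otimes> z \<in> H}"
    using closedin_continuous_map_preimage [OF cont_lmult H_closed] x by simp
  then have "openin T (topspace T - {z \<in> topspace T. inv x \<otimes> z \<in> H})" by blast
  moreover have "topspace T - {z \<in> topspace T. inv x \<otimes> z \<in> H} = {z \<in> carrier G. z <# H \<in> lcosets H - {y}}"
    using x proj_eq_iff by auto
  ultimately have "openin X (lcosets H - {y})" by (simp add: openX)
  then show ?thesis using assms by (simp add: closedin_def)
qed

lemma open_orbit: "cosub V \<Longrightarrow> y \<in> lcosets H \<Longrightarrow> openin X (tr V {y})"
  by (intro open_tr) (auto dest: cosubD)

text \<open>If \<open>V z\<close> misses \<open>y\<close>, then the orbits \<open>V y\<close> and
  \<open>V z\<close> are distinct, hence disjoint, and separate the two points.\<close>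

lemma Hausdorff_X: "Hausdorff_space X"
  unfolding Hausdorff_space_def
proof (intro allI impI)
  fix y z assume yz: "y \<in> topspace X \<and> z \<in> topspace X \<and> y \<noteq> z"
  then have "openin X (topspace X - {y})" using closed_point closedin_def by (metis topspace_X)
  then obtain V where V: "cosub V" "tr V {z} \<subseteq> topspace X - {y}"
    using orbit_nbhd [of "topspace X - {y}" z] yz by blast
  have "disjnt (tr V {y}) (tr V {z})"
  proof (rule ccontr)
    assume "\<not> ?thesis"
    then obtain w where w: "w \<in> tr V {y}" "w \<in> tr V {z}" by (auto simp: disjnt_iff)
    have yz': "y \<in> lcosets H" "z \<in> lcosets H" using yz by simp_all
    have "tr V {y} = tr V {z}"
      by (rule trans [OF orbit_sym [OF V(1) yz'(1) w(1), symmetric] orbit_sym [OF V(1) yz'(2) w(2)]])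
    then show False using V(2) orbit_self [OF V(1) yz'(1)] by blast
  qed
  then show "\<exists>U V. openin X U \<and> openin X V \<and> y \<in> U \<and> z \<in> V \<and> disjnt U V"
    using open_orbit [OF V(1)] orbit_self [OF V(1)] yz by (metis topspace_X)
qed

text \<open>Finitely many orbits \<open>V y\<close> inside \<open>W\<close> cover \<open>K\<close>,
  each with its own \<open>V\<close>. Their union is invariant under the intersection of the
  subgroups involved.\<close>

lemma compact_open_between:
  assumes K: "compactin X K" and W: "openin X W" "K \<subseteq> W"
  obtains C V where "cosub V" "compactin X C" "openin X C" "K \<subseteq> C" "C \<subseteq> W" "tr V C \<subseteq> C"
proof -
  have Wc: "W \<subseteq> lcosets H" using W openX by blast
  have "\<forall>y. \<exists>V. y \<in> W \<longrightarrow> cosub V \<and> tr V {y} \<subseteq> W" using orbit_nbhd [OF W(1)] by metis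
  from choice [OF this] obtain V where V: "\<And>y. y \<in> W \<Longrightarrow> cosub (V y)" "\<And>y. y \<in> W \<Longrightarrow> tr (V y) {y} \<subseteq> W"
    by blast
  have "\<forall>U\<in>(\<lambda>y. tr (V y) {y}) ` K. openin X U"
    using V(1) W(2) Wc open_orbit by (auto simp: subset_iff)
  moreover have "K \<subseteq> \<Union>((\<lambda>y. tr (V y) {y}) ` K)"
  proof
    fix y assume "y \<in> K"
    then have "y \<in> tr (V y) {y}" using V(1) W(2) Wc orbit_self by blast
    then show "y \<in> \<Union>((\<lambda>y. tr (V y) {y}) ` K)" using \<open>y \<in> K\<close> by blast
  qed
  ultimately obtain \<F> where F: "finite \<F>" "\<F> \<subseteq> (\<lambda>y. tr (V y) {y}) ` K" "K \<subseteq> \<Union>\<F>"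
    using K unfolding compactin_def by meson
  obtain F where F': "F \<subseteq> K" "finite F" "\<F> = (\<lambda>y. tr (V y) {y}) ` F"
    using finite_subset_image [OF F(1,2)] by auto
  then have F: "finite F" "F \<subseteq> K" "K \<subseteq> (\<Union>y\<in>F. tr (V y) {y})" using F(3) by simp_all
  have FW: "y \<in> F \<Longrightarrow> y \<in> W" for y using F W by blast
  have FY: "y \<in> F \<Longrightarrow> y \<in> lcosets H" for y using FW Wc by blast
  let ?C = "\<Union>y\<in>F. tr (V y) {y}"
  have "compactin X ?C" by (rule compactin_Union) (use F(1) FW FY V(1) compact_orbit cosubD(3) in auto)
  moreover have "openin X ?C" by (rule openin_Union) (use FW FY V(1) open_orbit in auto)
  moreover have "?C \<subseteq> W" using V(2) FW by blast
  ultimately have C: "compactin X ?C" "openin X ?C" "?C \<subseteq> W" by blast+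
  \<comment> \<open>\<open>U0\<close> keeps the family of subgroups nonempty when \<open>K\<close>,
    and with it \<open>F\<close>, is empty.\<close>
  obtain U0 where U0: "cosub U0" using van_Dantzig [of "carrier G"] openin_topspace [of T] by auto
  let ?U = "\<Inter>(insert U0 (V ` F))"
  have U: "cosub ?U" by (rule cosub_Inter) (use F FW V U0 in auto)
  have "tr ?U ?C \<subseteq> ?C"
  proof
    fix z assume "z \<in> tr ?U ?C"
    then obtain a c where ac: "a \<in> ?U" "c \<in> ?C" "z = a <# c" by (rule translatesE)
    then obtain y where y: "y \<in> F" "c \<in> tr (V y) {y}" by blast
    have "z \<in> tr (V y) {c}" using ac y by (auto simp: orbit_eq)
    then have "z \<in> tr (V y) {y}" using orbit_sym [OF V(1) FY y(2)] y FW by blast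
    then show "z \<in> ?C" using y by blast
  qed
  then show thesis using that U C F(3) by blast
qed

lemma compact_open_invariant:
  assumes "compactin X C" "openin X C"
  obtains V where "cosub V" "tr V C \<subseteq> C"
  using compact_open_between [OF assms order_refl] by (metis subset_antisym)

lemma cosub_exists: obtains V where "cosub V"
  using van_Dantzig [of "carrier G"] openin_topspace [of T] by auto

end

section \<open>Invariant probability measures on coset spaces\<close>

locale tdlc_inv = tdlc_pair +
  fixes M :: "'a set measure"
  assumes inv_prob: "invariant_prob_measure G T H M"
begin

lemma space_M [simp]: "space M = lcosets H"
  and sets_M: "sets M = sigma_sets (lcosets H) {U. openin X U}"
  and emeasure_X: "emeasure M (lcosets H) = 1"
  and inner: "A \<in> sets M \<Longrightarrow> emeasure M A = (SUP K \<in> {K. compactin X K \<and> K \<subseteq> A}. emeasure M K)"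
  and emeasure_act: "g \<in> carrier G \<Longrightarrow> A \<in> sets M \<Longrightarrow> emeasure M ((\<lambda>C. g <# C) ` A) = emeasure M A"
  using inv_prob by (auto simp: invariant_prob_measure_def Borel_prob_measure_def)

end

sublocale tdlc_inv \<subseteq> finite_measure M
  by (rule finite_measureI) (simp add: emeasure_X)

context tdlc_inv
begin

lemma measure_X: "measure M (lcosets H) = 1"
  by (simp add: measure_def emeasure_X)

lemma sets_sub: "A \<in> sets M \<Longrightarrow> A \<subseteq> lcosets H"
  using sets.sets_into_space by fastforce

lemma open_sets [measurable_dest]: "openin X W \<Longrightarrow> W \<in> sets M"
  unfolding sets_M by (rule sigma_sets.Basic) simp

lemma closed_sets: "closedin X W \<Longrightarrow> W \<in> sets M"
  by (metis closedin_def open_sets double_diff sets.compl_sets space_M subset_refl topspace_X)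

lemma compact_sets: "compactin X K \<Longrightarrow> K \<in> sets M"
  using closed_sets compactin_imp_closedin Hausdorff_X by blast

lemma act_measurable: "g \<in> carrier G \<Longrightarrow> (\<lambda>y. g <# y) \<in> measurable M M"
proof (rule measurable_sigma_sets [OF sets_M])
  assume g: "g \<in> carrier G"
  show "{U. openin X U} \<subseteq> Pow (lcosets H)" using openX by blast
  show "(\<lambda>y. g <# y) \<in> space M \<rightarrow> lcosets H" using g by auto
  fix W assume "W \<in> {U. openin X U}"
  then have "openin X {y \<in> topspace X. g <# y \<in> W}"
    using openin_continuous_map_preimage [OF cont_act [OF g]] by blast
  moreover have "{y \<in> topspace X. g <# y \<in> W} = (\<lambda>y. g <# y) -` W \<inter> space M" by auto
  ultimately show "(\<lambda>y. g <# y) -` W \<inter> space M \<in> sets M" using open_sets by simp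
qed

lemma act_sets:
  assumes g: "g \<in> carrier G" and A: "A \<in> sets M"
  shows "(\<lambda>y. g <# y) ` A \<in> sets M"
proof -
  have "(\<lambda>y. inv g <# y) -` A \<inter> space M \<in> sets M"
    using measurable_sets [OF act_measurable A] g by simp
  moreover have "(\<lambda>y. inv g <# y) -` A \<inter> space M = (\<lambda>y. g <# y) ` A"
    using act_image_eq [OF g sets_sub [OF A]] by auto
  ultimately show ?thesis by simp
qed

lemma measure_act: "g \<in> carrier G \<Longrightarrow> A \<in> sets M \<Longrightarrow> measure M ((\<lambda>y. g <# y) ` A) = measure M A"
  by (simp add: emeasure_act measure_def)

lemma inner_approx:
  assumes A: "A \<in> sets M" and e: "0 < (e::real)"
  obtains K where "compactin X K" "K \<subseteq> A" "measure M A < measure M K + e"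
proof -
  have "\<exists>K. compactin X K \<and> K \<subseteq> A \<and> measure M A < measure M K + e"
  proof (rule ccontr)
    assume no: "\<nexists>K. compactin X K \<and> K \<subseteq> A \<and> measure M A < measure M K + e"
    have le: "measure M K \<le> measure M A - e" if "compactin X K" "K \<subseteq> A" for K
    proof -
      have "\<not> measure M A < measure M K + e" using no that by blast
      then show ?thesis by linarith
    qed
    have "emeasure M A \<le> ennreal (measure M A - e)"
      unfolding inner [OF A] 
      by (rule SUP_least) (use le in \<open>auto simp: emeasure_eq_measure intro!: ennreal_leI\<close>)
    \<comment> \<open>\<open>ennreal\<close> truncates negative reals to zero; the empty compact set
      rules this case out.\<close>
    moreover have "measure M A - e \<ge> 0" using le [of "{}"] measure_nonneg [of M "{}"] by simp
    ultimately show False using e by (simp add: emeasure_eq_measure)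
  qed
  then show thesis using that by blast
qed

text \<open>The action is transitive, so finitely many translates of \<open>W\<close> cover a given
  compact set. A null \<open>W\<close> would make all compact sets null, against inner regularity
  and total mass 1.\<close>

lemma open_positive:
  assumes W: "openin X W" "W \<noteq> {}"
  shows "0 < measure M W"
proof (rule ccontr)
  assume "\<not> 0 < measure M W"
  then have W0: "measure M W = 0" using measure_nonneg [of M W] by linarith
  obtain y where y: "y \<in> W" using W by blast
  then have "y \<in> lcosets H" using W(1) openX by blast
  then obtain x where x: "x \<in> carrier G" "y = x <# H" using cosetE by blast
  have "measure M K = 0" if K: "compactin X K" for K
  proof -
    let ?W = "\<lambda>g. (\<lambda>z. g <# z) ` W"
    have "K \<subseteq> \<Union>(?W ` carrier G)"
    proof
      fix z assume "z \<in> K"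
      then have "z \<in> lcosets H" using K compactin_subset_topspace by fastforce
      then obtain z' where z: "z' \<in> carrier G" "z = z' <# H" using cosetE by blast
      have "z = (z' \<otimes> inv x) <# y" using x z by (simp add: act_proj m_assoc)
      then show "z \<in> \<Union>(?W ` carrier G)" using y x z by blast
    qed
    moreover have "\<forall>U\<in>?W ` carrier G. openin X U" using open_act [OF _ W(1)] by auto
    ultimately obtain \<F> where F: "finite \<F>" "\<F> \<subseteq> ?W ` carrier G" "K \<subseteq> \<Union>\<F>"
      using K unfolding compactin_def by meson
    have "U \<in> null_sets M" if U: "U \<in> \<F>" for U
    proof -
      obtain g where g: "g \<in> carrier G" "U = ?W g" using F U by blast
      then have "measure M U = 0" using measure_act [OF g(1) open_sets [OF W(1)]] W0 by simp
      then show ?thesis using act_sets [OF g(1) open_sets [OF W(1)]] g(2)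
        by (simp add: null_sets_def emeasure_eq_measure)
    qed
    then have "\<Union>\<F> \<in> null_sets M" using F(1) by (intro null_sets.finite_Union) auto
    then have "K \<in> null_sets M" using compact_sets [OF K] F(3) null_sets_subset by blast
    then show ?thesis by (simp add: measure_def null_setsD1)
  qed
  moreover obtain K where "compactin X K" "measure M (lcosets H) < measure M K + 1"
    using inner_approx [of "lcosets H" 1] sets.top [of M] by auto
  ultimately show False using measure_X by simp
qed

section \<open>The pseudometric given by the measure of the symmetric difference\<close>

definition meas_dist :: "'a set set \<Rightarrow> 'a set set \<Rightarrow> real" where
  "meas_dist A B = measure M (A - B) + measure M (B - A)"

lemma meas_dist_sym: "meas_dist A B = meas_dist B A" and meas_dist_nonneg: "0 \<le> meas_dist A B" and meas_dist_self [simp]: "meas_dist A A = 0"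
  by (simp_all add: meas_dist_def)

lemma meas_dist_triangle:
  assumes [measurable]: "A \<in> sets M" "B \<in> sets M" "C \<in> sets M"
  shows "meas_dist A C \<le> meas_dist A B + meas_dist B C"
proof -
  have "measure M (A - C) \<le> measure M ((A - B) \<union> (B - C))" by (rule finite_measure_mono) auto
  also have "\<dots> \<le> measure M (A - B) + measure M (B - C)" by (rule measure_Un_le) auto
  finally have 1: "measure M (A - C) \<le> measure M (A - B) + measure M (B - C)" .
  have "measure M (C - A) \<le> measure M ((C - B) \<union> (B - A))" by (rule finite_measure_mono) auto
  also have "\<dots> \<le> measure M (C - B) + measure M (B - A)" by (rule measure_Un_le) auto
  finally show ?thesis using 1 by (simp add: meas_dist_def)
qed

lemma meas_dist_measure:
  assumes [measurable]: "A \<in> sets M" "B \<in> sets M"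
  shows "\<bar>measure M A - measure M B\<bar> \<le> meas_dist A B"
proof -
  have "measure M A \<le> measure M (B \<union> (A - B))" by (rule finite_measure_mono) auto
  also have "\<dots> \<le> measure M B + measure M (A - B)" by (rule measure_Un_le) auto
  finally have 1: "measure M A \<le> measure M B + measure M (A - B)" .
  have "measure M B \<le> measure M (A \<union> (B - A))" by (rule finite_measure_mono) auto
  also have "\<dots> \<le> measure M A + measure M (B - A)" by (rule measure_Un_le) auto
  finally show ?thesis using 1 measure_nonneg [of M "A - B"] measure_nonneg [of M "B - A"]
    unfolding meas_dist_def abs_le_iff by linarith
qed

lemma meas_dist_Int:
  assumes [measurable]: "A \<in> sets M" "B \<in> sets M" "C \<in> sets M"
  shows "meas_dist (A \<inter> C) (B \<inter> C) \<le> meas_dist A B"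
  unfolding meas_dist_def by (intro add_mono finite_measure_mono) auto

lemma meas_dist_act:
  assumes "g \<in> carrier G" and A: "A \<in> sets M" and B: "B \<in> sets M"
  shows "meas_dist ((\<lambda>y. g <# y) ` A) ((\<lambda>y. g <# y) ` B) = meas_dist A B"
proof -
  have "(\<lambda>y. g <# y) ` A - (\<lambda>y. g <# y) ` B = (\<lambda>y. g <# y) ` (A - B)"
    "(\<lambda>y. g <# y) ` B - (\<lambda>y. g <# y) ` A = (\<lambda>y. g <# y) ` (B - A)"
    by (rule inj_on_image_set_diff [OF act_inj [OF assms(1)], symmetric]; use sets_sub [OF A] sets_sub [OF B] in blast)+
  then show ?thesis using assms by (simp add: meas_dist_def measure_act)
qed

lemma invariant_image:
  assumes V: "cosub V" and C: "C \<subseteq> lcosets H" "tr V C \<subseteq> C" and v: "v \<in> V"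
  shows "(\<lambda>y. v <# y) ` C = C"
proof
  show "(\<lambda>y. v <# y) ` C \<subseteq> C" using C v by (auto simp: translates_def)
  show "C \<subseteq> (\<lambda>y. v <# y) ` C"
  proof
    fix y assume y: "y \<in> C"
    then have "inv v <# y \<in> C" using C(2) cosub_closed(2) [OF V v] by (auto simp: translates_def)
    moreover have "y = v <# (inv v <# y)" using y C(1) cosub_closed(1) [OF V v] by auto
    ultimately show "y \<in> (\<lambda>y. v <# y) ` C" by blast
  qed
qed

text \<open>Inner regularity of \<open>A\<close> and of its complement gives compact sets
  \<open>K\<close> and \<open>L\<close>. A compact open set between \<open>K\<close> and the
  complement of \<open>L\<close> differs from \<open>A\<close> only within the two small
  remainders.\<close>

lemma compact_open_approx:
  assumes A: "A \<in> sets M" and e: "0 < e"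
  obtains C V where "cosub V" "compactin X C" "openin X C" "tr V C \<subseteq> C" "meas_dist A C < e"
proof -
  obtain K where K: "compactin X K" "K \<subseteq> A" "measure M A < measure M K + e / 2"
    using inner_approx [OF A, of "e / 2"] e by auto
  have "lcosets H - A \<in> sets M" using A sets.compl_sets by fastforce
  then obtain L where L: "compactin X L" "L \<subseteq> lcosets H - A" "measure M (lcosets H - A) < measure M L + e / 2"
    using inner_approx [of "lcosets H - A" "e / 2"] e by auto
  have Ls: "L \<in> sets M" and Ks: "K \<in> sets M" using K L compact_sets by auto
  have "closedin X L" using L compactin_imp_closedin Hausdorff_X by blast
  then have op: "openin X (lcosets H - L)" using closedin_def by (metis topspace_X)
  have KL: "K \<subseteq> lcosets H - L" using K L sets_sub [OF A] by blast
  obtain C V where C: "cosub V" "compactin X C" "openin X C" "K \<subseteq> C" "C \<subseteq> lcosets H - L" "tr V C \<subseteq> C"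
    by (rule compact_open_between [OF K(1) op KL])
  have "measure M (A - C) \<le> measure M (A - K)" by (rule finite_measure_mono) (use C A Ks in auto)
  also have "\<dots> = measure M A - measure M K" using A Ks K by (intro finite_measure_Diff) auto
  finally have 1: "measure M (A - C) < e / 2" using K by simp
  have "measure M (C - A) \<le> measure M ((lcosets H - A) - L)"
    by (rule finite_measure_mono) (use C A Ls sets.compl_sets [of _ M] in \<open>auto intro!: sets.Diff [of _ M L]\<close>)
  also have "\<dots> = measure M (lcosets H - A) - measure M L" 
    using Ls L(2) \<open>lcosets H - A \<in> sets M\<close> by (intro finite_measure_Diff) auto
  finally have "measure M (C - A) < e / 2" using L by simp
  then have "meas_dist A C < e" using 1 by (simp add: meas_dist_def)
  then show thesis using that C by blast
qed

text \<open>Approximate \<open>A\<close> by a \<open>V\<close>-invariant \<open>C\<close>. For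
  \<open>v\<close> in \<open>V\<close>, the translate of \<open>A\<close> is as close to
  \<open>C\<close> as \<open>A\<close> itself, because \<open>v\<close> fixes \<open>C\<close> and
  acts isometrically.\<close>

lemma meas_dist_continuous:
  assumes A: "A \<in> sets M" and e: "0 < e"
  shows "\<exists>V. cosub V \<and> (\<forall>v\<in>V. meas_dist ((\<lambda>y. v <# y) ` A) A < e)"
proof -
  obtain C V where C: "cosub V" "compactin X C" "openin X C" "tr V C \<subseteq> C" "meas_dist A C < e / 2"
    by (rule compact_open_approx [OF A half_gt_zero [OF e]])
  have Cs: "C \<in> sets M" using C open_sets by blast
  have "meas_dist ((\<lambda>y. v <# y) ` A) A < e" if v: "v \<in> V" for v
  proof -
    have vG: "v \<in> carrier G" using cosub_closed(1) [OF C(1) v] .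
    have vC: "(\<lambda>y. v <# y) ` C = C" using invariant_image [OF C(1) sets_sub [OF Cs] C(4) v] .
    have "meas_dist ((\<lambda>y. v <# y) ` A) A \<le> meas_dist ((\<lambda>y. v <# y) ` A) C + meas_dist C A"
      by (rule meas_dist_triangle) (use A Cs act_sets [OF vG A] in auto)
    also have "meas_dist ((\<lambda>y. v <# y) ` A) C = meas_dist A C" using meas_dist_act [OF vG A Cs] vC by simp
    finally show ?thesis using C(5) meas_dist_sym [of A C] by simp
  qed
  then show ?thesis using C(1) by blast
qed

definition almost_inv :: "'a set set \<Rightarrow> bool" where
  "almost_inv A \<longleftrightarrow> A \<in> sets M \<and> (\<forall>g\<in>carrier G. meas_dist ((\<lambda>y. g <# y) ` A) A = 0)"

lemma almost_inv_space: "almost_inv (lcosets H)"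
  using sets.top [of M] by (simp add: almost_inv_def act_image)

text \<open>In other words, \<open>measure M (A \<inter> B)\<close> is an invariant measure in
  \<open>B\<close>. Statements about two invariant measures are therefore phrased with two almost
  invariant sets below.\<close>

lemma almost_inv_Int:
  assumes A: "almost_inv A" and g: "g \<in> carrier G" and B: "B \<in> sets M"
  shows "measure M (A \<inter> (\<lambda>y. g <# y) ` B) = measure M (A \<inter> B)"
proof -
  let ?g = "\<lambda>A. (\<lambda>y. g <# y) ` A"
  have As: "A \<in> sets M" "meas_dist (?g A) A = 0" using A g by (auto simp: almost_inv_def)
  have s: "?g A \<in> sets M" "?g B \<in> sets M" using act_sets g As B by auto
  have "meas_dist (?g A \<inter> ?g B) (A \<inter> ?g B) \<le> meas_dist (?g A) A" by (rule meas_dist_Int) (use As s in auto)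
  then have "\<bar>measure M (?g A \<inter> ?g B) - measure M (A \<inter> ?g B)\<bar> \<le> 0"
    using meas_dist_measure [of "?g A \<inter> ?g B" "A \<inter> ?g B"] s As by auto
  then have "measure M (A \<inter> ?g B) = measure M (?g A \<inter> ?g B)" by simp
  also have "?g A \<inter> ?g B = ?g (A \<inter> B)"
    using inj_on_image_Int [OF act_inj [OF g]] sets_sub [OF As(1)] sets_sub [OF B] by simp
  also have "measure M \<dots> = measure M (A \<inter> B)" using measure_act [OF g] As B by simp
  finally show ?thesis .
qed

end

section \<open>Almost invariant sets\<close>

context tdlc_inv
begin

section \<open>Counting cosets of a smaller compact open subgroup\<close>

definition cosets_in :: "'a set \<Rightarrow> 'a set \<Rightarrow> 'a set set" where
  "cosets_in U V = (\<lambda>w. w <# V) ` U"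

lemma mem_l_coset: "z \<in> w <# V \<longleftrightarrow> (\<exists>v\<in>V. z = w \<otimes> v)"
  by (auto simp: l_coset_def)

lemma finite_cosets_in:
  assumes U: "cosub U" and V: "cosub V" "V \<subseteq> U"
  shows "finite (cosets_in U V)"
proof -
  obtain F where F: "finite F" "F \<subseteq> U" "U \<subseteq> F <#> V"
    using compact_finite_cover [OF cosubD(3) [OF U] V(1)] by blast
  have "cosets_in U V \<subseteq> (\<lambda>w. w <# V) ` F"
  proof
    fix r assume "r \<in> cosets_in U V"
    then obtain w where w: "w \<in> U" "r = w <# V" by (auto simp: cosets_in_def)
    then obtain f v where fv: "f \<in> F" "v \<in> V" "w = f \<otimes> v" using F(3) by (auto simp: set_mult_def)
    then have "f \<in> carrier G" using F(2) cosubD(5) [OF U] by blast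
    then have "f <# V = w <# V"
      using l_repr_independence [of w f V] fv cosubD(1) [OF V(1)] by (auto simp: mem_l_coset)
    then show "r \<in> (\<lambda>w. w <# V) ` F" using w fv by blast
  qed
  then show ?thesis using F(1) finite_subset by blast
qed

lemma cosets_in_sub: "cosub U \<Longrightarrow> V \<subseteq> U \<Longrightarrow> r \<in> cosets_in U V \<Longrightarrow> r \<subseteq> U"
  by (auto simp: cosets_in_def mem_l_coset cosub_closed(3) subset_iff)

lemma cosets_in_act:
  assumes U: "cosub U" and V: "V \<subseteq> U" and u: "u \<in> U" and r: "r \<in> cosets_in U V"
  shows "u <# r \<in> cosets_in U V"
proof -
  obtain w where w: "w \<in> U" "r = w <# V" using r by (auto simp: cosets_in_def)
  then have "u <# r = (u \<otimes> w) <# V"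
    using lcos_m_assoc [of V u w] cosub_closed(1) [OF U] u V by (auto simp: subset_iff)
  then show ?thesis using cosub_closed(3) [OF U] u w by (auto simp: cosets_in_def)
qed

text \<open>The number does not depend on the point: \<open>r \<mapsto> u r\<close> is a bijection
  between the two families. If \<open>d\<close> is in \<open>r \<inter> D\<close>, then
  \<open>u c\<close> is \<open>u d\<close> applied to \<open>inv d <# c\<close>, which lies in
  \<open>C\<close>. Conversely, \<open>u c = w c'\<close> with \<open>c\<close> and
  \<open>c'\<close> represented in \<open>D\<close> forces \<open>inv u \<otimes> w\<close> into
  \<open>D\<close>.\<close>

lemma card_cosets_through:
  assumes U: "cosub U" and V: "cosub V" "V \<subseteq> U" and D: "subgroup D G" "H \<subseteq> D"
    and C: "C \<subseteq> (\<lambda>x. x <# H) ` D" and inv: "tr (U \<inter> D) C \<subseteq> C"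
    and u: "u \<in> U" and c: "c \<in> C"
  shows "card {r \<in> cosets_in U V. u <# c \<in> tr r C} = card {r \<in> cosets_in U V. r \<inter> D \<noteq> {}}"
proof (rule bij_betw_same_card [symmetric])
  interpret D: subgroup D G by fact
  have uG: "u \<in> carrier G" using u cosub_closed(1) [OF U] by blast
  have inv_u: "inv u \<in> U" using u cosub_closed(2) [OF U] by blast
  have CY: "C \<subseteq> lcosets H" using C D.subset proj_in by blast
  have rG: "r \<subseteq> carrier G" if "r \<in> cosets_in U V" for r
    using cosets_in_sub [OF U V(2) that] cosubD(5) [OF U] by blast
  show "bij_betw (\<lambda>r. u <# r) {r \<in> cosets_in U V. r \<inter> D \<noteq> {}} {r \<in> cosets_in U V. u <# c \<in> tr r C}"
  proof (rule bij_betw_byWitness [where f' = "\<lambda>r. inv u <# r"])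
    show "\<forall>r\<in>{r \<in> cosets_in U V. r \<inter> D \<noteq> {}}. inv u <# (u <# r) = r"
      using rG uG by (simp add: lcos_m_assoc lcos_mult_one)
    show "\<forall>r\<in>{r \<in> cosets_in U V. u <# c \<in> tr r C}. u <# (inv u <# r) = r"
      using rG uG by (simp add: lcos_m_assoc lcos_mult_one)
    show "(\<lambda>r. u <# r) ` {r \<in> cosets_in U V. r \<inter> D \<noteq> {}} \<subseteq> {r \<in> cosets_in U V. u <# c \<in> tr r C}"
    proof
      fix r' assume "r' \<in> (\<lambda>r. u <# r) ` {r \<in> cosets_in U V. r \<inter> D \<noteq> {}}"
      then obtain r d where r: "r \<in> cosets_in U V" and d: "d \<in> r" "d \<in> D" and r': "r' = u <# r" by blast
      have "u <# r \<in> cosets_in U V" by (rule cosets_in_act [OF U V(2) u r])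
      have dU: "d \<in> U" using cosets_in_sub [OF U V(2) r] d by blast
      have dG: "d \<in> carrier G" using d D.subset by blast
      have "inv d <# c \<in> C"
        using inv translatesI [of "inv d" "U \<inter> D" c C G] c d dU cosub_closed(2) [OF U] by auto
      moreover have "u \<otimes> d \<in> u <# r" using d by (auto simp: mem_l_coset)
      ultimately have "(u \<otimes> d) <# (inv d <# c) \<in> tr (u <# r) C" by (rule translatesI [rotated])
      moreover have "(u \<otimes> d) <# (inv d <# c) = u <# c"
        using uG dG c CY act_mult [of "inv d <# c" u d, symmetric] by (auto simp: subset_iff)
      ultimately have "u <# c \<in> tr (u <# r) C" by simp
      then show "r' \<in> {r \<in> cosets_in U V. u <# c \<in> tr r C}"
        using \<open>u <# r \<in> cosets_in U V\<close> r' by simp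
    qed
    show "(\<lambda>r. inv u <# r) ` {r \<in> cosets_in U V. u <# c \<in> tr r C} \<subseteq> {r \<in> cosets_in U V. r \<inter> D \<noteq> {}}"
    proof
      fix r' assume "r' \<in> (\<lambda>r. inv u <# r) ` {r \<in> cosets_in U V. u <# c \<in> tr r C}"
      then obtain r where r: "r \<in> cosets_in U V" and uc: "u <# c \<in> tr r C" and r': "r' = inv u <# r" by blast
      have "inv u <# r \<in> cosets_in U V" by (rule cosets_in_act [OF U V(2) inv_u r])
      obtain w c' where w: "w \<in> r" "c' \<in> C" "u <# c = w <# c'" using uc by (rule translatesE)
      have wG: "w \<in> carrier G" using rG [OF r] w by blast
      obtain x x' where x: "x \<in> D" "c = x <# H" "x' \<in> D" "c' = x' <# H" using C c w by blast
      then have xG: "x \<in> carrier G" "x' \<in> carrier G" by auto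
      have "(u \<otimes> x) <# H = (w \<otimes> x') <# H" using w x xG uG wG by (simp add: act_proj)
      then have "inv (u \<otimes> x) \<otimes> (w \<otimes> x') \<in> D" using proj_eq_iff uG wG xG D(2) by auto
      then have "x \<otimes> (inv (u \<otimes> x) \<otimes> (w \<otimes> x')) \<otimes> inv x' \<in> D" using x by auto
      moreover have "x \<otimes> (inv (u \<otimes> x) \<otimes> (w \<otimes> x')) \<otimes> inv x' = x \<otimes> (inv x \<otimes> (inv u \<otimes> (w \<otimes> (x' \<otimes> inv x'))))"
        using uG wG xG by (simp add: inv_mult_group m_assoc del: r_inv)
      moreover have "\<dots> = inv u \<otimes> w"
        using uG wG xG by (simp add: m_assoc [symmetric])
      ultimately have "inv u \<otimes> w \<in> D" by simp
      moreover have "inv u \<otimes> w \<in> inv u <# r" using w by (auto simp: mem_l_coset)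
      ultimately show "r' \<in> {r \<in> cosets_in U V. r \<inter> D \<noteq> {}}"
        using \<open>inv u <# r \<in> cosets_in U V\<close> r' by blast
    qed
  qed
qed

text \<open>Every point of \<open>U C\<close> lies in equally many of the sets \<open>r C\<close>,
  where \<open>r\<close> runs over the cosets of \<open>V\<close> in \<open>U\<close>. Integrating
  over \<open>A\<close>, where all \<open>r C\<close> have the same measure as \<open>V C\<close>,
  gives the identity. Both coefficients depend on \<open>U\<close>, \<open>V\<close> and
  \<open>D\<close> only.\<close>

lemma orbit_count:
  assumes U: "cosub U" and V: "cosub V" "V \<subseteq> U" and D: "subgroup D G" "H \<subseteq> D"
    and C: "C \<subseteq> (\<lambda>x. x <# H) ` D" and inv: "tr (U \<inter> D) C \<subseteq> C" and A: "almost_inv A"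
  shows "real (card (cosets_in U V)) * measure M (A \<inter> tr V C)
    = real (card {r \<in> cosets_in U V. r \<inter> D \<noteq> {}}) * measure M (A \<inter> tr U C)"
proof -
  let ?R = "cosets_in U V"
  define k where "k = card {r \<in> ?R. r \<inter> D \<noteq> {}}"
  have fR: "finite ?R" using finite_cosets_in U V by blast
  have As: "A \<in> sets M" using A by (simp add: almost_inv_def)
  have CY: "C \<subseteq> lcosets H" using C subgroup.subset [OF D(1)] proj_in by blast
  have VC: "tr V C \<in> sets M"
    using open_sets open_tr [OF _ CY] cosubD(2) [OF V(1)] by auto
  have tr_r: "tr (w <# V) C = (\<lambda>y. w <# y) ` tr V C" if w: "w \<in> U" for w
  proof -
    have eq: "(w \<otimes> v) <# c = w <# (v <# c)" if "v \<in> V" "c \<in> C" for v c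
      using that w CY cosub_closed(1) [OF U] cosub_closed(1) [OF V(1)] by (simp add: act_mult subset_iff)
    have "tr (w <# V) C = (\<Union>v\<in>V. (\<lambda>c. (w \<otimes> v) <# c) ` C)"
      by (simp add: translates_def l_coset_def [of G w V])
    also have "\<dots> = (\<Union>v\<in>V. (\<lambda>c. w <# (v <# c)) ` C)"
      using eq by (intro SUP_cong image_cong refl) auto
    also have "\<dots> = (\<lambda>y. w <# y) ` tr V C" by (simp add: translates_def image_UN image_image)
    finally show ?thesis .
  qed
  have r_sets: "tr r C \<in> sets M" and r_meas: "measure M (A \<inter> tr r C) = measure M (A \<inter> tr V C)" if r: "r \<in> ?R" for r
  proof -
    obtain w where w: "w \<in> U" "r = w <# V" using r by (auto simp: cosets_in_def)
    then show "tr r C \<in> sets M" "measure M (A \<inter> tr r C) = measure M (A \<inter> tr V C)"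
      using tr_r act_sets [OF _ VC] almost_inv_Int [OF A _ VC] cosub_closed(1) [OF U] by auto
  qed
  \<comment> \<open>The count as an identity of functions; off \<open>A \<inter> tr U C\<close> both
    sides vanish, since every \<open>r\<close> is contained in \<open>U\<close>.\<close>
  have pt: "(\<Sum>r\<in>?R. indicator (A \<inter> tr r C) y) = real k * indicator (A \<inter> tr U C) y" for y
  proof (cases "y \<in> A \<inter> tr U C")
    case True
    then obtain u c where uc: "u \<in> U" "c \<in> C" "y = u <# c" by (auto elim: translatesE)
    have "(\<Sum>r\<in>?R. indicator (A \<inter> tr r C) y) = (\<Sum>r\<in>?R. if y \<in> tr r C then 1 else (0::real))"
      using True by (intro sum.cong) (auto simp: indicator_def)
    also have "\<dots> = real (card {r \<in> ?R. y \<in> tr r C})"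
      using fR by (simp add: sum.If_cases Int_def)
    also have "card {r \<in> ?R. y \<in> tr r C} = k"
      unfolding uc(3) k_def by (rule card_cosets_through [OF U V D C inv uc(1,2)])
    finally show ?thesis using True by simp
  next
    case False
    have "y \<notin> A \<inter> tr r C" if "r \<in> ?R" for r
      using False cosets_in_sub [OF U V(2) that] by (auto simp: translates_def)
    then have "(\<Sum>r\<in>?R. indicator (A \<inter> tr r C) y) = (0::real)" by (intro sum.neutral) auto
    then show ?thesis using False by simp
  qed
  have "real (card ?R) * measure M (A \<inter> tr V C) = (\<Sum>r\<in>?R. measure M (A \<inter> tr r C))"
    using r_meas by simp
  also have "\<dots> = (\<Sum>r\<in>?R. \<integral>y. indicator (A \<inter> tr r C) y \<partial>M)"
    using r_sets As sets_sub [OF As] by (intro sum.cong) (auto simp: Int_absorb2 le_infI1)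
  also have "\<dots> = (\<integral>y. (\<Sum>r\<in>?R. indicator (A \<inter> tr r C) y) \<partial>M)"
    using r_sets As by (intro Bochner_Integration.integral_sum [symmetric] integrable_real_indicator) (auto simp: emeasure_eq_measure)
  also have "\<dots> = (\<integral>y. real k * indicator (A \<inter> tr U C) y \<partial>M)" by (simp only: pt)
  also have "\<dots> = real k * measure M (A \<inter> tr U C)"
    using sets_sub [OF As] by (simp add: Int_absorb2 le_infI1)
  finally show ?thesis by (simp add: k_def)
qed

lemma card_pos:
  assumes U: "cosub U" and V: "cosub V" "V \<subseteq> U" and D: "subgroup D G"
  shows "0 < card (cosets_in U V)" "0 < card {r \<in> cosets_in U V. r \<inter> D \<noteq> {}}"
proof -
  have "\<one> <# V \<in> cosets_in U V" using cosubD(4) [OF U] by (auto simp: cosets_in_def)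
  moreover have "\<one> \<in> \<one> <# V" using cosubD(4,5) [OF V(1)] by (simp add: lcos_mult_one)
  ultimately have 1: "\<one> <# V \<in> {r \<in> cosets_in U V. r \<inter> D \<noteq> {}}" using subgroup.one_closed [OF D] by blast
  have f: "finite (cosets_in U V)" using finite_cosets_in U V by blast
  show "0 < card (cosets_in U V)" "0 < card {r \<in> cosets_in U V. r \<inter> D \<noteq> {}}"
    using 1 f by (auto simp: card_gt_0_iff)
qed

text \<open>The factor by which the measure changes from \<open>U C\<close> to \<open>V C\<close> is
  independent of \<open>C\<close> and of the invariant measure. It is obtained by passing through
  \<open>U \<inter> V\<close>, and stated with products to avoid division by zero.\<close>

lemma orbit_ratio:
  assumes U: "cosub U" "tr (U \<inter> D) C \<subseteq> C" and V: "cosub V" "tr (V \<inter> D) C \<subseteq> C"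
    and D: "subgroup D G" "H \<subseteq> D" and C: "C \<subseteq> (\<lambda>x. x <# H) ` D"
    and C': "C' \<subseteq> (\<lambda>x. x <# H) ` D" "tr (U \<inter> D) C' \<subseteq> C'" "tr (V \<inter> D) C' \<subseteq> C'"
    and A: "almost_inv A" "almost_inv A'"
  shows "measure M (A \<inter> tr U C) * measure M (A' \<inter> tr V C') = measure M (A \<inter> tr V C) * measure M (A' \<inter> tr U C')"
proof -
  \<comment> \<open>For nested subgroups the two counting identities have the same coefficients,
    which are positive and cancel.\<close>
  have *: "measure M (A \<inter> tr U C) * measure M (A' \<inter> tr W C') = measure M (A \<inter> tr W C) * measure M (A' \<inter> tr U C')"
    if U: "cosub U" "tr (U \<inter> D) C \<subseteq> C" "tr (U \<inter> D) C' \<subseteq> C'" and W: "cosub W" "W \<subseteq> U" for U W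
  proof -
    note c = orbit_count [OF U(1) W D C U(2) A(1)] orbit_count [OF U(1) W D C'(1) U(3) A(2)]
    let ?p = "real (card (cosets_in U W))" and ?k = "real (card {r \<in> cosets_in U W. r \<inter> D \<noteq> {}})"
    have "?p > 0" "?k > 0" using card_pos [OF U(1) W D(1)] by auto
    moreover have "?k * (measure M (A \<inter> tr U C) * (?p * measure M (A' \<inter> tr W C')))
      = ?p * measure M (A \<inter> tr W C) * (?k * measure M (A' \<inter> tr U C'))"
      using c by (simp add: mult.assoc)
    ultimately show ?thesis by (simp add: ac_simps)
  qed
  let ?W = "U \<inter> V"
  let ?m = "measure M"
  have W: "cosub ?W" using cosub_Int U V by blast
  note 1 = * [OF U C'(2) W] and 2 = * [OF V C'(3) W]
  show ?thesis
  \<comment> \<open>Combining the two nested comparisons cancels one of the measures for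
    \<open>?W\<close>. If both vanish, the counting identity makes the measures for
    \<open>U C'\<close> and \<open>V C'\<close> vanish as well.\<close>
  proof (cases "?m (A' \<inter> tr ?W C') = 0 \<and> ?m (A \<inter> tr ?W C) = 0")
    case True
    have "?m (A' \<inter> tr U C') = 0 \<and> ?m (A' \<inter> tr V C') = 0"
      using True orbit_count [OF U(1) W _ D C'(1) C'(2) A(2)] orbit_count [OF V(1) W _ D C'(1) C'(3) A(2)]
        card_pos [OF U(1) W _ D(1)] card_pos [OF V(1) W _ D(1)] by simp
    then show ?thesis by simp
  next
    case False
    have "(?m (A \<inter> tr U C) * ?m (A' \<inter> tr V C')) * ?m (A' \<inter> tr ?W C') =
       (?m (A \<inter> tr ?W C) * ?m (A' \<inter> tr V C')) * ?m (A' \<inter> tr U C')"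
      using 1 by (simp add: ac_simps)
    also have "\<dots> = ?m (A \<inter> tr V C) * ?m (A' \<inter> tr U C') * ?m (A' \<inter> tr ?W C')"
      using 2 by (simp add: ac_simps)
    finally have a: "?m (A' \<inter> tr ?W C') \<noteq> 0 \<Longrightarrow> ?thesis" by simp
    have "(?m (A \<inter> tr U C) * ?m (A' \<inter> tr V C')) * ?m (A \<inter> tr ?W C) =
       ?m (A \<inter> tr U C) * (?m (A \<inter> tr V C) * ?m (A' \<inter> tr ?W C'))"
      using 2 by (simp add: ac_simps)
    also have "\<dots> = (?m (A \<inter> tr V C) * ?m (A' \<inter> tr U C')) * ?m (A \<inter> tr ?W C)"
      using 1 by (simp add: ac_simps)
    finally have "?m (A \<inter> tr ?W C) \<noteq> 0 \<Longrightarrow> ?thesis" by simp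
    then show ?thesis using a False by blast
  qed
qed

text \<open>Moves an orbit to the base point \<open>H\<close>, at the price of replacing
  \<open>V\<close> by its conjugate by \<open>inv x\<close>.\<close>

lemma tr_coset_H:
  assumes V: "cosub V" and x: "x \<in> carrier G"
  shows "tr V {x <# H} = (\<lambda>y. x <# y) ` tr {z \<in> carrier G. x \<otimes> z \<otimes> inv x \<in> V} {H}"
proof (intro equalityI subsetI)
  fix y assume "y \<in> tr V {x <# H}"
  then obtain v where v: "v \<in> V" "y = v <# (x <# H)" by (auto simp: orbit_eq)
  have vG: "v \<in> carrier G" using cosub_closed(1) [OF V v(1)] .
  have "x \<otimes> (inv x \<otimes> v \<otimes> x) \<otimes> inv x = v" using vG x by (simp add: m_assoc) (simp add: m_assoc [symmetric])
  moreover have "y = x <# ((inv x \<otimes> v \<otimes> x) <# H)"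
    using v vG x by (simp add: act_proj m_assoc) (simp add: m_assoc [symmetric])
  ultimately show "y \<in> (\<lambda>y. x <# y) ` tr {z \<in> carrier G. x \<otimes> z \<otimes> inv x \<in> V} {H}"
    using v vG x by (auto simp: orbit_eq intro!: image_eqI [of _ _ "inv x \<otimes> v \<otimes> x"])
next
  fix y assume "y \<in> (\<lambda>y. x <# y) ` tr {z \<in> carrier G. x \<otimes> z \<otimes> inv x \<in> V} {H}"
  then obtain z where z: "z \<in> carrier G" "x \<otimes> z \<otimes> inv x \<in> V" "y = x <# (z <# H)" by (auto simp: orbit_eq)
  then have "y = (x \<otimes> z \<otimes> inv x) <# (x <# H)" using x by (simp add: act_proj m_assoc)
  then show "y \<in> tr V {x <# H}" using z by (auto simp: orbit_eq)
qed

text \<open>Uniqueness of the invariant measure, for the restriction of \<open>M\<close> to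
  \<open>A\<close> against \<open>M\<close> itself. Proportionality is proved for orbits of the base
  point by \<open>orbit_ratio\<close>, for all orbits by conjugation, for compact open sets by
  disjoint decomposition, and for measurable sets by approximation.\<close>

theorem almost_inv_trivial:
  assumes A: "almost_inv A"
  shows "measure M A = 0 \<or> measure M A = 1"
proof -
  let ?m = "measure M"
  have As: "A \<in> sets M" using A by (simp add: almost_inv_def)
  obtain U where U: "cosub U" by (rule cosub_exists)
  \<comment> \<open>\<open>orbit_ratio\<close> is applied with \<open>D = H\<close>, where the coset
    space is the single point \<open>H\<close>.\<close>
  have H1: "{H} \<subseteq> (\<lambda>x. x <# H) ` H"
    using subgroup.one_closed [OF H_sub] lcos_mult_one [OF H_carrier] by force
  have H2: "tr (V \<inter> H) {H} \<subseteq> {H}" for V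
    using proj_H_iff H_carrier by (auto simp: translates_def)
  have tU: "0 < ?m (tr U {H})"
    by (rule open_positive) (use open_orbit [OF U H_in] orbit_self [OF U H_in] in auto)
  \<comment> \<open>The constant of proportionality, read off from one reference subgroup
    \<open>U\<close>.\<close>
  define c where "c = ?m (A \<inter> tr U {H}) / ?m (tr U {H})"
  have base: "?m (A \<inter> tr V {H}) = c * ?m (tr V {H})" if V: "cosub V" for V
  proof -
    have "?m (A \<inter> tr U {H}) * ?m (lcosets H \<inter> tr V {H}) = ?m (A \<inter> tr V {H}) * ?m (lcosets H \<inter> tr U {H})"
      by (rule orbit_ratio [OF U H2 V H2 H_sub order_refl H1 H1 H2 H2 A almost_inv_space])
    then show ?thesis using tU orbit_sub [OF U H_in] orbit_sub [OF V H_in]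
      by (simp add: c_def Int_absorb1 field_simps)
  qed
  have orb: "?m (A \<inter> tr V {y}) = c * ?m (tr V {y})" if V: "cosub V" and y: "y \<in> lcosets H" for V y
  proof -
    obtain x where x: "x \<in> carrier G" "y = x <# H" using cosetE y by blast
    let ?V = "{z \<in> carrier G. x \<otimes> z \<otimes> inv x \<in> V}"
    have cV: "cosub ?V" using cosub_conj [OF V, of "inv x"] x by simp
    have s: "tr ?V {H} \<in> sets M" using open_sets [OF open_orbit [OF cV H_in]] .
    show ?thesis unfolding x(2) tr_coset_H [OF V x(1)]
      using almost_inv_Int [OF A x(1) s] measure_act [OF x(1) s] base [OF cV] by simp
  qed
  have co: "?m (A \<inter> C) = c * ?m C" if V: "cosub V" and C: "compactin X C" "openin X C" "tr V C \<subseteq> C" for V C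
  proof -
    have CY: "C \<subseteq> lcosets H" using C(2) openX by blast
    let ?O = "(\<lambda>y. tr V {y}) ` C"
    have CO: "C = \<Union>?O"
    proof
      show "C \<subseteq> \<Union>?O" using orbit_self [OF V] CY by blast
      show "\<Union>?O \<subseteq> C" using C(3) by (auto simp: translates_def)
    qed
    have op: "\<forall>U\<in>?O. openin X U" using open_orbit [OF V] CY by auto
    have "C \<subseteq> \<Union>?O" using CO by simp
    then obtain \<F> where F: "finite \<F>" "\<F> \<subseteq> ?O" "C \<subseteq> \<Union>\<F>"
      using C(1) op unfolding compactin_def by meson
    have CF: "C = \<Union>\<F>" using F CO by blast
    have disj: "O1 \<inter> O2 = {}" if O: "O1 \<in> \<F>" "O2 \<in> \<F>" "O1 \<noteq> O2" for O1 O2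
    proof (rule ccontr)
      assume "O1 \<inter> O2 \<noteq> {}"
      then obtain z where z: "z \<in> O1" "z \<in> O2" by blast
      obtain y1 y2 where y: "y1 \<in> C" "y2 \<in> C" "O1 = tr V {y1}" "O2 = tr V {y2}" using O(1,2) F(2) by blast
      have "O1 = tr V {z}" "O2 = tr V {z}"
        using orbit_sym [OF V, of y1 z] orbit_sym [OF V, of y2 z] y z CY by blast+
      then show False using O(3) by blast
    qed
    have s: "Q \<in> sets M" if "Q \<in> \<F>" for Q using that F(2) op open_sets by blast
    have "?m C = (\<Sum>Q\<in>\<F>. ?m Q)"
      using CF measure_Union' [of \<F> M] s disj F(1)
      by (simp add: disjoint_def fmeasurable_eq_sets)
    moreover have "?m (A \<inter> C) = (\<Sum>Q\<in>\<F>. ?m (A \<inter> Q))"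
    proof -
      have "A \<inter> C = (\<Union>Q\<in>\<F>. A \<inter> Q)" using CF by blast
      moreover have "disjoint_family_on (\<lambda>Q. A \<inter> Q) \<F>"
        unfolding disjoint_family_on_def using disj by blast
      moreover have "(\<lambda>Q. A \<inter> Q) ` \<F> \<subseteq> sets M" using s As by blast
      ultimately show ?thesis using finite_measure_finite_Union [OF F(1)] by metis
    qed
    moreover have "?m (A \<inter> Q) = c * ?m Q" if "Q \<in> \<F>" for Q
      using that F(2) orb [OF V] CY by auto
    ultimately show ?thesis by (simp add: sum_distrib_left)
  qed
  have c0: "0 \<le> c" by (simp add: c_def)
  have all: "?m (A \<inter> B) = c * ?m B" if B: "B \<in> sets M" for B
  proof -
    have "\<bar>?m (A \<inter> B) - c * ?m B\<bar> \<le> e" if e: "0 < e" for e :: real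
    proof -
      \<comment> \<open>The error of the approximation enters once through
        \<open>A \<inter> B\<close> and once, multiplied by \<open>c\<close>, through
        \<open>B\<close>.\<close>
      have "0 < e / (1 + c)" using e c0 by simp
      then obtain C V where C: "cosub V" "compactin X C" "openin X C" "tr V C \<subseteq> C" "meas_dist B C < e / (1 + c)"
        by (rule compact_open_approx [OF B])
      have Cs: "C \<in> sets M" using open_sets C by blast
      have 1: "\<bar>?m (A \<inter> B) - ?m (A \<inter> C)\<bar> \<le> meas_dist B C"
        using meas_dist_measure [of "B \<inter> A" "C \<inter> A"] meas_dist_Int [OF B Cs As] B Cs As by (simp add: Int_commute)
      have "\<bar>c * ?m C - c * ?m B\<bar> = c * \<bar>?m B - ?m C\<bar>"
        using c0 by (simp add: abs_mult abs_minus_commute flip: right_diff_distrib)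
      also have "\<dots> \<le> c * meas_dist B C" using meas_dist_measure [OF B Cs] c0 by (intro mult_left_mono)
      finally have 2: "\<bar>c * ?m C - c * ?m B\<bar> \<le> c * meas_dist B C" .
      have "meas_dist B C + c * meas_dist B C = (1 + c) * meas_dist B C" by (simp add: algebra_simps)
      also have "\<dots> \<le> e" using C(5) c0 by (simp add: field_simps)
      finally show ?thesis using 1 2 co [OF C(1-4)] by linarith
    qed
    then have "\<bar>?m (A \<inter> B) - c * ?m B\<bar> \<le> 0" by (rule field_le_epsilon [where y = 0, simplified])
    then show ?thesis by simp
  qed
  \<comment> \<open>The whole space shows that \<open>c\<close> is the measure of \<open>A\<close>;
    taking \<open>B = A\<close> then shows that this number equals its square.\<close>
  have "?m A = c" using all [OF sets.top] measure_X sets_sub [OF As] by (simp add: Int_absorb2)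
  moreover have "?m A = c * ?m A" using all [OF As] by simp
  ultimately show ?thesis by simp
qed

end

section \<open>The invariant measure on a closed overgroup\<close>

text \<open>Induction over the generated sigma-algebra needs the stronger two-sided claim, with
  compact sets inside and open sets outside, since complements exchange the two sides.\<close>

lemma compact_open_inner_regular:
  fixes X :: "'b topology" and N :: "'b measure" and C :: "nat \<Rightarrow> 'b set"
  assumes fin: "finite_measure N" and sp: "space N = topspace X" and haus: "Hausdorff_space X"
    and st: "sets N = sigma_sets (topspace X) {C. compactin X C \<and> openin X C}"
    and op: "\<And>U. openin X U \<Longrightarrow> U \<in> sets N"
    and C: "\<And>n. compactin X (C n)" "\<And>n. openin X (C n)" "incseq C" "(\<Union>n. C n) = topspace X"
    and A: "A \<in> sets N"
  shows "emeasure N A = (SUP K \<in> {K. compactin X K \<and> K \<subseteq> A}. emeasure N K)"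
proof -
  interpret finite_measure N by fact
  let ?m = "measure N"
  have clX: "closedin X K" if "compactin X K" for K using that haus compactin_imp_closedin by blast
  have cl: "K \<in> sets N" if "closedin X K" for K
  proof -
    have "topspace X - (topspace X - K) \<in> sets N"
      using sets.compl_sets [OF op, of "topspace X - K"] that sp by (auto simp: closedin_def)
    then show ?thesis using closedin_subset [OF that] by (simp add: double_diff)
  qed
  have co: "K \<in> sets N" if "compactin X K" for K using that clX cl by blast
  have Asig: "A \<in> sigma_sets (topspace X) {C. compactin X C \<and> openin X C}" using A st by simp
  have approx: "\<forall>e>0. \<exists>K U. compactin X K \<and> openin X U \<and> K \<subseteq> A \<and> A \<subseteq> U \<and> ?m (U - K) < e"
    using Asig
  proof (induction rule: sigma_sets.induct)
    case (Basic a)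
    then show ?case by (intro allI impI exI [of _ a]) auto
  next
    case Empty
    then show ?case by (intro allI impI exI [of _ "{}"]) auto
  next
    case (Compl a)
    show ?case
    proof (intro allI impI)
      fix e :: real assume e: "0 < e"
      obtain K U where KU: "compactin X K" "openin X U" "K \<subseteq> a" "a \<subseteq> U" "?m (U - K) < e / 2"
        using Compl.IH [rule_format, OF half_gt_zero [OF e]] by blast
      \<comment> \<open>The complement of the outer open set is closed but perhaps not compact; it
        is cut down to some \<open>C n\<close> of nearly full measure.\<close>
      have "(\<lambda>n. ?m (C n)) \<longlonglongrightarrow> ?m (\<Union>n. C n)"
        using C op by (intro finite_Lim_measure_incseq) auto
      then have "eventually (\<lambda>n. dist (?m (C n)) (?m (topspace X)) < e / 2) sequentially"
        using half_gt_zero [OF e] unfolding C(4) by (rule tendstoD)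
      then obtain n where n: "dist (?m (C n)) (?m (topspace X)) < e / 2"
        by (auto simp: eventually_sequentially)
      have Cn: "?m (topspace X - C n) < e / 2"
        using finite_measure_compl [OF op [OF C(2) [of n]]] n unfolding sp dist_real_def by linarith
      have s: "C n \<in> sets N" "U \<in> sets N" "K \<in> sets N" "topspace X \<in> sets N"
        using op [OF C(2) [of n]] op [OF KU(2)] co [OF KU(1)] op [OF openin_topspace] by simp_all
      let ?K = "(topspace X - U) \<inter> C n"
      have "closedin X (topspace X - U)" using KU(2) by blast
      then have K: "compactin X ?K" using C(1) by (rule closed_Int_compactin)
      have U: "openin X (topspace X - K)" using clX [OF KU(1)] closedin_def by blast
      have "?m (topspace X - K - ?K) \<le> ?m ((U - K) \<union> (topspace X - C n))"
        by (rule finite_measure_mono) (use s in auto)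
      also have "\<dots> \<le> ?m (U - K) + ?m (topspace X - C n)" by (rule measure_Un_le) (use s in auto)
      also have "\<dots> < e" using Cn KU(5) by simp
      finally have "?m (topspace X - K - ?K) < e" .
      moreover have "?K \<subseteq> topspace X - a" "topspace X - a \<subseteq> topspace X - K" using KU by blast+
      ultimately show "\<exists>K U. compactin X K \<and> openin X U \<and> K \<subseteq> topspace X - a \<and> topspace X - a \<subseteq> U \<and> ?m (U - K) < e"
        using K U by blast
    qed
  next
    case (Union a)
    show ?case
    proof (intro allI impI)
      fix e :: real assume e: "0 < e"
      \<comment> \<open>Inner and outer set are packed into a pair, so that one application of
        choice selects both. The geometric bounds sum to \<open>e / 2\<close>.\<close>
      have "\<forall>i. \<exists>P. compactin X (fst P) \<and> openin X (snd P) \<and> fst P \<subseteq> a i \<and> a i \<subseteq> snd P \<and> ?m (snd P - fst P) < e / 2 * (1/2) ^ Suc i"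
      proof
        fix i
        have pos: "0 < e / 2 * (1/2) ^ Suc i" using e by simp
        obtain K U where "compactin X K \<and> openin X U \<and> K \<subseteq> a i \<and> a i \<subseteq> U \<and> ?m (U - K) < e / 2 * (1/2) ^ Suc i"
          using Union.IH [of i, rule_format, OF pos] by blast
        then show "\<exists>P. compactin X (fst P) \<and> openin X (snd P) \<and> fst P \<subseteq> a i \<and> a i \<subseteq> snd P \<and> ?m (snd P - fst P) < e / 2 * (1/2) ^ Suc i"
          by (intro exI [of _ "(K, U)"]) simp
      qed
      from choice [OF this] obtain P where P: "\<And>i. compactin X (fst (P i))" "\<And>i. openin X (snd (P i))"
        "\<And>i. fst (P i) \<subseteq> a i" "\<And>i. a i \<subseteq> snd (P i)" "\<And>i. ?m (snd (P i) - fst (P i)) < e / 2 * (1/2) ^ Suc i"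
        by blast
      define K where "K i = fst (P i)" for i
      define U where "U i = snd (P i)" for i
      define L where "L n = (\<Union>i<n. K i)" for n
      have Ks: "\<And>i. K i \<in> sets N" and Us: "\<And>i. U i \<in> sets N" using P co op by (auto simp: K_def U_def)
      have Ls: "L n \<in> sets N" for n unfolding L_def using Ks by blast
      have sums: "(\<lambda>i. e / 2 * (1/2) ^ Suc i) sums (e / 2 * 1)"
        by (rule sums_mult [OF power_half_series])
      have le: "?m (U i - K i) \<le> e / 2 * (1/2) ^ Suc i" for i using P(5) [of i] by (simp add: K_def U_def)
      have smm: "summable (\<lambda>i. ?m (U i - K i))"
        by (rule summable_comparison_test' [OF sums_summable [OF sums]]) (use le in auto)
      have "?m (\<Union>i. U i - K i) \<le> (\<Sum>i. ?m (U i - K i))"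
        by (rule finite_measure_subadditive_countably [OF _ smm]) (use Ks Us in auto)
      also have "\<dots> \<le> (\<Sum>i. e / 2 * (1/2) ^ Suc i)"
        by (rule suminf_le [OF le smm sums_summable [OF sums]])
      also have "\<dots> = e / 2" using sums_unique [OF sums] by simp
      finally have 1: "?m (\<Union>i. U i - K i) \<le> e / 2" .
      \<comment> \<open>A countable union of compact sets need not be compact, so it is truncated to
        a finite one, at the cost of the other \<open>e / 2\<close>.\<close>
      have "incseq L" unfolding L_def incseq_def by (intro allI impI UN_mono) auto
      then have "(\<lambda>n. ?m (L n)) \<longlonglongrightarrow> ?m (\<Union>n. L n)"
        using Ls by (intro finite_Lim_measure_incseq) auto
      then have "eventually (\<lambda>n. dist (?m (L n)) (?m (\<Union>n. L n)) < e / 2) sequentially"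
        using half_gt_zero [OF e] by (rule tendstoD)
      then obtain n where n: "dist (?m (L n)) (?m (\<Union>n. L n)) < e / 2"
        by (auto simp: eventually_sequentially)
      have Li: "(\<Union>n. L n) \<in> sets N" using Ls by blast
      have "?m ((\<Union>n. L n) - L n) = ?m (\<Union>n. L n) - ?m (L n)"
        by (rule finite_measure_Diff) (use Ls Li in auto)
      then have 2: "?m ((\<Union>n. L n) - L n) < e / 2" using n unfolding dist_real_def by linarith
      have "(\<Union>i. U i) - L n \<subseteq> (\<Union>i. U i - K i) \<union> ((\<Union>n. L n) - L n)"
      proof
        fix z assume z: "z \<in> (\<Union>i. U i) - L n"
        show "z \<in> (\<Union>i. U i - K i) \<union> ((\<Union>n. L n) - L n)"
        proof (cases "\<exists>i. z \<in> K i")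
          case True
          then obtain i where "z \<in> K i" by blast
          then have "z \<in> L (Suc i)" by (auto simp: L_def)
          then show ?thesis using z by blast
        qed (use z in blast)
      qed
      then have "?m ((\<Union>i. U i) - L n) \<le> ?m ((\<Union>i. U i - K i) \<union> ((\<Union>n. L n) - L n))"
        by (rule finite_measure_mono) (use Ks Us Ls in auto)
      also have "\<dots> \<le> ?m (\<Union>i. U i - K i) + ?m ((\<Union>n. L n) - L n)"
        by (rule measure_Un_le) (use Ks Us Ls in auto)
      also have "\<dots> < e" using 1 2 by simp
      finally have 3: "?m ((\<Union>i. U i) - L n) < e" .
      have "compactin X (L n)" unfolding L_def by (rule compactin_Union) (use P(1) in \<open>auto simp: K_def\<close>)
      moreover have "openin X (\<Union>i. U i)" by (rule openin_Union) (use P(2) in \<open>auto simp: U_def\<close>)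
      moreover have "L n \<subseteq> (\<Union>i. a i)" using P(3) by (auto simp: L_def K_def)
      moreover have "(\<Union>i. a i) \<subseteq> (\<Union>i. U i)" using P(4) by (auto simp: U_def)
      ultimately show "\<exists>K U. compactin X K \<and> openin X U \<and> K \<subseteq> \<Union> (range a) \<and> \<Union> (range a) \<subseteq> U \<and> ?m (U - K) < e"
        using 3 by blast
    qed
  qed
  show ?thesis
  proof (rule antisym)
    show "emeasure N A \<le> (SUP K \<in> {K. compactin X K \<and> K \<subseteq> A}. emeasure N K)"
    proof (rule ennreal_le_epsilon)
      fix e :: real assume e: "0 < e"
      obtain K U where KU: "compactin X K" "openin X U" "K \<subseteq> A" "A \<subseteq> U" "?m (U - K) < e"
        using approx [rule_format, OF e] by blast
      have "?m A \<le> ?m (K \<union> (U - K))" by (rule finite_measure_mono) (use KU co op in auto)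
      also have "\<dots> \<le> ?m K + ?m (U - K)" by (rule measure_Un_le) (use KU co op in auto)
      also have "\<dots> \<le> ?m K + e" using KU(5) by simp
      finally have "emeasure N A \<le> emeasure N K + ennreal e"
        using e by (simp add: emeasure_eq_measure flip: ennreal_plus)
      also have "emeasure N K \<le> (SUP K \<in> {K. compactin X K \<and> K \<subseteq> A}. emeasure N K)"
        using KU by (intro SUP_upper) simp
      finally show "emeasure N A \<le> (SUP K \<in> {K. compactin X K \<and> K \<subseteq> A}. emeasure N K) + ennreal e"
        by (simp add: add_mono)
    qed
    show "(SUP K \<in> {K. compactin X K \<and> K \<subseteq> A}. emeasure N K) \<le> emeasure N A"
      by (rule SUP_least) (use A in \<open>auto intro: emeasure_mono\<close>)
  qed
qed

text \<open>Makes all results on \<open>G/H\<close> available for \<open>D/H\<close>. Closedness of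
  \<open>D\<close> gives local compactness; the other properties pass to subspaces.\<close>

lemma (in tdlc_pair) closed_overgroup:
  assumes D: "closed_subgroup G T D" and HD: "H \<subseteq> D"
  shows "tdlc_pair (G\<lparr>carrier := D\<rparr>) (subtopology T D) H"
proof -
  have Ds: "subgroup D G" and Dc: "closedin T D" using D by (auto simp: closed_subgroup_def)
  have DG: "D \<subseteq> carrier G" using Ds by (rule subgroup.subset)
  let ?G = "G\<lparr>carrier := D\<rparr>" and ?T = "subtopology T D"
  have tT: "topspace ?T = D" using DG by auto
  have "topological_group ?G ?T"
    unfolding topological_group_def
  proof (intro conjI)
    show "group ?G" using Ds subgroup_imp_group by blast
    show "topspace ?T = carrier ?G" using tT by simp
    show "Hausdorff_space ?T" using Hausdorff by (rule Hausdorff_space_subtopology)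
    have "continuous_map (prod_topology ?T ?T) T (\<lambda>(x, y). x \<otimes> y)"
      using continuous_map_from_subtopology [OF cont_mult, of "D \<times> D"] by (simp only: subtopology_Times)
    then show "continuous_map (prod_topology ?T ?T) ?T (\<lambda>(x, y). x \<otimes>\<^bsub>?G\<^esub> y)"
      using DG subgroup.m_closed [OF Ds] by (auto simp: continuous_map_in_subtopology)
    have "continuous_map ?T T (\<lambda>x. inv x)" using cont_inv by (rule continuous_map_from_subtopology)
    then have "continuous_map ?T ?T (\<lambda>x. inv x)"
      using DG subgroup.m_inv_closed [OF Ds] by (auto simp: continuous_map_in_subtopology)
    then show "continuous_map ?T ?T (\<lambda>x. inv\<^bsub>?G\<^esub> x)"
      by (rule continuous_map_eq) (use tT m_inv_consistent [OF Ds] in auto)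
  qed
  moreover have "metrizable_space ?T" using metrizable by (rule metrizable_space_subtopology)
  moreover have "totally_disconnected_space ?T"
    unfolding totally_disconnected_space_def
  proof
    fix x assume x: "x \<in> topspace ?T"
    have "connected_component_of_set ?T x \<subseteq> connected_component_of_set T x"
      by (auto simp: connected_component_of_def connectedin_subtopology)
    also have "\<dots> = {x}" using tot_disc x by (simp add: totally_disconnected_space_def)
    finally show "connected_component_of_set ?T x = {x}"
      using x connected_component_of_refl [of ?T x] by blast
  qed
  moreover have "locally_compact_space ?T"
    using loc_compact Dc by (rule locally_compact_space_closed_subset)
  moreover have "subgroup H ?G" using subgroup_incl H_sub Ds HD by blast
  moreover have "closedin ?T H" using H_closed HD by (simp add: closedin_subset_topspace)
  ultimately show ?thesis
    by (simp add: tdlc_pair_def tdlc_pair_axioms_def tdlc_group_def closed_subgroup_def)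
qed

locale tdlc_over = tdlc_inv +
  fixes D :: "'a set"
  assumes closed_subgroup_D: "closed_subgroup G T D" and H_sub_D: "H \<subseteq> D"

sublocale tdlc_over \<subseteq> over: tdlc_pair "G\<lparr>carrier := D\<rparr>" "subtopology T D" H
  by (rule closed_overgroup [OF closed_subgroup_D H_sub_D])

context tdlc_over
begin

section \<open>The coset space of the overgroup and its invariant content\<close>

abbreviation "GD \<equiv> G\<lparr>carrier := D\<rparr>"
abbreviation "XD \<equiv> coset_topology GD (subtopology T D) H"
abbreviation "YD \<equiv> lcosets\<^bsub>GD\<^esub> H"

lemma D_sub: "subgroup D G" and D_carrier: "D \<subseteq> carrier G"
  using closed_subgroup_D by (auto simp: closed_subgroup_def dest: subgroup.subset)

lemma l_coset_GD [simp]: "x <#\<^bsub>GD\<^esub> S = x <# S"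
  by (rule l_coset_consistent)

lemma YD_eq: "YD = (\<lambda>x. x <# H) ` D"
  by (auto simp: LCOSETS_def)

lemma YD_sub: "YD \<subseteq> lcosets H"
  unfolding YD_eq using D_carrier by auto

lemma act_YD: "d \<in> D \<Longrightarrow> y \<in> YD \<Longrightarrow> d <# y \<in> YD"
  using over.act_closed [of y d] by simp

lemma tr_YD: "tr (U \<inter> D) YD \<subseteq> YD"
  by (auto simp: translates_def act_YD)

lemma open_XD_sub: "openin XD C \<Longrightarrow> C \<subseteq> YD"
  using over.openX by blast

text \<open>Elements of \<open>U\<close> outside \<open>D\<close> move \<open>D/H\<close> off
  itself, so invariance of \<open>C\<close> is required for \<open>U \<inter> D\<close>
  only.\<close>

definition adapted :: "'a set \<Rightarrow> 'a set set \<Rightarrow> bool" where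
  "adapted U C \<longleftrightarrow> cosub U \<and> tr (U \<inter> D) C \<subseteq> C"

lemma adapted_iff: "adapted U C \<longleftrightarrow> cosub U \<and> (\<forall>u\<in>U \<inter> D. \<forall>c\<in>C. u <# c \<in> C)"
  unfolding adapted_def translates_def by blast

lemma cosub_inside:
  assumes "over.cosub W"
  obtains U where "cosub U" "U \<inter> D \<subseteq> W"
proof -
  have "openin (subtopology T D) W" "\<one> \<in> W"
    using over.cosubD [OF assms] by auto
  then obtain S where S: "openin T S" "W = S \<inter> D" by (auto simp: openin_subtopology)
  then obtain U where "cosub U" "U \<subseteq> S" using van_Dantzig \<open>\<one> \<in> W\<close> by blast
  then show thesis using that S by blast
qed

lemma adapted_exists:
  assumes "compactin XD C" "openin XD C"
  obtains U where "adapted U C"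
proof -
  obtain W where W: "over.cosub W" "translates GD W C \<subseteq> C" using over.compact_open_invariant [OF assms] .
  obtain U where U: "cosub U" "U \<inter> D \<subseteq> W" using cosub_inside [OF W(1)] .
  have "tr (U \<inter> D) C \<subseteq> tr W C" using U(2) by (auto simp: translates_def)
  then have "adapted U C" using W(2) U(1) by (simp add: adapted_def)
  then show thesis by (rule that)
qed

text \<open>\<open>D/H\<close> may be a null set of \<open>G/H\<close>. Hence \<open>C\<close> is
  thickened to the open set \<open>U C\<close> and measured relative to the equally thickened
  \<open>D/H\<close>; the choice of \<open>U\<close> is immaterial by
  \<open>content_eq\<close>.\<close>

definition content :: "'a set set \<Rightarrow> real" where
  "content C = (let U = (SOME U. adapted U C) in measure M (tr U C) / measure M (tr U YD))"

lemma tr_open: "cosub U \<Longrightarrow> C \<subseteq> YD \<Longrightarrow> openin X (tr U C)"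
  using open_tr [of U C] cosubD(2) YD_sub by blast

lemma tr_sets: "cosub U \<Longrightarrow> C \<subseteq> YD \<Longrightarrow> tr U C \<in> sets M"
  using tr_open open_sets by blast

lemma tr_pos:
  assumes "cosub U" "C \<subseteq> YD" "C \<noteq> {}"
  shows "0 < measure M (tr U C)"
proof (rule open_positive [OF tr_open [OF assms(1,2)]])
  show "tr U C \<noteq> {}" using assms cosubD(4) [OF assms(1)] by (auto simp: translates_def)
qed

lemma H_in_YD: "H \<in> YD"
  using over.H_in .

text \<open>This is \<open>orbit_ratio\<close> with the whole space as both almost invariant sets
  and \<open>D/H\<close> as second set: replacing \<open>U\<close> by \<open>V\<close> changes
  numerator and denominator by the same factor.\<close>

lemma content_eq:
  assumes U: "adapted U C" and C: "C \<subseteq> YD"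
  shows "content C = measure M (tr U C) / measure M (tr U YD)"
proof -
  define V where "V = (SOME U. adapted U C)"
  have V: "adapted V C" unfolding V_def using U by (rule someI)
  have UV: "cosub U" "tr (U \<inter> D) C \<subseteq> C" "cosub V" "tr (V \<inter> D) C \<subseteq> C" using U V by (auto simp: adapted_def)
  have Cp: "C \<subseteq> (\<lambda>x. x <# H) ` D" and Yp: "YD \<subseteq> (\<lambda>x. x <# H) ` D" using C YD_eq by auto
  have "measure M (lcosets H \<inter> tr U C) * measure M (lcosets H \<inter> tr V YD)
      = measure M (lcosets H \<inter> tr V C) * measure M (lcosets H \<inter> tr U YD)"
    by (rule orbit_ratio [OF UV D_sub H_sub_D Cp Yp tr_YD tr_YD almost_inv_space almost_inv_space])
  then have "measure M (tr U C) * measure M (tr V YD) = measure M (tr V C) * measure M (tr U YD)"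
    using sets_sub tr_sets UV C by (simp add: Int_absorb1)
  moreover have "0 < measure M (tr U YD)" "0 < measure M (tr V YD)"
    using tr_pos [OF _ order_refl] UV H_in_YD by auto
  ultimately show ?thesis by (simp add: content_def V_def [symmetric] Let_def field_simps)
qed

lemma adapted_Int: "adapted U C \<Longrightarrow> adapted V C' \<Longrightarrow> adapted (U \<inter> V) C \<and> adapted (U \<inter> V) C'"
  unfolding adapted_iff using cosub_Int by blast

lemma content_nonneg: "0 \<le> content C"
  by (simp add: content_def Let_def)

lemma content_pos:
  assumes "compactin XD C" "openin XD C" "C \<noteq> {}"
  shows "0 < content C"
proof -
  obtain U where U: "adapted U C" using adapted_exists assms by blast
  have C: "C \<subseteq> YD" using open_XD_sub assms by blast
  have cU: "cosub U" using U by (simp add: adapted_def)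
  show ?thesis unfolding content_eq [OF U C]
    using tr_pos [OF cU C assms(3)] tr_pos [OF cU order_refl] H_in_YD by (intro divide_pos_pos) auto
qed

lemma content_le_1:
  assumes "compactin XD C" "openin XD C"
  shows "content C \<le> 1"
proof -
  obtain U where U: "adapted U C" using adapted_exists assms by blast
  have cU: "cosub U" using U by (simp add: adapted_def)
  have C: "C \<subseteq> YD" using open_XD_sub assms by blast
  have "measure M (tr U C) \<le> measure M (tr U YD)"
    by (rule finite_measure_mono) (use C tr_sets [OF cU] in \<open>auto simp: translates_def\<close>)
  then show ?thesis unfolding content_eq [OF U C]
    using tr_pos [OF cU order_refl] H_in_YD by (auto simp: divide_le_eq_1)
qed

text \<open>With one \<open>U\<close> adapted to both sets, the thickenings stay disjoint:
  \<open>u c = u' c'\<close> puts \<open>inv u' \<otimes> u\<close> into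
  \<open>U \<inter> D\<close>, and invariance of \<open>C\<close> then puts \<open>c'\<close> into
  \<open>C\<close>.\<close>

lemma content_Un:
  assumes C: "compactin XD C" "openin XD C" and C': "compactin XD C'" "openin XD C'" and disj: "C \<inter> C' = {}"
  shows "content (C \<union> C') = content C + content C'"
proof -
  obtain U1 U2 where U12: "adapted U1 C" "adapted U2 C'" using adapted_exists C C' by metis
  define U where "U = U1 \<inter> U2"
  have U: "adapted U C" "adapted U C'" using adapted_Int U12 by (auto simp: U_def)
  have UU: "adapted U (C \<union> C')" using U unfolding adapted_iff by blast
  have cU: "cosub U" using U by (simp add: adapted_def)
  have CY: "C \<subseteq> YD" "C' \<subseteq> YD" using open_XD_sub C C' by auto
  have "tr U C \<inter> tr U C' = {}"
  proof (rule ccontr)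
    assume "tr U C \<inter> tr U C' \<noteq> {}"
    then obtain z where z: "z \<in> tr U C" "z \<in> tr U C'" by blast
    obtain u c where uc: "u \<in> U" "c \<in> C" "z = u <# c" using z(1) by (rule translatesE)
    obtain u' c' where uc': "u' \<in> U" "c' \<in> C'" "z = u' <# c'" using z(2) by (rule translatesE)
    have uG: "u \<in> carrier G" "u' \<in> carrier G" using uc uc' cosub_closed(1) [OF cU] by auto
    have cY: "c \<in> lcosets H" "c' \<in> lcosets H" using uc uc' CY YD_sub by auto
    have "c' = inv u' <# (u <# c)" using act_inv(1) [OF cY(2) uG(2)] uc(3) uc'(3) by simp
    then have c': "c' = (inv u' \<otimes> u) <# c" using uG cY by (simp add: act_mult)
    obtain x x' where x: "x \<in> D" "c = x <# H" "x' \<in> D" "c' = x' <# H" 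
      using uc(2) uc'(2) CY unfolding YD_eq by blast
    have xG: "x \<in> carrier G" "x' \<in> carrier G" using x D_carrier by auto
    have "x' <# H = (inv u' \<otimes> u \<otimes> x) <# H" using c' x xG uG by (simp add: act_proj)
    then have "inv x' \<otimes> (inv u' \<otimes> u \<otimes> x) \<in> H"
      using proj_eq_iff [OF xG(2), of "inv u' \<otimes> u \<otimes> x"] xG uG by simp
    then have "inv x' \<otimes> (inv u' \<otimes> u \<otimes> x) \<in> D" using H_sub_D by blast
    then have "x' \<otimes> (inv x' \<otimes> (inv u' \<otimes> u \<otimes> x)) \<otimes> inv x \<in> D"
      using x D_sub by (auto intro!: subgroup.m_closed subgroup.m_inv_closed)
    moreover have "x' \<otimes> (inv x' \<otimes> (inv u' \<otimes> u \<otimes> x)) = inv u' \<otimes> u \<otimes> x" using xG uG by (simp add: m_assoc [symmetric])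
    moreover have "inv u' \<otimes> u \<otimes> x \<otimes> inv x = inv u' \<otimes> u" using xG uG by (simp add: m_assoc)
    ultimately have "inv u' \<otimes> u \<in> D" by simp
    moreover have "inv u' \<otimes> u \<in> U" using uc uc' cosub_closed(2,3) [OF cU] by blast
    ultimately have "c' \<in> C" using U(1) uc(2) c' unfolding adapted_iff by blast
    then show False using disj uc' by blast
  qed
  moreover have "tr U (C \<union> C') = tr U C \<union> tr U C'" by (auto simp: translates_def)
  ultimately have "measure M (tr U (C \<union> C')) = measure M (tr U C) + measure M (tr U C')"
    using finite_measure_Union tr_sets cU CY by simp
  then show ?thesis
    using content_eq [OF U(1) CY(1)] content_eq [OF U(2) CY(2)] content_eq [OF UU] CY by (simp add: add_divide_distrib)
qed

lemma tr_conj: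
  assumes U: "cosub U" and d: "d \<in> carrier G" and C: "C \<subseteq> lcosets H"
  shows "tr {x \<in> carrier G. inv d \<otimes> x \<otimes> d \<in> U} ((\<lambda>y. d <# y) ` C) = (\<lambda>y. d <# y) ` tr U C"
proof (intro equalityI subsetI)
  fix z assume "z \<in> tr {x \<in> carrier G. inv d \<otimes> x \<otimes> d \<in> U} ((\<lambda>y. d <# y) ` C)"
  then obtain x c where x: "x \<in> carrier G" "inv d \<otimes> x \<otimes> d \<in> U" "c \<in> C" "z = x <# (d <# c)"
    by (auto elim!: translatesE)
  have "d \<otimes> (inv d \<otimes> x \<otimes> d) = x \<otimes> d" using x d by (simp add: m_assoc [symmetric])
  then have "z = d <# ((inv d \<otimes> x \<otimes> d) <# c)" using x d C by (auto simp: act_mult subset_iff)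
  then show "z \<in> (\<lambda>y. d <# y) ` tr U C" by (rule image_eqI [OF _ translatesI [OF x(2,3)]])
next
  fix z assume "z \<in> (\<lambda>y. d <# y) ` tr U C"
  then obtain u c where u: "u \<in> U" "c \<in> C" "z = d <# (u <# c)" by (auto elim!: translatesE)
  have uG: "u \<in> carrier G" using cosub_closed(1) [OF U u(1)] .
  have e: "inv d \<otimes> (d \<otimes> u \<otimes> inv d) \<otimes> d = u" using uG d by (simp add: m_assoc) (simp add: m_assoc [symmetric])
  have "z = (d \<otimes> u \<otimes> inv d) <# (d <# c)" using u uG d C by (auto simp: act_mult subset_iff m_assoc)
  then show "z \<in> tr {x \<in> carrier G. inv d \<otimes> x \<otimes> d \<in> U} ((\<lambda>y. d <# y) ` C)"
    using u uG d e by (auto intro!: translatesI)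
qed

text \<open>The conjugate of \<open>U\<close> by \<open>d\<close> is adapted to the translate of
  \<open>C\<close>. As \<open>d\<close> preserves \<open>D/H\<close>, numerator and denominator are
  both measures of sets translated by \<open>d\<close>.\<close>

lemma content_act:
  assumes C: "compactin XD C" "openin XD C" and d: "d \<in> D"
  shows "content ((\<lambda>y. d <# y) ` C) = content C"
proof -
  obtain U where U: "adapted U C" using adapted_exists C by blast
  have cU: "cosub U" using U by (simp add: adapted_def)
  have CY: "C \<subseteq> YD" using open_XD_sub C by blast
  have dG: "d \<in> carrier G" using d D_carrier by blast
  have CH: "C \<subseteq> lcosets H" using CY YD_sub by blast
  let ?V = "{x \<in> carrier G. inv d \<otimes> x \<otimes> d \<in> U}" and ?d = "\<lambda>C. (\<lambda>y. d <# y) ` C"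
  have cV: "cosub ?V" using cosub_conj cU dG by blast
  have dY: "?d YD = YD" using over.act_image [of d] d by simp
  have "tr (?V \<inter> D) (?d C) \<subseteq> ?d C"
  proof
    fix z assume "z \<in> tr (?V \<inter> D) (?d C)"
    then obtain x c where x: "x \<in> carrier G" "x \<in> D" "inv d \<otimes> x \<otimes> d \<in> U" "c \<in> C" "z = x <# (d <# c)"
      by (auto elim!: translatesE)
    have "d \<otimes> (inv d \<otimes> x \<otimes> d) = x \<otimes> d" using x dG by (simp add: m_assoc [symmetric])
    then have "z = d <# ((inv d \<otimes> x \<otimes> d) <# c)" using x dG CH by (auto simp: act_mult subset_iff)
    moreover have "inv d \<otimes> x \<otimes> d \<in> D" using x d D_sub by (auto intro!: subgroup.m_closed subgroup.m_inv_closed)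
    then have "(inv d \<otimes> x \<otimes> d) <# c \<in> C" using U x unfolding adapted_iff by blast
    ultimately show "z \<in> ?d C" by blast
  qed
  then have gV: "adapted ?V (?d C)" using cV by (simp add: adapted_def)
  have "?d C \<subseteq> YD" using CY act_YD d by auto
  then have "content (?d C) = measure M (tr ?V (?d C)) / measure M (tr ?V YD)" using content_eq [OF gV] by simp
  also have "tr ?V (?d C) = ?d (tr U C)" using tr_conj [OF cU dG CH] .
  also have "tr ?V YD = ?d (tr U YD)" using tr_conj [OF cU dG YD_sub] dY by simp
  finally show ?thesis using measure_act [OF dG] tr_sets [OF cU] CY content_eq [OF U CY] by simp
qed

section \<open>Extension of the content to a regular invariant measure\<close>

definition compact_opens :: "'a set set set" where
  "compact_opens = {C. compactin XD C \<and> openin XD C}"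

lemma compact_opens_closed: "C \<in> compact_opens \<Longrightarrow> closedin XD C"
  using over.Hausdorff_X compactin_imp_closedin by (auto simp: compact_opens_def)

text \<open>A ring rather than an algebra, since \<open>D/H\<close> itself need not be
  compact.\<close>

lemma ring_compact_opens: "ring_of_sets YD compact_opens"
  unfolding ring_of_sets_iff
proof (intro conjI ballI)
  show "compact_opens \<subseteq> Pow YD" using open_XD_sub by (auto simp: compact_opens_def)
  show "{} \<in> compact_opens" by (simp add: compact_opens_def)
  fix a b assume ab: "a \<in> compact_opens" "b \<in> compact_opens"
  show "a \<union> b \<in> compact_opens" using ab by (auto simp: compact_opens_def intro: compactin_Un)
  have "openin XD (a - b)" using ab compact_opens_closed openin_diff by (auto simp: compact_opens_def)
  moreover have "compactin XD (a \<inter> (YD - b))"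
  proof (rule compact_Int_closedin)
    show "compactin XD a" using ab by (simp add: compact_opens_def)
    have "closedin XD (topspace XD - b)" using ab(2) unfolding compact_opens_def by blast
    then show "closedin XD (YD - b)" using over.topspace_X by simp
  qed
  moreover have "a \<inter> (YD - b) = a - b" using ab open_XD_sub by (auto simp: compact_opens_def)
  ultimately show "a - b \<in> compact_opens" by (simp add: compact_opens_def)
qed

interpretation ring: ring_of_sets YD compact_opens
  by (rule ring_compact_opens)

lemma compact_opens_D: "C \<in> compact_opens \<Longrightarrow> compactin XD C" "C \<in> compact_opens \<Longrightarrow> openin XD C" "C \<in> compact_opens \<Longrightarrow> C \<subseteq> YD"
  using open_XD_sub by (auto simp: compact_opens_def)

lemma content_empty [simp]: "content {} = 0"
proof -
  have "content ({} \<union> {}) = content {} + content {}" by (rule content_Un) auto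
  then show ?thesis by simp
qed

lemma positive_content: "positive compact_opens (\<lambda>C. ennreal (content C))"
  by (simp add: positive_def)

lemma additive_content: "additive compact_opens (\<lambda>C. ennreal (content C))"
  unfolding additive_def using content_Un compact_opens_D(1,2) content_nonneg by (simp add: ennreal_plus)

text \<open>A compact set that is a disjoint union of open sets meets only finitely many of them, so
  countable additivity reduces to the finite case.\<close>

lemma countably_additive_content: "countably_additive compact_opens (\<lambda>C. ennreal (content C))"
  unfolding countably_additive_def
proof (intro allI impI)
  fix A :: "nat \<Rightarrow> 'a set set"
  assume A: "range A \<subseteq> compact_opens" "disjoint_family A" "(\<Union>i. A i) \<in> compact_opens"
  have "\<forall>U\<in>range A. openin XD U" using A(1) compact_opens_D(2) by blast
  then obtain \<F> where F: "finite \<F>" "\<F> \<subseteq> range A" "(\<Union>i. A i) \<subseteq> \<Union>\<F>"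
    using compact_opens_D(1) [OF A(3)] unfolding compactin_def by (metis order_refl)
  obtain I where I: "finite I" "\<F> = A ` I" using finite_subset_image [OF F(1,2)] by auto
  have UI: "(\<Union>i. A i) = (\<Union>i\<in>I. A i)" using F(3) I(2) by blast
  have out: "A i = {}" if "i \<notin> I" for i
  proof (rule ccontr)
    assume "A i \<noteq> {}"
    then obtain z where z: "z \<in> A i" by blast
    then obtain j where j: "j \<in> I" "z \<in> A j" using UI by blast
    then have "i \<noteq> j" using that by blast
    then have "A i \<inter> A j = {}" using disjoint_family_onD [OF A(2)] by simp
    then show False using z j by blast
  qed
  have "(\<Sum>i. ennreal (content (A i))) = (\<Sum>i\<in>I. ennreal (content (A i)))"
    by (rule suminf_finite [OF I(1)]) (use out in simp)
  also have "\<dots> = ennreal (content (\<Union>i\<in>I. A i))"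
    by (rule ring.additive_sum [OF positive_content additive_content I(1)])
      (use A in \<open>auto simp: disjoint_family_on_def\<close>)
  finally show "(\<Sum>i. ennreal (content (A i))) = ennreal (content (\<Union>i. A i))" using UI by simp
qed

lemma orbit_compact_opens: "over.cosub W \<Longrightarrow> y \<in> YD \<Longrightarrow> tr W {y} \<in> compact_opens"
  using over.open_orbit [of W y] over.compact_orbit [OF over.cosubD(3), of W y] by (simp add: compact_opens_def)

lemma finite_sum_content:
  assumes "finite F" "F \<subseteq> compact_opens" "disjoint F"
  shows "(\<Sum>C\<in>F. content C) \<le> 1"
proof -
  have "(\<Sum>C\<in>F. ennreal (content C)) = ennreal (content (\<Union>C\<in>F. C))"
    by (rule ring.additive_sum [OF positive_content additive_content assms(1)])
      (use assms in \<open>auto simp: disjoint_family_on_def disjoint_def\<close>)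
  also have "(\<Union>C\<in>F. C) \<in> compact_opens" using ring.finite_Union [OF assms(1,2)] by simp
  then have "ennreal (content (\<Union>C\<in>F. C)) \<le> 1" using content_le_1 compact_opens_D(1,2) by simp
  finally show ?thesis using content_nonneg by (simp add: sum_ennreal)
qed

text \<open>Orbits are disjoint sets of positive content, and finite sums of their contents are at
  most 1.\<close>

lemma countable_orbits:
  assumes W: "over.cosub W"
  shows "countable ((\<lambda>y. tr W {y}) ` YD)"
proof -
  let ?O = "(\<lambda>y. tr W {y}) ` YD"
  have OR: "?O \<subseteq> compact_opens" using orbit_compact_opens [OF W] by blast
  have eq: "tr W {z} = tr W {y}" if "y \<in> YD" "z \<in> tr W {y}" for y z
    using over.orbit_sym [OF W that(1), of z] that(2) by simp
  have dis: "disjoint ?O"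
  proof (rule disjointI)
    fix a b assume ab: "a \<in> ?O" "b \<in> ?O" "a \<noteq> b"
    show "a \<inter> b = {}"
    proof (rule ccontr)
      assume "a \<inter> b \<noteq> {}"
      then obtain z where z: "z \<in> a" "z \<in> b" by blast
      obtain y y' where y: "y \<in> YD" "y' \<in> YD" "a = tr W {y}" "b = tr W {y'}" using ab by blast
      have "a = tr W {z}" "b = tr W {z}" using eq [of y z] eq [of y' z] y z by simp_all
      then show False using ab(3) by simp
    qed
  qed
  have "content summable_on ?O"
  proof (rule nonneg_bdd_above_summable_on)
    show "bdd_above (sum content ` {F. F \<subseteq> ?O \<and> finite F})"
    proof (rule bdd_aboveI2)
      fix F assume F: "F \<in> {F. F \<subseteq> ?O \<and> finite F}"
      then have "disjoint F" using dis pairwise_subset by blast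
      moreover have "finite F" "F \<subseteq> compact_opens" using F OR by auto
      ultimately show "sum content F \<le> 1" using finite_sum_content by simp
    qed
  qed (rule content_nonneg)
  then have "countable {C \<in> ?O. content C \<noteq> 0}" by (rule summable_countable_real)
  moreover have "{C \<in> ?O. content C \<noteq> 0} = ?O"
  proof -
    have "content C \<noteq> 0" if C: "C \<in> ?O" for C
    proof -
      obtain y where y: "y \<in> YD" "C = tr W {y}" using C by blast
      have "y \<in> C" using over.orbit_self [OF W y(1)] y(2) by simp
      moreover have "C \<in> compact_opens" using OR C by blast
      ultimately have "0 < content C" using content_pos [OF compact_opens_D(1,2)] by blast
      then show ?thesis by simp
    qed
    then show ?thesis by blast
  qed
  ultimately show ?thesis by simp
qed

text \<open>For each member of a countable neighbourhood base at \<open>\<one>\<close> of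
  \<open>D\<close> there are only countably many orbits.\<close>

lemma countable_base_compact_opens:
  "\<exists>\<B>. countable \<B> \<and> \<B> \<subseteq> compact_opens \<and> (\<forall>U y. openin XD U \<longrightarrow> y \<in> U \<longrightarrow> (\<exists>B\<in>\<B>. y \<in> B \<and> B \<subseteq> U))"
proof -
  obtain V :: "nat \<Rightarrow> 'a set" where V: "\<And>n. over.cosub (V n)"
      "\<And>S. openin (subtopology T D) S \<Longrightarrow> \<one>\<^bsub>GD\<^esub> \<in> S \<Longrightarrow> \<exists>n. V n \<subseteq> S"
    using over.countable_base_at_one by blast
  let ?B = "\<Union>n. (\<lambda>y. tr (V n) {y}) ` YD"
  have 1: "countable ?B" using countable_orbits [OF V(1)] by (intro countable_UN) auto
  have 2: "?B \<subseteq> compact_opens" using orbit_compact_opens [OF V(1)] by blast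
  have 3: "\<exists>B\<in>?B. y \<in> B \<and> B \<subseteq> U" if U: "openin XD U" "y \<in> U" for U y
  proof -
    have y: "y \<in> YD" using open_XD_sub U by blast
    obtain W where W: "over.cosub W" "translates GD W {y} \<subseteq> U" using over.orbit_nbhd [OF U] .
    obtain n where n: "V n \<subseteq> W" using V(2) [OF over.cosubD(2,4) [OF W(1)]] by blast
    have "tr (V n) {y} \<subseteq> tr W {y}" using n by (auto simp: translates_def)
    then have "tr (V n) {y} \<subseteq> U" using W(2) by simp
    moreover have "y \<in> tr (V n) {y}" using over.orbit_self [OF V(1) y] by simp
    ultimately show ?thesis using y by blast
  qed
  show ?thesis by (intro exI [of _ ?B] conjI allI impI 1 2 3)
qed

text \<open>By the countable base, an open set is a countable union of compact open sets; hence
  these generate the Borel sets.\<close>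

lemma open_in_sigma:
  assumes U: "openin XD U"
  shows "U \<in> sigma_sets YD compact_opens"
proof -
  from countable_base_compact_opens obtain \<B> where B: "countable \<B>" "\<B> \<subseteq> compact_opens"
      "\<forall>U y. openin XD U \<longrightarrow> y \<in> U \<longrightarrow> (\<exists>B\<in>\<B>. y \<in> B \<and> B \<subseteq> U)"
    by (elim exE conjE)
  interpret s: sigma_algebra YD "sigma_sets YD compact_opens"
    by (rule sigma_algebra_sigma_sets) (use ring.sets_into_space in blast)
  have "U = \<Union>{B \<in> \<B>. B \<subseteq> U}" using B(3) [rule_format, OF U] by blast
  moreover have "\<Union>{B \<in> \<B>. B \<subseteq> U} \<in> sigma_sets YD compact_opens"
    by (rule s.countable_Union) (use B(1,2) in \<open>auto intro: sigma_sets.Basic\<close>)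
  ultimately show ?thesis by simp
qed

lemma sigma_compact_opens: "sigma_sets YD {U. openin XD U} = sigma_sets YD compact_opens"
proof (rule sigma_sets_eqI)
  fix a assume "a \<in> {U. openin XD U}" then show "a \<in> sigma_sets YD compact_opens" using open_in_sigma by simp
next
  fix a assume "a \<in> compact_opens" then show "a \<in> sigma_sets YD {U. openin XD U}"
    using compact_opens_D(2) by (intro sigma_sets.Basic) simp
qed

lemma exhaustion_compact_opens:
  "\<exists>C :: nat \<Rightarrow> 'a set set. (\<forall>n. C n \<in> compact_opens) \<and> incseq C \<and> (\<Union>n. C n) = YD"
proof -
  from countable_base_compact_opens obtain \<B> where B: "countable \<B>" "\<B> \<subseteq> compact_opens"
      "\<forall>U y. openin XD U \<longrightarrow> y \<in> U \<longrightarrow> (\<exists>B\<in>\<B>. y \<in> B \<and> B \<subseteq> U)"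
    by (elim exE conjE)
  have opY: "openin XD YD" using openin_topspace [of XD] over.topspace_X by simp
  have YB: "YD = \<Union>\<B>"
    using B(3) [rule_format, OF opY] B(2) compact_opens_D(3) by blast
  then have ne: "\<B> \<noteq> {}" using H_in_YD by blast
  define C where "C n = (\<Union>i\<le>n. from_nat_into \<B> i)" for n
  have fB: "from_nat_into \<B> i \<in> compact_opens" for i using from_nat_into [OF ne, of i] B(2) by blast
  have "C n \<in> compact_opens" for n unfolding C_def by (rule ring.finite_UN) (use fB in auto)
  moreover have "incseq C" unfolding incseq_def C_def by (intro allI impI UN_mono) auto
  moreover have "(\<Union>n. C n) = YD"
  proof -
    have "(\<Union>n. C n) = (\<Union>i. from_nat_into \<B> i)" by (auto simp: C_def)
    also have "\<dots> = \<Union>\<B>" using range_from_nat_into [OF ne B(1)] by simp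
    finally show ?thesis using YB by simp
  qed
  ultimately show ?thesis by blast
qed

text \<open>Caratheodory extension of the content, followed by normalization. Regularity comes from
  \<open>compact_open_inner_regular\<close>, invariance from uniqueness of extensions.\<close>

lemma exists_invariant_prob_measure: "\<exists>N. invariant_prob_measure GD (subtopology T D) H N"
proof -
  obtain \<mu> :: "'a set set \<Rightarrow> ennreal" where mu: "\<forall>C\<in>compact_opens. \<mu> C = ennreal (content C)" "measure_space YD (sigma_sets YD compact_opens) \<mu>"
    using ring.caratheodory' [OF positive_content countably_additive_content] by blast
  have RP: "compact_opens \<subseteq> Pow YD" using compact_opens_D(3) by blast
  define N0 where "N0 = measure_of YD compact_opens \<mu>"
  have spN0: "space N0 = YD" and sN0: "sets N0 = sigma_sets YD compact_opens"
    using RP by (simp_all add: N0_def)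
  have eN0: "emeasure N0 C = ennreal (content C)" if "C \<in> compact_opens" for C
  proof -
    have "emeasure N0 C = \<mu> C"
      by (rule emeasure_measure_of [OF N0_def RP])
        (use mu(2) that sN0 in \<open>auto simp: measure_space_def intro: sigma_sets.Basic\<close>)
    then show ?thesis using mu(1) that by simp
  qed
  from exhaustion_compact_opens obtain C :: "nat \<Rightarrow> 'a set set"
    where C: "\<And>n. C n \<in> compact_opens" "incseq C" "(\<Union>n. C n) = YD" by auto
  have RN: "compact_opens \<subseteq> sets N0" unfolding sN0 by (auto intro: sigma_sets.Basic)
  have "(SUP n. emeasure N0 (C n)) = emeasure N0 (\<Union>n. C n)"
    by (rule SUP_emeasure_incseq) (use C RN in auto)
  then have tot: "emeasure N0 YD = (SUP n. emeasure N0 (C n))" using C(3) by simp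
  have "emeasure N0 (C n) \<le> 1" for n using eN0 [OF C(1)] content_le_1 compact_opens_D(1,2) [OF C(1)] by simp
  then have le1: "emeasure N0 YD \<le> 1" unfolding tot by (intro SUP_least)
  obtain n where n: "H \<in> C n" using C(3) H_in_YD by blast
  have "0 < content (C n)" by (rule content_pos) (use compact_opens_D(1,2) [OF C(1)] n in auto)
  then have "0 < emeasure N0 (C n)" using eN0 [OF C(1)] by simp
  also have "emeasure N0 (C n) \<le> emeasure N0 YD"
    unfolding tot by (rule SUP_upper) simp
  finally have pos: "0 < emeasure N0 YD" .
  \<comment> \<open>The exhaustion only shows that the total mass is positive and at most 1, so it
    is rescaled.\<close>
  define r where "r = 1 / emeasure N0 YD"
  have tt: "emeasure N0 YD < \<infinity>" using le1 ennreal_one_less_top by (simp add: le_less_trans)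
  have rr: "r * emeasure N0 YD = 1"
    using pos tt ennreal_divide_self [of "emeasure N0 YD"] by (simp add: r_def ennreal_divide_times)
  define N where "N = scale_measure r N0"
  have spN: "space N = YD" and sN: "sets N = sigma_sets YD compact_opens" using spN0 sN0 by (simp_all add: N_def space_scale_measure)
  have eN: "emeasure N A = r * emeasure N0 A" for A by (simp add: N_def)
  have one: "emeasure N YD = 1" using rr by (simp add: eN)
  have fin: "finite_measure N" by (rule finite_measureI) (simp add: spN one)
  have topX: "topspace XD = YD" using over.topspace_X by simp
  have opN: "U \<in> sets N" if "openin XD U" for U using open_in_sigma that sN by simp
  have reg: "emeasure N A = (SUP K \<in> {K. compactin XD K \<and> K \<subseteq> A}. emeasure N K)" if "A \<in> sets N" for A
  proof (rule compact_open_inner_regular [OF fin _ over.Hausdorff_X _ opN _ _ C(2) _ that])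
    show "space N = topspace XD" using spN topX by simp
    show "sets N = sigma_sets (topspace XD) {C. compactin XD C \<and> openin XD C}"
      using sN topX by (simp add: compact_opens_def)
    show "compactin XD (C n)" "openin XD (C n)" for n using compact_opens_D(1,2) [OF C(1)] by auto
    show "(\<Union>n. C n) = topspace XD" using C(3) topX by simp
  qed
  have inv: "emeasure N ((\<lambda>y. d <# y) ` A) = emeasure N A" if d: "d \<in> D" and A: "A \<in> sets N" for d A
  proof -
    let ?d = "\<lambda>y. d <# y" and ?i = "\<lambda>y. inv d <# y"
    have dG: "d \<in> carrier G" "inv d \<in> carrier G" "inv d \<in> D"
      using d D_carrier subgroup.m_inv_closed [OF D_sub] by auto
    have im: "?i -` A \<inter> YD = ?d ` A" if A: "A \<subseteq> YD" for A
    proof (intro equalityI subsetI)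
      fix y assume y: "y \<in> ?i -` A \<inter> YD"
      then have "y \<in> lcosets H" using YD_sub by blast
      then have "y = ?d (?i y)" using dG(1) by simp
      then show "y \<in> ?d ` A" using y by blast
    next
      fix y assume "y \<in> ?d ` A"
      then obtain z where z: "z \<in> A" "y = ?d z" by blast
      have zY: "z \<in> YD" using z(1) A by blast
      have "z \<in> lcosets H" using zY YD_sub by blast
      then have "?i y = z" using z dG by simp
      moreover have "y \<in> YD" using act_YD [OF d zY] z(2) by simp
      ultimately show "y \<in> ?i -` A \<inter> YD" using z by simp
    qed
    have dRD: "?d ` B \<in> compact_opens" if B: "B \<in> compact_opens" for B
    proof -
      have "openin XD (?d ` B)" using over.open_act [of d B] compact_opens_D(2) [OF B] d by simp
      moreover have "compactin XD (?d ` B)"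
        using image_compactin [OF compact_opens_D(1) [OF B] over.cont_act [of d]] d by simp
      ultimately show ?thesis by (simp add: compact_opens_def)
    qed
    have meas: "?i \<in> measurable N N"
    proof (rule measurable_sigma_sets [OF sN RP])
      show "?i \<in> space N \<rightarrow> YD" using act_YD dG(3) spN by auto
      fix B assume B: "B \<in> compact_opens"
      have "?i -` B \<inter> space N = ?d ` B" using im compact_opens_D(3) [OF B] spN by simp
      then show "?i -` B \<inter> space N \<in> sets N" using dRD [OF B] sN by (auto intro: sigma_sets.Basic)
    qed
    \<comment> \<open>Both measures agree on the compact open sets, an intersection-stable generator
      with an exhaustion of finite measure.\<close>
    have "N = distr N N ?i"
    proof (rule measure_eqI_generator_eq [where E = compact_opens and \<Omega> = YD and A = C])
      show "Int_stable compact_opens" unfolding Int_stable_def using ring.Int by blast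
      show "compact_opens \<subseteq> Pow YD" by (rule RP)
      fix B assume B: "B \<in> compact_opens"
      have "emeasure (distr N N ?i) B = emeasure N (?d ` B)"
        using emeasure_distr [OF meas, of B] B sN im compact_opens_D(3) [OF B] spN by (auto intro: sigma_sets.Basic)
      also have "\<dots> = emeasure N B"
        using eN0 [OF B] eN0 [OF dRD [OF B]] content_act [OF compact_opens_D(1,2) [OF B] d] by (simp add: eN)
      finally show "emeasure N B = emeasure (distr N N ?i) B" by simp
    next
      show "sets N = sigma_sets YD compact_opens" by (rule sN)
      show "sets (distr N N ?i) = sigma_sets YD compact_opens" using sN by simp
      show "range C \<subseteq> compact_opens" using C(1) by blast
      show "(\<Union>n. C n) = YD" by (rule C(3))
      fix n show "emeasure N (C n) \<noteq> \<infinity>" using finite_measure.emeasure_finite [OF fin] by simp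
    qed
    then have "emeasure N A = emeasure (distr N N ?i) A" by simp
    also have "\<dots> = emeasure N (?i -` A \<inter> space N)" using emeasure_distr [OF meas A] .
    also have "?i -` A \<inter> space N = ?d ` A" using im sets.sets_into_space [OF A] spN by simp
    finally show ?thesis by simp
  qed
  have "invariant_prob_measure GD (subtopology T D) H N"
    unfolding invariant_prob_measure_def Borel_prob_measure_def
    using spN sN one reg inv topX sigma_compact_opens by simp
  then show ?thesis by blast
qed

end

section \<open>Distality, stabilizers and ergodicity\<close>

context tdlc_pair
begin

section \<open>Double coset descriptions of \<open>K_set\<close> and of distality\<close>

lemma mem_set_mult_mult: "x \<in> A <#> B <#> C \<longleftrightarrow> (\<exists>a\<in>A. \<exists>b\<in>B. \<exists>c\<in>C. x = a \<otimes> b \<otimes> c)"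
  by (auto simp: set_mult_def)

lemma mem_K_iff: "x \<in> K_set G T H \<longleftrightarrow> (\<forall>U. cosub U \<longrightarrow> x \<in> H <#> U <#> H)"
proof
  assume x: "x \<in> K_set G T H"
  show "\<forall>U. cosub U \<longrightarrow> x \<in> H <#> U <#> H"
  proof (intro allI impI)
    fix U assume "cosub U"
    then have "U \<in> identity_neighbourhoods G T"
      using cosubD(2,4,5) by (auto simp: identity_neighbourhoods_def)
    then show "x \<in> H <#> U <#> H" using x by (simp add: K_set_def)
  qed
next
  assume x: "\<forall>U. cosub U \<longrightarrow> x \<in> H <#> U <#> H"
  have "x \<in> H <#> U <#> H" if "U \<in> identity_neighbourhoods G T" for U
  proof -
    obtain S where S: "openin T S" "\<one> \<in> S" "S \<subseteq> U" using \<open>U \<in> _\<close> by (auto simp: identity_neighbourhoods_def)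
    obtain V where V: "cosub V" "V \<subseteq> S" by (rule van_Dantzig [OF S(1,2)])
    have "x \<in> H <#> V <#> H" using x V by simp
    then show ?thesis using V S(3) unfolding mem_set_mult_mult by blast
  qed
  then show "x \<in> K_set G T H" by (simp add: K_set_def)
qed

lemma K_carrier: "K_set G T H \<subseteq> carrier G"
proof
  fix x assume "x \<in> K_set G T H"
  moreover obtain V where V: "cosub V" by (rule cosub_exists)
  ultimately have "x \<in> H <#> V <#> H" by (simp add: mem_K_iff)
  then show "x \<in> carrier G" using H_carrier cosubD(5) [OF V] by (auto simp: mem_set_mult_mult subset_iff)
qed

text \<open>The orbits \<open>U E\<close> are basic neighbourhoods of the trivial coset, and the
  \<open>H\<close>-orbit of \<open>x E\<close> meets \<open>U E\<close> exactly if \<open>x\<close>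
  is in \<open>H U E\<close>.\<close>

lemma distal_iff:
  assumes E: "closed_subgroup G T E"
  shows "distal_at_1 G T H E \<longleftrightarrow> (\<forall>x\<in>carrier G. (\<forall>U. cosub U \<longrightarrow> x \<in> H <#> U <#> E) \<longrightarrow> x \<in> E)"
proof -
  interpret E: tdlc_pair G T E by unfold_locales (rule E)
  have cl: "E \<in> E.X closure_of ((\<lambda>h. h <# (x <# E)) ` H) \<longleftrightarrow> (\<forall>U. cosub U \<longrightarrow> x \<in> H <#> U <#> E)"
    if x: "x \<in> carrier G" for x
  proof
    assume L: "E \<in> E.X closure_of ((\<lambda>h. h <# (x <# E)) ` H)"
    show "\<forall>U. cosub U \<longrightarrow> x \<in> H <#> U <#> E"
    proof (intro allI impI)
      fix U assume U: "cosub U"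
      have "openin E.X (tr U {E})" "E \<in> tr U {E}"
        using E.open_orbit [OF U E.H_in] E.orbit_self [OF U E.H_in] by auto
      then have "\<exists>z. z \<in> (\<lambda>h. h <# (x <# E)) ` H \<and> z \<in> tr U {E}"
        using L by (simp add: in_closure_of)
      then obtain h u where hu: "h \<in> H" "u \<in> U" "h <# (x <# E) = u <# E"
        unfolding E.orbit_eq by blast
      have hG: "h \<in> carrier G" "u \<in> carrier G" using hu H_carrier cosub_closed(1) [OF U] by auto
      have "(h \<otimes> x) <# E = u <# E" using hu E.act_proj [OF hG(1) x] by simp
      then have "inv u \<otimes> (h \<otimes> x) \<in> E" using E.proj_eq_iff [of u "h \<otimes> x"] hG x by simp
      moreover have "x = inv h \<otimes> u \<otimes> (inv u \<otimes> (h \<otimes> x))"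
      proof -
        have "u \<otimes> (inv u \<otimes> (h \<otimes> x)) = h \<otimes> x" using hG x by (simp add: m_assoc [symmetric])
        then show ?thesis using hG x by (simp add: m_assoc) (simp add: m_assoc [symmetric])
      qed
      ultimately show "x \<in> H <#> U <#> E"
        unfolding mem_set_mult_mult using hu subgroup.m_inv_closed [OF H_sub] by blast
    qed
  next
    assume R: "\<forall>U. cosub U \<longrightarrow> x \<in> H <#> U <#> E"
    show "E \<in> E.X closure_of ((\<lambda>h. h <# (x <# E)) ` H)"
      unfolding in_closure_of
    proof (intro conjI allI impI)
      show "E \<in> topspace E.X" using E.H_in by simp
      fix W assume W: "E \<in> W \<and> openin E.X W"
      then obtain U where U: "cosub U" "tr U {E} \<subseteq> W" using E.orbit_nbhd by blast
      obtain h u e where hue: "h \<in> H" "u \<in> U" "e \<in> E" "x = h \<otimes> u \<otimes> e"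
        using R U(1) unfolding mem_set_mult_mult by blast
      have G: "h \<in> carrier G" "u \<in> carrier G" "e \<in> carrier G"
        using hue H_carrier E.H_carrier cosub_closed(1) [OF U(1)] by auto
      have "inv h <# (x <# E) = (inv h \<otimes> x) <# E" using E.act_proj G(1) x by simp
      also have "inv h \<otimes> x = u \<otimes> e" using G hue(4) by (simp add: m_assoc) (simp add: m_assoc [symmetric])
      also have "(u \<otimes> e) <# E = u <# E" 
        using E.act_proj [OF G(2,3)] E.proj_H_iff [OF G(3)] hue(3) by simp
      also have "u <# E \<in> W" using U(2) hue(2) by (auto simp: E.orbit_eq)
      finally have "inv h <# (x <# E) \<in> W" .
      moreover have "inv h \<in> H" using hue(1) subgroup.m_inv_closed [OF H_sub] by blast
      ultimately show "\<exists>y. y \<in> (\<lambda>h. h <# (x <# E)) ` H \<and> y \<in> W" by blast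
    qed
  qed
  show ?thesis
  proof
    assume d: "distal_at_1 G T H E"
    show "\<forall>x\<in>carrier G. (\<forall>U. cosub U \<longrightarrow> x \<in> H <#> U <#> E) \<longrightarrow> x \<in> E"
    proof (intro ballI impI)
      fix x assume x: "x \<in> carrier G" "\<forall>U. cosub U \<longrightarrow> x \<in> H <#> U <#> E"
      have "x <# E = E" using d cl [OF x(1)] x E.proj_in [OF x(1)] unfolding distal_at_1_def by blast
      then show "x \<in> E" using E.proj_H_iff [OF x(1)] by simp
    qed
  next
    assume r: "\<forall>x\<in>carrier G. (\<forall>U. cosub U \<longrightarrow> x \<in> H <#> U <#> E) \<longrightarrow> x \<in> E"
    show "distal_at_1 G T H E"
      unfolding distal_at_1_def
    proof (intro ballI impI notI)
      fix C assume C: "C \<in> lcosets E" "C \<noteq> E" and L: "E \<in> E.X closure_of ((\<lambda>h. h <# C) ` H)"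
      obtain x where x: "x \<in> carrier G" "C = x <# E" using C(1) by (rule E.cosetE)
      then have "x \<in> E" using r cl [OF x(1)] L by blast
      then show False using C(2) x E.proj_H_iff by simp
    qed
  qed
qed

lemma K_sub_distal:
  assumes E: "closed_subgroup G T E" "H \<subseteq> E" "distal_at_1 G T H E"
  shows "T closure_of K_set G T H \<subseteq> E"
proof (rule closure_of_minimal)
  show "closedin T E" using E(1) by (simp add: closed_subgroup_def)
  show "K_set G T H \<subseteq> E"
  proof
    fix x assume x: "x \<in> K_set G T H"
    have "x \<in> H <#> U <#> E" if "cosub U" for U
    proof -
      have "x \<in> H <#> U <#> H" using x that by (simp add: mem_K_iff)
      then show ?thesis using E(2) unfolding mem_set_mult_mult by blast
    qed
    then show "x \<in> E" using E distal_iff x K_carrier by blast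
  qed
qed

text \<open>By \<open>distal_iff\<close>, distality passes to intersections, because
  \<open>H U D\<close> is contained in \<open>H U E\<close> whenever \<open>D\<close> is contained
  in \<open>E\<close>. Only with this is \<open>LEAST\<close> known to return an actual least
  element.\<close>

lemma Dist_star_least:
  shows "closed_subgroup G T (Dist_star G T H)" "H \<subseteq> Dist_star G T H"
    "distal_at_1 G T H (Dist_star G T H)"
    "closed_subgroup G T E \<Longrightarrow> H \<subseteq> E \<Longrightarrow> distal_at_1 G T H E \<Longrightarrow> Dist_star G T H \<subseteq> E"
proof -
  let ?P = "\<lambda>E. closed_subgroup G T E \<and> H \<subseteq> E \<and> distal_at_1 G T H E"
  define D where "D = \<Inter>{E. ?P E}"
  have cG: "closed_subgroup G T (carrier G)"
    using subgroup_self closedin_topspace [of T] by (simp add: closed_subgroup_def)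
  \<comment> \<open>\<open>G\<close> itself qualifies trivially, so the intersection runs over a
    nonempty family.\<close>
  have PG: "?P (carrier G)" using cG distal_iff [OF cG] H_carrier by blast
  have "subgroup D G"
    unfolding D_def by (rule subgroups_Inter) (use PG in \<open>auto simp: closed_subgroup_def\<close>)
  moreover have "closedin T D"
    unfolding D_def by (rule closedin_Inter) (use PG in \<open>auto simp: closed_subgroup_def\<close>)
  ultimately have cD: "closed_subgroup G T D" by (simp add: closed_subgroup_def)
  have least: "D \<subseteq> E" if "?P E" for E using that by (auto simp: D_def)
  have in_E: "x \<in> E" if x: "x \<in> carrier G" "\<forall>U. cosub U \<longrightarrow> x \<in> H <#> U <#> D" and E: "?P E" for x E
  proof -
    have "\<forall>U. cosub U \<longrightarrow> x \<in> H <#> U <#> E"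
      using x(2) least [OF E] unfolding mem_set_mult_mult by blast
    then show ?thesis using x E distal_iff by blast
  qed
  have "distal_at_1 G T H D"
    unfolding distal_iff [OF cD]
  proof (intro ballI impI)
    fix x assume "x \<in> carrier G" "\<forall>U. cosub U \<longrightarrow> x \<in> H <#> U <#> D"
    then show "x \<in> D" using in_E unfolding D_def by (intro InterI) simp
  qed
  moreover have "H \<subseteq> D" by (auto simp: D_def)
  ultimately have PD: "?P D" using cD by blast
  have Ds: "Dist_star G T H = D"
    unfolding Dist_star_def
  proof (rule Least_equality)
    show "?P D" by (rule PD)
    show "D \<subseteq> E" if "?P E" for E by (rule least [OF that])
  qed
  show "closed_subgroup G T (Dist_star G T H)" "H \<subseteq> Dist_star G T H"
    "distal_at_1 G T H (Dist_star G T H)"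
    "closed_subgroup G T E \<Longrightarrow> H \<subseteq> E \<Longrightarrow> distal_at_1 G T H E \<Longrightarrow> Dist_star G T H \<subseteq> E"
    unfolding Ds using PD least by blast+
qed

end

context tdlc_inv
begin

section \<open>Stabilizers of measurable sets modulo null sets\<close>

definition stabilizer :: "'a set set \<Rightarrow> 'a set" where
  "stabilizer A = {g \<in> carrier G. meas_dist ((\<lambda>y. g <# y) ` A) A = 0}"

lemma meas_dist_zeroI:
  assumes "\<And>e. 0 < e \<Longrightarrow> meas_dist A B \<le> e"
  shows "meas_dist A B = 0"
  using field_le_epsilon [of "meas_dist A B" 0] assms meas_dist_nonneg [of A B] by simp

text \<open>The translates of \<open>A\<close> by \<open>g \<otimes> f\<close> and by
  \<open>g\<close> differ by a null set. This yields the subgroup property and later removes the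
  last factor of \<open>H U F\<close>.\<close>

lemma stabilizer_mult:
  assumes A: "A \<in> sets M" and g: "g \<in> carrier G" and f: "f \<in> stabilizer A"
  shows "meas_dist ((\<lambda>y. (g \<otimes> f) <# y) ` A) A = meas_dist ((\<lambda>y. g <# y) ` A) A"
proof -
  have f: "f \<in> carrier G" "meas_dist ((\<lambda>y. f <# y) ` A) A = 0" using f by (auto simp: stabilizer_def)
  let ?g = "\<lambda>g A. (\<lambda>y. g <# y) ` A"
  have s: "?g f A \<in> sets M" "?g g A \<in> sets M" "?g g (?g f A) \<in> sets M" using A f g act_sets by auto
  have e: "?g (g \<otimes> f) A = ?g g (?g f A)" using act_image_mult [OF g f(1) sets_sub [OF A]] by simp
  have z: "meas_dist (?g g (?g f A)) (?g g A) = 0" using meas_dist_act [OF g s(1) A] f by simp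
  have "meas_dist (?g g (?g f A)) A \<le> meas_dist (?g g A) A" using meas_dist_triangle [OF s(3,2) A] z by simp
  moreover have "meas_dist (?g g A) A \<le> meas_dist (?g g (?g f A)) A"
    using meas_dist_triangle [OF s(2,3) A] z meas_dist_sym [of "?g g A"] by simp
  ultimately show ?thesis using e by simp
qed

lemma stabilizer_subgroup:
  assumes A: "A \<in> sets M"
  shows "subgroup (stabilizer A) G"
proof (rule subgroupI)
  show "stabilizer A \<subseteq> carrier G" by (auto simp: stabilizer_def)
  have "(\<lambda>y. \<one> <# y) ` A = A" using sets_sub [OF A] by (auto simp: subset_iff image_iff)
  then have one: "\<one> \<in> stabilizer A" by (simp add: stabilizer_def)
  then show "stabilizer A \<noteq> {}" by blast
  fix a assume a: "a \<in> stabilizer A"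
  then have aG: "a \<in> carrier G" by (simp add: stabilizer_def)
  show "inv a \<in> stabilizer A"
    using stabilizer_mult [OF A inv_closed [OF aG] a] aG one by (simp add: stabilizer_def)
next
  fix a b assume "a \<in> stabilizer A" "b \<in> stabilizer A"
  then show "a \<otimes> b \<in> stabilizer A"
    using stabilizer_mult [OF A, of a b] by (simp add: stabilizer_def)
qed

text \<open>For \<open>g\<close> in the closure pick a small \<open>v\<close> with
  \<open>g \<otimes> v\<close> in the stabilizer. Then \<open>g A\<close> is the translate by
  \<open>g \<otimes> v\<close> of \<open>inv v\<close> applied to \<open>A\<close>, which is close
  to \<open>A\<close>.\<close>

lemma stabilizer_closed:
  assumes A: "A \<in> sets M"
  shows "closed_subgroup G T (stabilizer A)"
proof -
  have "T closure_of stabilizer A \<subseteq> stabilizer A"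
  proof
    fix g assume g: "g \<in> T closure_of stabilizer A"
    then have gG: "g \<in> carrier G" using closure_of_subset_topspace by fastforce
    have "meas_dist ((\<lambda>y. g <# y) ` A) A \<le> e" if e: "0 < e" for e
    proof -
      obtain V where V: "cosub V" "\<And>v. v \<in> V \<Longrightarrow> meas_dist ((\<lambda>y. v <# y) ` A) A < e"
        using meas_dist_continuous [OF A e] by blast
      have "openin T ((\<lambda>x. g \<otimes> x) ` V)" "g \<in> (\<lambda>x. g \<otimes> x) ` V"
        using open_lmult [OF cosubD(2) [OF V(1)] gG] cosubD(4) [OF V(1)] gG by (auto intro!: image_eqI [of _ _ \<one>])
      then obtain v where v: "v \<in> V" "g \<otimes> v \<in> stabilizer A" using g unfolding in_closure_of by blast
      have vG: "v \<in> carrier G" "inv v \<in> V" "inv v \<in> carrier G" using cosub_closed [OF V(1) v(1)] by auto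
      let ?g = "\<lambda>g A. (\<lambda>y. g <# y) ` A"
      have gv: "g \<otimes> v \<in> carrier G" "meas_dist (?g (g \<otimes> v) A) A = 0" using v by (auto simp: stabilizer_def)
      have s: "?g (inv v) A \<in> sets M" "?g (g \<otimes> v) A \<in> sets M" "?g g A \<in> sets M" using A gG vG gv act_sets by auto
      have "?g g A = ?g (g \<otimes> v) (?g (inv v) A)"
        using act_image_mult [OF gv(1) vG(3) sets_sub [OF A]] gG vG by (simp add: m_assoc)
      then have "meas_dist (?g g A) (?g (g \<otimes> v) A) = meas_dist (?g (inv v) A) A"
        using meas_dist_act [OF gv(1) s(1) A] by simp
      then have "meas_dist (?g g A) A \<le> meas_dist (?g (inv v) A) A"
        using meas_dist_triangle [OF s(3,2) A] gv by simp
      then show ?thesis using V(2) [OF vG(2)] by simp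
    qed
    then show "g \<in> stabilizer A" using meas_dist_zeroI gG by (simp add: stabilizer_def)
  qed
  moreover have "stabilizer A \<subseteq> topspace T" by (auto simp: stabilizer_def)
  ultimately have "closedin T (stabilizer A)" using closure_of_subset_eq by blast
  then show ?thesis using stabilizer_subgroup [OF A] by (simp add: closed_subgroup_def)
qed

text \<open>In \<open>x = h \<otimes> u \<otimes> f\<close> the factor \<open>f\<close> drops out by
  \<open>stabilizer_mult\<close> and \<open>h\<close> because it fixes \<open>A\<close> and acts
  isometrically; only the small \<open>u\<close> remains.\<close>

lemma stabilizer_distal:
  assumes A: "A \<in> sets M" and H: "\<And>h. h \<in> H \<Longrightarrow> (\<lambda>y. h <# y) ` A = A"
    and x: "\<And>U. cosub U \<Longrightarrow> x \<in> H <#> U <#> stabilizer A"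
  shows "x \<in> stabilizer A"
proof -
  let ?g = "\<lambda>g A. (\<lambda>y. g <# y) ` A"
  have "x \<in> carrier G"
  proof -
    obtain V where V: "cosub V" by (rule cosub_exists)
    show ?thesis using x [OF V] H_carrier cosubD(5) [OF V]
      by (auto simp: mem_set_mult_mult subset_iff stabilizer_def)
  qed
  moreover have "meas_dist (?g x A) A \<le> e" if e: "0 < e" for e
  proof -
    obtain V where V: "cosub V" "\<And>v. v \<in> V \<Longrightarrow> meas_dist ((\<lambda>y. v <# y) ` A) A < e"
      using meas_dist_continuous [OF A e] by blast
    obtain h u f where huf: "h \<in> H" "u \<in> V" "f \<in> stabilizer A" "x = h \<otimes> u \<otimes> f"
      using x [OF V(1)] unfolding mem_set_mult_mult by blast
    have G: "h \<in> carrier G" "u \<in> carrier G" using huf H_carrier cosub_closed(1) [OF V(1)] by auto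
    have "meas_dist (?g x A) A = meas_dist (?g (h \<otimes> u) A) A"
      unfolding huf(4) by (rule stabilizer_mult [OF A _ huf(3)]) (use G in simp)
    also have "\<dots> = meas_dist (?g h (?g u A)) (?g h A)"
      using act_image_mult [OF G sets_sub [OF A]] H [OF huf(1)] by simp
    also have "\<dots> = meas_dist (?g u A) A" by (rule meas_dist_act [OF G(1) act_sets [OF G(2) A] A])
    also have "\<dots> < e" by (rule V(2) [OF huf(2)])
    finally show ?thesis by simp
  qed
  ultimately show ?thesis using meas_dist_zeroI by (simp add: stabilizer_def)
qed

text \<open>A conull set meets every nonempty open set, as such sets have positive measure. Applied
  in \<open>G/H\<close>, this finds elements of \<open>K_set\<close> in every nonempty open subset
  of \<open>G\<close>.\<close>

lemma ergodic_imp_dense_K: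
  assumes erg: "\<And>A. A \<in> sets M \<Longrightarrow> (\<forall>h\<in>H. (\<lambda>y. h <# y) ` A = A) \<Longrightarrow> emeasure M A = 0 \<or> emeasure M A = 1"
  shows "carrier G \<subseteq> T closure_of K_set G T H"
proof
  fix d assume d: "d \<in> carrier G"
  obtain V :: "nat \<Rightarrow> 'a set" where V: "\<And>n. cosub (V n)"
      "\<And>S. openin T S \<Longrightarrow> \<one> \<in> S \<Longrightarrow> \<exists>n. V n \<subseteq> S"
    using countable_base_at_one by blast
  \<comment> \<open>The image of \<open>H (V n) H\<close> in \<open>G/H\<close>: open,
    \<open>H\<close>-invariant and containing the base point.\<close>
  define B where "B n = tr H (tr (V n) {H})" for n
  have Bop: "openin X (B n)" for n
    unfolding B_def translates_def [of G H]
    by (rule openin_Union) (use open_act open_orbit [OF V(1) H_in] H_carrier in auto)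
  have HB: "H \<in> B n" for n
  proof -
    have "\<one> <# H \<in> B n"
      unfolding B_def using orbit_self [OF V(1) H_in] subgroup.one_closed [OF H_sub] by (rule translatesI [rotated])
    then show ?thesis using H_in by simp
  qed
  have BY: "B n \<subseteq> lcosets H" for n using Bop openX by blast
  have Binv: "(\<lambda>y. h <# y) ` B n = B n" if h: "h \<in> H" for h n
  proof -
    have 1: "(\<lambda>y. k <# y) ` B n \<subseteq> B n" if k: "k \<in> H" for k
    proof
      fix z assume "z \<in> (\<lambda>y. k <# y) ` B n"
      then obtain h' y where z: "h' \<in> H" "y \<in> tr (V n) {H}" "z = k <# (h' <# y)"
        unfolding B_def translates_def [of G H] by blast
      have "y \<in> lcosets H" using z(2) orbit_sub [OF V(1) H_in] by blast
      then have "z = (k \<otimes> h') <# y" using act_mult z k H_carrier by auto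
      then show "z \<in> B n" using z k subgroup.m_closed [OF H_sub] by (auto simp: B_def intro!: translatesI)
    qed
    have hG: "h \<in> carrier G" using h H_carrier by blast
    have "B n \<subseteq> (\<lambda>y. h <# y) ` B n"
    proof
      fix y assume y: "y \<in> B n"
      have "inv h <# y \<in> B n" using 1 [of "inv h"] y h subgroup.m_inv_closed [OF H_sub] by blast
      moreover have "y = h <# (inv h <# y)" using act_inv(2) [OF subsetD [OF BY y] hG] by simp
      ultimately show "y \<in> (\<lambda>y. h <# y) ` B n" by blast
    qed
    then show ?thesis using 1 [OF h] by blast
  qed
  have Bs: "B n \<in> sets M" for n using Bop open_sets by blast
  have B1: "emeasure M (B n) = 1" for n
  proof -
    have "0 < measure M (B n)" using open_positive [OF Bop] HB by blast
    then have "emeasure M (B n) \<noteq> 0" by (auto simp: measure_def)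
    then show ?thesis using erg [OF Bs] Binv by blast
  qed
  have null: "lcosets H - B n \<in> null_sets M" for n
  proof -
    have "emeasure M (space M - B n) = emeasure M (space M) - emeasure M (B n)"
      by (rule emeasure_compl [OF Bs]) simp
    then have "emeasure M (lcosets H - B n) = 0" using B1 emeasure_X by simp
    then show ?thesis using Bs [of n] sets.compl_sets [OF Bs [of n]] by (simp add: null_sets_def)
  qed
  have nU: "(\<Union>n. lcosets H - B n) \<in> null_sets M" using null by blast
  show "d \<in> T closure_of K_set G T H"
    unfolding in_closure_of
  proof (intro conjI allI impI)
    show "d \<in> topspace T" using d by simp
    fix S assume S: "d \<in> S \<and> openin T S"
    let ?W = "(\<lambda>x. x <# H) ` S"
    have SG: "S \<subseteq> carrier G" using S open_sub by blast
    have "openin X (tr S {H})" by (rule open_tr) (use S H_in in auto)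
    then have W: "openin X ?W" by (simp add: orbit_eq)
    have "0 < measure M ?W" using open_positive [OF W] S by blast
    then have "?W \<notin> null_sets M" by (auto simp: null_sets_def measure_def)
    \<comment> \<open>Some coset in the image of \<open>S\<close> therefore lies in all the sets
      \<open>B n\<close> at once.\<close>
    then have "\<not> ?W \<subseteq> (\<Union>n. lcosets H - B n)" using null_sets_subset [OF nU open_sets [OF W]] by blast
    then obtain s where s: "s \<in> S" "\<And>n. s <# H \<in> B n" using SG by (auto simp: subset_iff)
    have sG: "s \<in> carrier G" using s SG by blast
    have "s \<in> H <#> U <#> H" if U: "cosub U" for U
    proof -
      obtain n where n: "V n \<subseteq> U" using V(2) cosubD(2,4) [OF U] by blast
      obtain h v where hv: "h \<in> H" "v \<in> V n" "s <# H = h <# (v <# H)"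
        using s(2) [of n] by (auto simp: B_def orbit_eq elim!: translatesE)
      have G: "h \<in> carrier G" "v \<in> carrier G" using hv H_carrier cosub_closed(1) [OF V(1)] by auto
      have "(h \<otimes> v) <# H = s <# H" using hv act_proj [OF G] by simp
      then have "inv (h \<otimes> v) \<otimes> s \<in> H" using proj_eq_iff [of "h \<otimes> v" s] G sG by simp
      moreover have "s = h \<otimes> v \<otimes> (inv (h \<otimes> v) \<otimes> s)" using G sG by (simp add: m_assoc [symmetric] del: inv_mult_group)
      ultimately show ?thesis unfolding mem_set_mult_mult using hv n by blast
    qed
    then have "s \<in> K_set G T H" by (simp add: mem_K_iff)
    then show "\<exists>y. y \<in> K_set G T H \<and> y \<in> S" using s by blast
  qed
qed

end

section \<open>Contraction groups\<close>

context tdlc_inv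
begin

text \<open>The points that visit \<open>B\<close> at arbitrarily late times form a decreasing
  intersection of sets \<open>L N\<close>. Each contains a translate of \<open>B\<close>, so in a
  finite measure the intersection has at least the measure of \<open>B\<close>.\<close>

lemma infinite_return:
  assumes g: "g \<in> carrier G" and B: "openin X B" "B \<noteq> {}"
  shows "\<exists>y\<in>lcosets H. \<forall>N :: nat. \<exists>n\<ge>N. (g [^] n) <# y \<in> B"
proof -
  define E where "E n = (\<lambda>y. inv (g [^] n) <# y) ` B" for n :: nat
  have BY: "B \<subseteq> lcosets H" using B openX by blast
  have Bs: "B \<in> sets M" using B open_sets by blast
  have iG: "inv (g [^] n) \<in> carrier G" for n :: nat using g by simp
  have Es: "E n \<in> sets M" and Em: "measure M (E n) = measure M B" for n
    unfolding E_def by (rule act_sets [OF iG Bs], rule measure_act [OF iG Bs])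
  define L where "L N = (\<Union>n\<in>{N..}. E n)" for N
  have Ls: "L N \<in> sets M" for N unfolding L_def using Es by blast
  have "decseq L" unfolding decseq_def L_def by (intro allI impI UN_mono) auto
  then have lim: "(\<lambda>N. measure M (L N)) \<longlonglongrightarrow> measure M (\<Inter>N. L N)"
    using Ls by (intro finite_Lim_measure_decseq) auto
  have "measure M B \<le> measure M (L N)" for N
  proof -
    have "E N \<subseteq> L N" by (auto simp: L_def)
    then show ?thesis using finite_measure_mono [OF _ Ls] Em by metis
  qed
  then have "measure M B \<le> measure M (\<Inter>N. L N)"
    by (intro LIMSEQ_le_const [OF lim]) auto
  then have "measure M (\<Inter>N. L N) \<noteq> 0" using open_positive [OF B] by simp
  then have "(\<Inter>N. L N) \<noteq> {}" using measure_empty by metis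
  then obtain y where y: "\<And>N. y \<in> L N" by blast
  have ret: "\<exists>n\<ge>N. (g [^] n) <# y \<in> B" for N :: nat
  proof -
    obtain n where n: "N \<le> n" "y \<in> E n" using y [of N] by (auto simp: L_def)
    obtain b where b: "b \<in> B" "y = inv (g [^] n) <# b" using n(2) by (auto simp: E_def)
    have "(g [^] n) <# y = b"
      unfolding b(2) by (rule act_inv(2)) (use b BY g in auto)
    then show ?thesis using n(1) b(1) by blast
  qed
  obtain n :: nat and b where "b \<in> B" "y = inv (g [^] n) <# b" using y [of 0] by (auto simp: L_def E_def)
  then have "y \<in> lcosets H" using BY iG by (auto simp: subset_iff)
  then show ?thesis using ret by blast
qed

text \<open>The element \<open>a\<close> is fixed before \<open>W\<close> is chosen, so that a
  single conjugate of \<open>x\<close> lies in \<open>H W H\<close> for all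
  \<open>W\<close>.\<close>

lemma contraction_conj_in_K:
  assumes g: "g \<in> carrier G" and x: "x \<in> contraction_group G T g" and V: "cosub V"
  obtains a where "a \<in> V" "inv a \<otimes> x \<otimes> a \<in> K_set G T H"
proof -
  have xG: "x \<in> carrier G" and lim: "limitin T (\<lambda>n::nat. g [^] n \<otimes> x \<otimes> inv (g [^] n)) \<one> sequentially"
    using x by (auto simp: contraction_group_def)
  have "tr V {H} \<noteq> {}" using orbit_self [OF V H_in] by blast
  from infinite_return [OF g open_orbit [OF V H_in] this]
  obtain z where z: "z \<in> lcosets H" "\<And>N :: nat. \<exists>n\<ge>N. (g [^] n) <# z \<in> tr V {H}"
    by blast
  \<comment> \<open>The recurrent point need not start in \<open>V H\<close>; its position at one
    visit becomes the new starting point \<open>a H\<close>.\<close>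
  obtain m where "(g [^] (m::nat)) <# z \<in> tr V {H}" using z(2) [of 0] by blast
  then obtain a where a: "a \<in> V" "(g [^] m) <# z = a <# H" by (auto simp: orbit_eq)
  have aG: "a \<in> carrier G" using a cosub_closed(1) [OF V] by blast
  have ret: "\<exists>n\<ge>N. (g [^] n \<otimes> a) <# H \<in> tr V {H}" for N :: nat
  proof -
    \<comment> \<open>Time is now counted from \<open>m\<close>, so a visit after
      \<open>N + m\<close> is a return after at least \<open>N\<close> steps.\<close>
    obtain n where n: "n \<ge> N + m" "(g [^] n) <# z \<in> tr V {H}" using z(2) by blast
    have "(g [^] (n - m) \<otimes> a) <# H = (g [^] (n - m)) <# ((g [^] m) <# z)"
      unfolding a(2) using g aG by (simp add: act_proj)
    also have "\<dots> = (g [^] (n - m) \<otimes> g [^] m) <# z" using g z(1) by (intro act_mult) auto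
    also have "g [^] (n - m) \<otimes> g [^] m = g [^] n" using g n(1) by (simp add: nat_pow_mult)
    finally show ?thesis using n by (intro exI [of _ "n - m"]) simp
  qed
  have "inv a \<otimes> x \<otimes> a \<in> H <#> W <#> H" if W: "cosub W" for W
  proof -
    \<comment> \<open>The element \<open>b\<close> below varies with \<open>n\<close>. Covering
      \<open>V\<close> by finitely many \<open>f W\<close> makes convergence under finitely many
      conjugations sufficient.\<close>
    obtain F where F: "finite F" "F \<subseteq> V" "V \<subseteq> F <#> W"
      by (rule compact_finite_cover [OF cosubD(3) [OF V] W])
    have FG: "f \<in> carrier G" if "f \<in> F" for f using that F(2) cosubD(5) [OF V] by blast
    have "eventually (\<lambda>n. \<forall>f\<in>F. inv f \<otimes> (g [^] n \<otimes> x \<otimes> inv (g [^] n)) \<otimes> f \<in> W) sequentially"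
    proof (rule eventually_ball_finite [OF F(1)], rule ballI)
      fix f assume f: "f \<in> F"
      let ?W = "{z \<in> carrier G. inv f \<otimes> z \<otimes> f \<in> W}"
      have "cosub ?W" by (rule cosub_conj [OF W FG [OF f]])
      then have "eventually (\<lambda>n. g [^] n \<otimes> x \<otimes> inv (g [^] n) \<in> ?W) sequentially"
        using lim cosubD(2,4) unfolding limitin_def by blast
      then show "eventually (\<lambda>n. inv f \<otimes> (g [^] n \<otimes> x \<otimes> inv (g [^] n)) \<otimes> f \<in> W) sequentially"
        by (rule eventually_mono) simp
    qed
    then obtain N :: nat where N: "\<forall>n\<ge>N. \<forall>f\<in>F. inv f \<otimes> (g [^] n \<otimes> x \<otimes> inv (g [^] n)) \<otimes> f \<in> W"
      unfolding eventually_sequentially by blast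
    obtain n where n: "n \<ge> N" "(g [^] n \<otimes> a) <# H \<in> tr V {H}" using ret [of N] by blast
    then obtain b where b: "b \<in> V" "(g [^] n \<otimes> a) <# H = b <# H" by (auto simp: orbit_eq)
    obtain f w where fw: "f \<in> F" "w \<in> W" "b = f \<otimes> w" using F(3) b(1) by (auto simp: set_mult_def)
    have G: "g [^] n \<in> carrier G" "b \<in> carrier G" "f \<in> carrier G" "w \<in> carrier G"
      using g b fw FG cosub_closed(1) [OF V] cosub_closed(1) [OF W] by auto
    define p where "p = g [^] n"
    have pG: "p \<in> carrier G" using G by (simp add: p_def)
    \<comment> \<open>The \<open>H\<close>-component in the decomposition of
      \<open>p \<otimes> a\<close> as \<open>b \<otimes> h\<close>.\<close>
    define h where "h = inv b \<otimes> (p \<otimes> a)"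
    have hG: "h \<in> carrier G" using G pG aG by (simp add: h_def)
    have hH: "h \<in> H" using proj_eq_iff [of b "p \<otimes> a"] b(2) pG G aG by (simp add: h_def p_def)
    have "b \<otimes> h = p \<otimes> a" using G pG aG by (simp add: h_def m_assoc [symmetric])
    then have "inv p \<otimes> (b \<otimes> h) = a" using pG aG by (simp add: m_assoc [symmetric])
    then have ae: "a = inv p \<otimes> (b \<otimes> h)" by simp
    define q where "q = inv f \<otimes> (p \<otimes> x \<otimes> inv p) \<otimes> f"
    have q: "q \<in> W" using N n(1) fw(1) by (simp add: q_def p_def)
    \<comment> \<open>Conjugation by \<open>f\<close> lands in \<open>W\<close> by the choice of
      \<open>N\<close>, and the further conjugation by \<open>w\<close> stays in the group
      \<open>W\<close>.\<close>
    have "inv a \<otimes> x \<otimes> a = inv h \<otimes> (inv w \<otimes> q \<otimes> w) \<otimes> h"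
      unfolding ae q_def fw(3) using G hG pG xG by (simp add: inv_mult_group m_assoc)
    moreover have "inv w \<otimes> q \<otimes> w \<in> W" using cosub_closed(2,3) [OF W] q fw(2) by blast
    moreover have "inv h \<in> H" using hH subgroup.m_inv_closed [OF H_sub] by blast
    ultimately show ?thesis unfolding mem_set_mult_mult using hH by blast
  qed
  then have "inv a \<otimes> x \<otimes> a \<in> K_set G T H" by (simp add: mem_K_iff)
  then show thesis using that a(1) by blast
qed

text \<open>Conjugation is continuous, so for small \<open>V\<close> the conjugate of
  \<open>x\<close> found in \<open>K_set\<close> is close to \<open>x\<close>.\<close>

lemma contraction_sub_closure_K:
  assumes g: "g \<in> carrier G"
  shows "contraction_group G T g \<subseteq> T closure_of K_set G T H"
proof
  fix x assume x: "x \<in> contraction_group G T g"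
  then have xG: "x \<in> carrier G" by (simp add: contraction_group_def)
  show "x \<in> T closure_of K_set G T H"
    unfolding in_closure_of
  proof (intro conjI allI impI)
    show "x \<in> topspace T" using xG by simp
    fix S assume S: "x \<in> S \<and> openin T S"
    have "continuous_map T T (\<lambda>a. inv a \<otimes> x \<otimes> a)"
      using xG cont_inv by (intro continuous_map_mult) auto
    then have "openin T {a \<in> carrier G. inv a \<otimes> x \<otimes> a \<in> S}" using S open_preimage by blast
    moreover have "\<one> \<in> {a \<in> carrier G. inv a \<otimes> x \<otimes> a \<in> S}" using S xG by simp
    ultimately obtain V where V: "cosub V" "V \<subseteq> {a \<in> carrier G. inv a \<otimes> x \<otimes> a \<in> S}"
      by (rule van_Dantzig)
    obtain a where "a \<in> V" "inv a \<otimes> x \<otimes> a \<in> K_set G T H"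
      by (rule contraction_conj_in_K [OF g x V(1)])
    then show "\<exists>y. y \<in> K_set G T H \<and> y \<in> S" using V(2) by blast
  qed
qed

section \<open>Ergodic overgroups and the least distal overgroup\<close>

lemma ergodic_overgroup_sub:
  assumes "ergodic_closed_overgroup G T H D"
  shows "D \<subseteq> T closure_of K_set G T H"
proof -
  let ?G = "G\<lparr>carrier := D\<rparr>" and ?T = "subtopology T D"
  have D: "closed_subgroup G T D" "H \<subseteq> D"
    using assms by (auto simp: ergodic_closed_overgroup_def)
  obtain N where N: "invariant_prob_measure ?G ?T H N"
    and erg: "\<forall>A\<in>sets N. (\<forall>h\<in>H. (\<lambda>C. h <# C) ` A = A) \<longrightarrow> emeasure N A = 0 \<or> emeasure N A = 1"
    using assms by (auto simp: ergodic_closed_overgroup_def acts_ergodically_def l_coset_consistent)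
  interpret N: tdlc_pair ?G ?T H by (rule closed_overgroup [OF D])
  interpret N: tdlc_inv ?G ?T H N by unfold_locales (rule N)
  \<comment> \<open>Density is obtained inside \<open>D\<close>, for the set \<open>K_set\<close>
    formed in \<open>D\<close>.\<close>
  have "carrier ?G \<subseteq> ?T closure_of K_set ?G ?T H"
    by (rule N.ergodic_imp_dense_K) (use erg in \<open>simp add: l_coset_consistent\<close>)
  then have "D \<subseteq> ?T closure_of K_set ?G ?T H" by simp
  also have "\<dots> \<subseteq> T closure_of K_set ?G ?T H" by (rule closure_of_subtopology_subset)
  also have "\<dots> \<subseteq> T closure_of K_set G T H"
  proof (rule closure_of_mono)
    \<comment> \<open>Neighbourhoods in \<open>G\<close> restrict to neighbourhoods in
      \<open>D\<close>, so \<open>K_set\<close> formed in \<open>D\<close> is contained in the one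
      formed in \<open>G\<close>.\<close>
    have "x \<in> H <#> U <#> H" if x: "x \<in> K_set ?G ?T H" and U: "U \<in> identity_neighbourhoods G T" for x U
    proof -
      obtain S where S: "openin T S" "\<one> \<in> S" "S \<subseteq> U" using U by (auto simp: identity_neighbourhoods_def)
      have "openin ?T (S \<inter> D)" using S(1) by (auto simp: openin_subtopology)
      moreover have "\<one> \<in> S \<inter> D" using S(2) N.one_closed by simp
      ultimately have "S \<inter> D \<in> identity_neighbourhoods ?G ?T" by (auto simp: identity_neighbourhoods_def)
      then have "x \<in> H <#>\<^bsub>?G\<^esub> (S \<inter> D) <#>\<^bsub>?G\<^esub> H" using x by (simp add: K_set_def)
      then have "x \<in> H <#> (S \<inter> D) <#> H" by (simp add: set_mult_def)
      then show ?thesis using S(3) unfolding mem_set_mult_mult by blast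
    qed
    then show "K_set ?G ?T H \<subseteq> K_set G T H" by (auto simp: K_set_def [of G])
  qed
  finally show ?thesis .
qed

text \<open>The stabilizer of an invariant set is formed in \<open>D\<close>, whereas minimality
  concerns subgroups that are distal in \<open>G\<close>. The proof transfers closedness and
  distality from \<open>D\<close> to \<open>G\<close>.\<close>

lemma minimal_distal_ergodic:
  assumes D: "closed_subgroup G T D" "H \<subseteq> D" "distal_at_1 G T H D"
    and least: "\<And>E. closed_subgroup G T E \<Longrightarrow> H \<subseteq> E \<Longrightarrow> distal_at_1 G T H E \<Longrightarrow> D \<subseteq> E"
  shows "ergodic_closed_overgroup G T H D"
proof -
  interpret O: tdlc_over G T H M D by unfold_locales (rule D)+
  let ?G = "G\<lparr>carrier := D\<rparr>" and ?T = "subtopology T D"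
  obtain N where N: "invariant_prob_measure ?G ?T H N" using O.exists_invariant_prob_measure by blast
  interpret N: tdlc_inv ?G ?T H N by unfold_locales (rule N)
  have "emeasure N A = 0 \<or> emeasure N A = 1"
    if A: "A \<in> sets N" and inv: "\<forall>h\<in>H. (\<lambda>C. h <# C) ` A = A" for A
  proof -
    let ?F = "N.stabilizer A"
    have F: "closed_subgroup ?G ?T ?F" by (rule N.stabilizer_closed [OF A])
    have FD: "?F \<subseteq> D" by (auto simp: N.stabilizer_def)
    have F_closed: "closed_subgroup G T ?F"
      using F D(1) incl_subgroup [of D ?F] closedin_trans_full by (auto simp: closed_subgroup_def)
    have HF: "H \<subseteq> ?F" using D(2) inv by (auto simp: N.stabilizer_def l_coset_consistent)
    have "distal_at_1 G T H ?F"
      unfolding distal_iff [OF F_closed]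
    proof (intro ballI impI)
      fix x assume x: "x \<in> carrier G" "\<forall>U. cosub U \<longrightarrow> x \<in> H <#> U <#> ?F"
      \<comment> \<open>Distality of \<open>D\<close> itself first puts \<open>x\<close> into
        \<open>D\<close>; only then can the argument inside \<open>D\<close> start.\<close>
      have "\<forall>U. cosub U \<longrightarrow> x \<in> H <#> U <#> D"
        using x(2) FD unfolding mem_set_mult_mult by blast
      then have xD: "x \<in> D" using D(3) x(1) unfolding distal_iff [OF D(1)] by blast
      show "x \<in> ?F"
      proof (rule N.stabilizer_distal [OF A])
        show "(\<lambda>y. h <#\<^bsub>?G\<^esub> y) ` A = A" if "h \<in> H" for h
          using inv that by (simp add: l_coset_consistent)
        fix W assume W: "O.over.cosub W"
        obtain U where U: "cosub U" "U \<inter> D \<subseteq> W" by (rule O.cosub_inside [OF W])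
        obtain h u f where huf: "h \<in> H" "u \<in> U" "f \<in> ?F" "x = h \<otimes> u \<otimes> f"
          using x(2) U(1) unfolding mem_set_mult_mult by blast
        have hf: "h \<in> D" "f \<in> D" using huf D(2) FD by auto
        then have G: "h \<in> carrier G" "u \<in> carrier G" "f \<in> carrier G"
          using huf(2) O.D_carrier cosub_closed(1) [OF U(1)] by auto
        \<comment> \<open>With \<open>x\<close>, \<open>h\<close> and \<open>f\<close> in
          \<open>D\<close>, the middle factor is in \<open>D\<close> too, hence in the given
          neighbourhood \<open>W\<close> of \<open>D\<close>.\<close>
        have "inv h \<otimes> x \<otimes> inv f = u"
          unfolding huf(4) using G by (simp add: m_assoc) (simp add: m_assoc [symmetric])
        moreover have "inv h \<otimes> x \<otimes> inv f \<in> D"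
          using hf xD O.D_sub by (auto intro!: subgroup.m_closed subgroup.m_inv_closed)
        ultimately have "u \<in> W" using huf(2) U(2) by auto
        then show "x \<in> H <#>\<^bsub>?G\<^esub> W <#>\<^bsub>?G\<^esub> ?F"
          unfolding O.over.mem_set_mult_mult using huf by auto
      qed
    qed
    then have "D \<subseteq> ?F" using least F_closed HF by blast
    then have "N.almost_inv A" using A by (auto simp: N.almost_inv_def N.stabilizer_def)
    then have "measure N A = 0 \<or> measure N A = 1" by (rule N.almost_inv_trivial)
    then show ?thesis by (auto simp: N.emeasure_eq_measure)
  qed
  then show ?thesis
    unfolding ergodic_closed_overgroup_def acts_ergodically_def l_coset_consistent using D N
    by (intro conjI exI [of _ N]) auto
qed

end

theorem theorem1p15:
  fixes G :: "('a, 'b) monoid_scheme" and T :: "'a topology" and H :: "'a set"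
  assumes "topological_group G T"
    and "metrizable_space T"
    and "totally_disconnected_space T"
    and "locally_compact_space T"
    and "closed_subgroup G T H"
    and "finite_covolume G T H"
  shows "(Tits_core G T \<subseteq> Dist_star G T H \<and>
          Dist_star G T H = T closure_of K_set G T H) \<and>
         (\<forall>D. (ergodic_closed_overgroup G T H D \<and>
               (\<forall>D'. ergodic_closed_overgroup G T H D' \<longrightarrow> D' \<subseteq> D)) \<longleftrightarrow>
              D = Dist_star G T H)"
proof -
  obtain M where "invariant_prob_measure G T H M" using assms by (auto simp: finite_covolume_def)
  then interpret tdlc_inv G T H M by unfold_locales (use assms in auto)
  define D where "D = Dist_star G T H"
  note D = Dist_star_least [folded D_def]
  have erg: "ergodic_closed_overgroup G T H D"
    by (rule minimal_distal_ergodic [OF D])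
  \<comment> \<open>One inclusion comes from ergodicity of \<open>D\<close>, the other from its
    distality.\<close>
  have DK: "D = T closure_of K_set G T H"
    using ergodic_overgroup_sub [OF erg] K_sub_distal [OF D(1-3)] by blast
  have "T closure_of contraction_group G T g \<subseteq> D" if "g \<in> carrier G" for g
    unfolding DK by (rule closure_of_minimal [OF contraction_sub_closure_K [OF that]]) simp
  then have "Tits_core G T \<subseteq> D"
    unfolding Tits_core_def using D(1)
    by (intro generate_subgroup_incl) (auto simp: closed_subgroup_def)
  \<comment> \<open>Every ergodic overgroup lies in the closure of \<open>K_set\<close>, which is
    \<open>D\<close>; the largest one is unique by antisymmetry of inclusion.\<close>
  moreover have "D' \<subseteq> D" if "ergodic_closed_overgroup G T H D'" for D'
    using ergodic_overgroup_sub [OF that] DK by simp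
  ultimately show ?thesis unfolding D_def [symmetric] using erg DK by blast
qed

end
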